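(* (Adequacy and Normalisation.) (1) For every closed term $\vdash t:A$ and every positive integer $i$, $[\![t]\!]_i \mathrel{R^A_i} t$. (2) If $\vdash t:\mathbf N$ and $[\![t]\!]_i=n$ then $t\twoheadrightarrow\mathsf{succ}^n\mathsf{zero}$. (3) Every closed well-typed term reduces (under $\twoheadrightarrow$) to a value.
   Context: The guarded $\lambda$-calculus ($\mathsf{g}\lambda$). Types: $A ::= \alpha \mid \mathbf{N} \mid \mathbf{1} \mid A\times A \mid \mathbf{0} \mid A+A \mid A\to A \mid \mu\alpha.A \mid \blacktriangleright A \mid \blacksquare A$. A judgement $\nabla\vdash A$ ($\nabla$ a finite set of type variables) is derived by: $\alpha\in\nabla$ gives $\nabla\vdash\alpha$; $\nabla\vdash\mathbf N,\mathbf 1,\mathbf 0$; $\times,+,\to$ are formed from well-formed components; $\nabla\vdash\mu\alpha.A$ if $\nabla,\alpha\vdash A$ and $\alpha$ is guarded in $A$ (every occurrence of $\alpha$ lies beneath an occurrence of $\blacktriangleright$); $\nabla\vdash\blacktriangleright A$ if $\nabla\vdash A$; $\nabla\vdash\blacksquare A$ if $\emptyset\vdash A$. Types are closed unless stated otherwise. A type is constant if every occurrence of $\blacktriangleright$ in it lies beneath an occurrence of $\blacksquare$. Terms: $t ::= x \mid \mathsf{zero} \mid \mathsf{succ}\,t \mid \langle\rangle \mid \langle t,t\rangle \mid \pi_1 t \mid \pi_2 t \mid \mathsf{abort}\,t \mid \mathsf{in}_1 t \mid \mathsf{in}_2 t \mid \mathsf{case}\,t\,\mathsf{of}\,x_1.t;x_2.t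 \mid \lambda x.t \mid t\,t \mid \mathsf{fold}\,t \mid \mathsf{unfold}\,t \mid \mathsf{next}\,t \mid \mathsf{prev}\,\sigma.t \mid t\circledast t \mid \mathsf{box}\,\sigma.t \mid \mathsf{unbox}\,t \mid \mathsf{box}^+\sigma.t$, where $\sigma=[x_1\leftarrow t_1,\dots,x_n\leftarrow t_n]$ is an explicit substitution binding $x_1,\dots,x_n$ in the body but not in the $t_k$; $\mathsf{prev}\,t$, $\mathsf{box}\,t$, $\mathsf{box}^+t$ denote the case $n=0$. Typing: the usual rules for variables, $\mathsf{zero}:\mathbf N$, $\mathsf{succ}$, $\langle\rangle:\mathbf 1$, pairs/projections, $\mathsf{abort}$ (from $\mathbf 0$ to any type), injections and case, abstraction and application; $\mathsf{fold}\,t:\mu\alpha.A$ if $t:A[\mu\alpha.A/\alpha]$ and $\mathsf{unfold}\,t:A[\mu\alpha.A/\alpha]$ if $t:\mu\alpha.A$; $\mathsf{next}\,t:\blacktriangleright A$ if $t:A$; $t_1\circledast t_2:\blacktriangleright B$ if $t_1:\blacktriangleright(A\to B)$, $t_2:\blacktriangleright A$; $\mathsf{unbox}\,t:A$ if $t:\blacksquare A$; and, when $A_1,\dots,A_n$ are constant and $\Gamma\vdash t_k:A_k$ for all $k$: $\Gamma\vdash\mathsf{prev}[\vec x\leftarrow\vec t].t:A$ if $x_1{:}A_1,\dots,x_n{:}A_n\vdash t:\blacktriangleright A$; $\Gamma\vdash\mathsf{box}[\vec x\leftarrow\vec t].t:\blacksquare A$ if $\vec x{:}\vec A\vdash t:A$;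 $\Gamma\vdash\mathsf{box}^+[\vec x\leftarrow\vec t].t:\blacksquare B_1+\blacksquare B_2$ if $\vec x{:}\vec A\vdash t:B_1+B_2$. Reduction rules on closed terms: $\pi_d\langle t_1,t_2\rangle\mapsto t_d$; $\mathsf{case}\,\mathsf{in}_d t\,\mathsf{of}\,x_1.t_1;x_2.t_2\mapsto t_d[t/x_d]$; $(\lambda x.t_1)t_2\mapsto t_1[t_2/x]$; $\mathsf{unfold}\,\mathsf{fold}\,t\mapsto t$; $\mathsf{prev}[\vec x\leftarrow\vec t].t\mapsto\mathsf{prev}(t[\vec t/\vec x])$ ($\vec x$ nonempty); $\mathsf{prev}\,\mathsf{next}\,t\mapsto t$; $\mathsf{next}\,t_1\circledast\mathsf{next}\,t_2\mapsto\mathsf{next}(t_1t_2)$; $\mathsf{box}[\vec x\leftarrow\vec t].t\mapsto\mathsf{box}(t[\vec t/\vec x])$ ($\vec x$ nonempty); $\mathsf{unbox}(\mathsf{box}[\vec x\leftarrow\vec t].t)\mapsto t[\vec t/\vec x]$; $\mathsf{box}^+[\vec x\leftarrow\vec t].t\mapsto\mathsf{box}^+(t[\vec t/\vec x])$ ($\vec x$ nonempty); $\mathsf{box}^+(\mathsf{in}_d t)\mapsto\mathsf{in}_d(\mathsf{box}\,t)$. Values: $\mathsf{succ}^n\mathsf{zero}$, $\langle\rangle$, $\langle t,t'\rangle$, $\mathsf{in}_d t$, $\lambda x.t$, $\mathsf{fold}\,t$, $\mathsf{next}\,t$, $\mathsf{box}\,\sigma.t$. Evaluation contexts: $E::=\cdot\mid\mathsf{succ}\,E\mid\pi_1E\mid\pi_2E\mid\mathsf{case}\,E\,\mathsf{of}\,x_1.t_1;x_2.t_2\mid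 E\,t\mid\mathsf{unfold}\,E\mid\mathsf{prev}\,E\mid E\circledast t\mid v\circledast E\ (v\text{ a value})\mid\mathsf{unbox}\,E\mid\mathsf{box}^+E$. Call-by-name reduction: $E[t]\mapsto E[u]$ whenever $t\mapsto u$ is a reduction rule; $\twoheadrightarrow$ is its reflexive–transitive closure. The topos of trees $\mathcal S$: objects $X$ are families of sets $X_1,X_2,\dots$ with restriction maps $r^X_i:X_{i+1}\to X_i$; morphisms $f:X\to Y$ are families $f_i:X_i\to Y_i$ with $f_i\circ r^X_i=r^Y_i\circ f_{i+1}$. For $i\le j$, $\restriction_i:X_j\to X_i$ is the composite restriction. Products and coproducts are pointwise; $(Y^X)_i$ is the set of tuples $(f_1,\dots,f_i)$, $f_j:X_j\to Y_j$, commuting with restrictions, restricted by projection. $\Delta Z$ has all sets $Z$ and identity restrictions; an object is constant if all its restriction maps are bijections (an element of $X_i$ is then identified with its preimages at higher stages). $\blacksquare X=\Delta(\mathrm{Hom}_{\mathcal S}(1,X))$ with $\mathsf{unbox}_i(x)=x_i$. $(\blacktriangleright X)_1=\{*\}$, $(\blacktriangleright X)_{i+1}=X_i$; $\mathsf{next}:X\to\blacktriangleright X$ has $\mathsf{next}_1$ the unique map and $\mathsf{next}_{i+1}=r^X_i$. Denotation of types: a type with $n$ free variables denotes a mixed-variance functor $(\mathcal S^{op}\times\mathcal S)^n\to\mathcal S$: variables project to their covariant argument; $[\![\mathbf N]\!]=\Delta\mathbb N$, $[\![\mathbf 1]\!]=\Delta\{*\}$, $[\![\mathbf 0]\!]=\Delta\emptyset$;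 $\times,+$ pointwise, $\to$ by exponential; $\blacktriangleright,\blacksquare$ by composing with the functors above; $[\![\mu\alpha.A]\!](\vec W)$ is the unique-up-to-isomorphism $X$ with $[\![A]\!](\vec W,X,X)\cong X$. Denotation of terms: $[\![\Gamma\vdash t:A]\!]:[\![\Gamma]\!]\to[\![A]\!]$ (contexts denote products): variables are projections; zero/succ as expected; products, sums, functions via cartesian closed and coproduct structure ($[\![\lambda x.t]\!]_i(\gamma)_j(a)=[\![t]\!]_j(\restriction_j\gamma,a)$, $[\![t_1t_2]\!]_i(\gamma)=[\![t_1]\!]_i(\gamma)_i([\![t_2]\!]_i(\gamma))$); fold/unfold via the isomorphism $[\![\mu\alpha.A]\!]\cong[\![A[\mu\alpha.A/\alpha]]\!]$; next, unbox by composing with $\mathsf{next},\mathsf{unbox}$; $[\![t_1\circledast t_2]\!]_{i+1}(\gamma)=[\![t_1]\!]_{i+1}(\gamma)_i([\![t_2]\!]_{i+1}(\gamma))$; $[\![\mathsf{prev}[\vec x\leftarrow\vec t].t]\!]_i(\gamma)=[\![t]\!]_{i+1}([\![t_1]\!]_i(\gamma),\dots)$; $[\![\mathsf{box}[\vec x\leftarrow\vec t].t]\!]_i(\gamma)$ is the global element with $j$-th component $[\![t]\!]_j([\![t_1]\!]_i(\gamma),\dots)$; $[\![\mathsf{box}^+[\vec x\leftarrow\vec t].t]\!]_i(\gamma)=[a,d]$ where $[\![t]\!]_j([\![t_1]\!]_i(\gamma),\dots)=[a_j,d]$ for all $j$ and $a$ is the global element with components $a_j$. Logical relation: for closed types $A$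 and positive integers $i$, $R^A_i$ relates $a\in[\![A]\!]_i$ to closed terms $t:A$: $n\,R^{\mathbf N}_i\,t$ iff $t\twoheadrightarrow\mathsf{succ}^n\mathsf{zero}$; $*\,R^{\mathbf 1}_i\,t$ iff $t\twoheadrightarrow\langle\rangle$; $R^{\mathbf 0}_i$ is empty; $(a_1,a_2)\,R^{A_1\times A_2}_i\,t$ iff $t\twoheadrightarrow\langle t_1,t_2\rangle$ with $a_k\,R^{A_k}_i\,t_k$; $[a,d]\,R^{A_1+A_2}_i\,t$ iff $t\twoheadrightarrow\mathsf{in}_d u$ and $a\,R^{A_d}_i\,u$; $f\,R^{A\to B}_i\,t$ iff $t\twoheadrightarrow\lambda x.s$ and for all $j\le i$, $a\,R^A_j\,u$ implies $f_j(a)\,R^B_j\,s[u/x]$; $a\,R^{\mu\alpha.A}_i\,t$ iff $t\twoheadrightarrow\mathsf{fold}\,u$ and $h_i(a)\,R^{A[\mu\alpha.A/\alpha]}_i\,u$ where $h$ is the unfold isomorphism; $a\,R^{\blacktriangleright A}_i\,t$ iff $t\twoheadrightarrow\mathsf{next}\,u$ and, if $i>1$, $a\,R^A_{i-1}\,u$; $a\,R^{\blacksquare A}_i\,t$ iff $t\twoheadrightarrow\mathsf{box}\,u$ (empty explicit substitution) and for all $j$, $a_j\,R^A_j\,u$. *)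

theory Defs
  imports Main
begin

section \<open>Ambient set theory\<close>

text \<open>
  HOL does not prove the existence of a type large enough for the objects that interpret all
  types: the hierarchy of function types over the naturals has sets of cardinality
  \<open>\<beth>\<^sub>n\<close> for every \<open>n\<close>, and the one closed type
  \<open>TBox (TMu (TProd TNat (TLater (TFun (TVar 0) (TVar 0)))))\<close> denotes a set with at least
  \<open>\<beth>\<^sub>\<omega>\<close> elements.  Sets are therefore elements of a type \<open>'v\<close> with a membership
  relation, and \<open>zf_universe TYPE('v)\<close> states the axioms of Zermelo-Fraenkel set theory for it:
  extensionality, separation, union, power set, replacement, infinity and foundation, with
  predicates and functions of HOL in separation and replacement.
\<close>

class elts =
  fixes elts :: "'a \<Rightarrow> 'a set"

definition small :: "'v::elts set \<Rightarrow> bool" where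
  "small X \<longleftrightarrow> X \<in> range elts"

definition zf_universe :: "'v::elts itself \<Rightarrow> bool" where
  "zf_universe (_ :: 'v itself) \<longleftrightarrow>
     (\<forall>x y :: 'v. elts x = elts y \<longrightarrow> x = y) \<and>
     (\<forall>X Y :: 'v set. small X \<and> Y \<subseteq> X \<longrightarrow> small Y) \<and>
     (\<forall>X :: 'v set. small X \<longrightarrow> small (\<Union> (elts ` X))) \<and>
     (\<forall>X :: 'v set. small X \<longrightarrow> small {y. elts y \<subseteq> X}) \<and>
     (\<forall>(X :: 'v set) (f :: 'v \<Rightarrow> 'v). small X \<longrightarrow> small (f ` X)) \<and>
     (\<forall>f :: nat \<Rightarrow> 'v. small (range f)) \<and>
     wf {(x, y :: 'v). x \<in> elts y}"

definition mkset :: "'v::elts set \<Rightarrow> 'v" where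
  "mkset X = inv elts X"

definition vunit :: "'v::elts" where
  "vunit = mkset {}"

definition vsucc :: "'v::elts \<Rightarrow> 'v" where
  "vsucc x = mkset (insert x (elts x))"

definition vnat :: "nat \<Rightarrow> 'v::elts" where
  "vnat n = (vsucc ^^ n) (mkset {})"

definition vpair :: "'v::elts \<Rightarrow> 'v \<Rightarrow> 'v" where
  "vpair x y = mkset {mkset {x}, mkset {x, y}}"

definition vfst :: "'v::elts \<Rightarrow> 'v" where
  "vfst p = (THE x. \<exists>y. p = vpair x y)"

definition vsnd :: "'v::elts \<Rightarrow> 'v" where
  "vsnd p = (THE y. \<exists>x. p = vpair x y)"

text \<open>\<open>vin d a\<close> with \<open>d\<close> being 1 or 2 is the element $[a,d]$ of a binary coproduct.\<close>

definition vin :: "nat \<Rightarrow> 'v::elts \<Rightarrow> 'v" where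
  "vin d a = vpair (vnat d) a"

definition vcase :: "('v::elts \<Rightarrow> 'a) \<Rightarrow> ('v \<Rightarrow> 'a) \<Rightarrow> 'v \<Rightarrow> 'a" where
  "vcase f g p = (if vfst p = vnat 1 then f (vsnd p) else g (vsnd p))"

definition vlam :: "'v::elts \<Rightarrow> ('v \<Rightarrow> 'v) \<Rightarrow> 'v" where
  "vlam X f = mkset ((\<lambda>x. vpair x (f x)) ` elts X)"

definition vapp :: "'v::elts \<Rightarrow> 'v \<Rightarrow> 'v" where
  "vapp F x = (THE y. vpair x y \<in> elts F)"

text \<open>Tuples \<open>(x\<^sub>1, \<dots>, x\<^sub>i)\<close> (index set \<open>{1..i}\<close>) and sequences \<open>(x\<^sub>1, x\<^sub>2, \<dots>)\<close> (index set \<open>{1..}\<close>).\<close>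

definition vtuple :: "nat set \<Rightarrow> (nat \<Rightarrow> 'v::elts) \<Rightarrow> 'v" where
  "vtuple J x = mkset ((\<lambda>j. vpair (vnat j) (x j)) ` J)"

definition vproj :: "'v::elts \<Rightarrow> nat \<Rightarrow> 'v" where
  "vproj F j = vapp F (vnat j)"


section \<open>The topos of trees\<close>

text \<open>Stages are the positive integers; the components at 0 carry no information.
  \<open>restr X i\<close> maps stage \<open>i + 1\<close> to stage \<open>i\<close>.\<close>

datatype 'v obj = Obj (stage: "nat \<Rightarrow> 'v") (restr: "nat \<Rightarrow> 'v \<Rightarrow> 'v")

abbreviation elts_at :: "'v::elts obj \<Rightarrow> nat \<Rightarrow> 'v set" where
  "elts_at X i \<equiv> elts (stage X i)"

definition is_obj :: "'v::elts obj \<Rightarrow> bool" where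
  "is_obj X \<longleftrightarrow> (\<forall>i\<ge>1. \<forall>x \<in> elts_at X (Suc i). restr X i x \<in> elts_at X i)"

definition is_mor :: "'v::elts obj \<Rightarrow> 'v obj \<Rightarrow> (nat \<Rightarrow> 'v \<Rightarrow> 'v) \<Rightarrow> bool" where
  "is_mor X Y f \<longleftrightarrow>
     (\<forall>i\<ge>1. \<forall>x \<in> elts_at X i. f i x \<in> elts_at Y i) \<and>
     (\<forall>i\<ge>1. \<forall>x \<in> elts_at X (Suc i). f i (restr X i x) = restr Y i (f (Suc i) x))"

definition is_iso :: "'v::elts obj \<Rightarrow> 'v obj \<Rightarrow> (nat \<Rightarrow> 'v \<Rightarrow> 'v) \<Rightarrow> bool" where
  "is_iso X Y f \<longleftrightarrow> is_mor X Y f \<and>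
     (\<exists>g. is_mor Y X g \<and>
       (\<forall>i\<ge>1. (\<forall>x \<in> elts_at X i. g i (f i x) = x) \<and> (\<forall>y \<in> elts_at Y i. f i (g i y) = y)))"

text \<open>\<open>down X i k\<close> is the composite restriction from stage \<open>i + k\<close> to stage \<open>i\<close>,
  and \<open>restrict_to X j i\<close> the one from stage \<open>j\<close> to stage \<open>i \<le> j\<close>.\<close>

primrec down :: "'v::elts obj \<Rightarrow> nat \<Rightarrow> nat \<Rightarrow> 'v \<Rightarrow> 'v" where
  "down X i 0 x = x"
| "down X i (Suc k) x = down X i k (restr X (i + k) x)"

definition restrict_to :: "'v::elts obj \<Rightarrow> nat \<Rightarrow> nat \<Rightarrow> 'v \<Rightarrow> 'v" where
  "restrict_to X j i x = down X i (j - i) x"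

text \<open>In a constant object an element of stage \<open>i\<close> is identified with its preimages at later
  stages; \<open>transport X i j\<close> sends it to the corresponding element of stage \<open>j\<close>.\<close>

definition transport :: "'v::elts obj \<Rightarrow> nat \<Rightarrow> nat \<Rightarrow> 'v \<Rightarrow> 'v" where
  "transport X i j x =
     (if j \<le> i then restrict_to X i j x else (THE y. y \<in> elts_at X j \<and> restrict_to X j i y = x))"

definition delta :: "'v::elts \<Rightarrow> 'v obj" where
  "delta Z = Obj (\<lambda>_. Z) (\<lambda>_ x. x)"

definition prod_obj :: "'v::elts obj \<Rightarrow> 'v obj \<Rightarrow> 'v obj" where
  "prod_obj X Y =
     Obj (\<lambda>i. mkset {vpair x y | x y. x \<in> elts_at X i \<and> y \<in> elts_at Y i})
         (\<lambda>i p. vpair (restr X i (vfst p)) (restr Y i (vsnd p)))"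

definition sum_obj :: "'v::elts obj \<Rightarrow> 'v obj \<Rightarrow> 'v obj" where
  "sum_obj X Y =
     Obj (\<lambda>i. mkset (vin 1 ` elts_at X i \<union> vin 2 ` elts_at Y i))
         (\<lambda>i. vcase (\<lambda>x. vin 1 (restr X i x)) (\<lambda>y. vin 2 (restr Y i y)))"

text \<open>The exponential $Y^X$.\<close>

definition exp_obj :: "'v::elts obj \<Rightarrow> 'v obj \<Rightarrow> 'v obj" where
  "exp_obj X Y =
     Obj (\<lambda>i. mkset {vtuple {1..i} (\<lambda>j. vlam (stage X j) (f j)) | f.
                (\<forall>j \<in> {1..i}. \<forall>x \<in> elts_at X j. f j x \<in> elts_at Y j) \<and>
                (\<forall>j \<in> {1..<i}. \<forall>x \<in> elts_at X (Suc j). f j (restr X j x) = restr Y j (f (Suc j) x))})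
         (\<lambda>i F. vtuple {1..i} (vproj F))"

definition later_obj :: "'v::elts obj \<Rightarrow> 'v obj" where
  "later_obj X =
     Obj (\<lambda>i. if i \<le> 1 then mkset {vunit} else stage X (i - 1))
         (\<lambda>i x. if i \<le> 1 then vunit else restr X (i - 1) x)"

text \<open>A global element $1 \to X$ is given by the sequence of its values.\<close>

definition global_elements :: "'v::elts obj \<Rightarrow> 'v" where
  "global_elements X =
     mkset {vtuple {1..} x | x. \<forall>j\<ge>1. x j \<in> elts_at X j \<and> restr X j (x (Suc j)) = x j}"

definition box_obj :: "'v::elts obj \<Rightarrow> 'v obj" where
  "box_obj X = delta (global_elements X)"

text \<open>An object \<open>X\<close> with \<open>F X \<cong> X\<close>, together with an isomorphism from \<open>X\<close> to \<open>F X\<close>.\<close>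

definition fixpoint :: "('v::elts obj \<Rightarrow> 'v obj) \<Rightarrow> 'v obj \<times> (nat \<Rightarrow> 'v \<Rightarrow> 'v)" where
  "fixpoint F = (SOME (X, h). is_obj X \<and> is_iso X (F X) h)"


section \<open>Types\<close>

text \<open>Type variables and term variables are de Bruijn indices, so that syntax is taken up to
  renaming of bound variables.\<close>

datatype ty =
    TVar nat
  | TNat
  | TOne
  | TProd ty ty
  | TZero
  | TSum ty ty
  | TFun ty ty
  | TMu ty
  | TLater ty
  | TBox ty

definition lift_ren :: "nat \<Rightarrow> (nat \<Rightarrow> nat) \<Rightarrow> nat \<Rightarrow> nat" where
  "lift_ren n r k = (if k < n then k else n + r (k - n))"

primrec tren :: "(nat \<Rightarrow> nat) \<Rightarrow> ty \<Rightarrow> ty" where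
  "tren r (TVar k) = TVar (r k)"
| "tren r TNat = TNat"
| "tren r TOne = TOne"
| "tren r (TProd A B) = TProd (tren r A) (tren r B)"
| "tren r TZero = TZero"
| "tren r (TSum A B) = TSum (tren r A) (tren r B)"
| "tren r (TFun A B) = TFun (tren r A) (tren r B)"
| "tren r (TMu A) = TMu (tren (lift_ren 1 r) A)"
| "tren r (TLater A) = TLater (tren r A)"
| "tren r (TBox A) = TBox (tren r A)"

definition lift_tsub :: "(nat \<Rightarrow> ty) \<Rightarrow> nat \<Rightarrow> ty" where
  "lift_tsub s k = (if k = 0 then TVar 0 else tren Suc (s (k - 1)))"

primrec tsub :: "(nat \<Rightarrow> ty) \<Rightarrow> ty \<Rightarrow> ty" where
  "tsub s (TVar k) = s k"
| "tsub s TNat = TNat"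
| "tsub s TOne = TOne"
| "tsub s (TProd A B) = TProd (tsub s A) (tsub s B)"
| "tsub s TZero = TZero"
| "tsub s (TSum A B) = TSum (tsub s A) (tsub s B)"
| "tsub s (TFun A B) = TFun (tsub s A) (tsub s B)"
| "tsub s (TMu A) = TMu (tsub (lift_tsub s) A)"
| "tsub s (TLater A) = TLater (tsub s A)"
| "tsub s (TBox A) = TBox (tsub s A)"

text \<open>\<open>tinst A B\<close> is $A[B/\alpha]$, where $\alpha$ is the variable with index 0 in \<open>A\<close>.\<close>

definition tinst :: "ty \<Rightarrow> ty \<Rightarrow> ty" where
  "tinst A B = tsub (\<lambda>k. if k = 0 then B else TVar (k - 1)) A"

text \<open>Every occurrence of variable \<open>k\<close> lies beneath an occurrence of \<open>TLater\<close>.\<close>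

primrec guarded :: "nat \<Rightarrow> ty \<Rightarrow> bool" where
  "guarded k (TVar j) \<longleftrightarrow> j \<noteq> k"
| "guarded k TNat \<longleftrightarrow> True"
| "guarded k TOne \<longleftrightarrow> True"
| "guarded k (TProd A B) \<longleftrightarrow> guarded k A \<and> guarded k B"
| "guarded k TZero \<longleftrightarrow> True"
| "guarded k (TSum A B) \<longleftrightarrow> guarded k A \<and> guarded k B"
| "guarded k (TFun A B) \<longleftrightarrow> guarded k A \<and> guarded k B"
| "guarded k (TMu A) \<longleftrightarrow> guarded (Suc k) A"
| "guarded k (TLater A) \<longleftrightarrow> True"
| "guarded k (TBox A) \<longleftrightarrow> guarded k A"

text \<open>The judgement $\nabla \vdash A$, with $\nabla$ the first \<open>n\<close> variables.\<close>

inductive wf_ty :: "nat \<Rightarrow> ty \<Rightarrow> bool" where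
  wf_TVar: "k < n \<Longrightarrow> wf_ty n (TVar k)"
| wf_TNat: "wf_ty n TNat"
| wf_TOne: "wf_ty n TOne"
| wf_TProd: "wf_ty n A \<Longrightarrow> wf_ty n B \<Longrightarrow> wf_ty n (TProd A B)"
| wf_TZero: "wf_ty n TZero"
| wf_TSum: "wf_ty n A \<Longrightarrow> wf_ty n B \<Longrightarrow> wf_ty n (TSum A B)"
| wf_TFun: "wf_ty n A \<Longrightarrow> wf_ty n B \<Longrightarrow> wf_ty n (TFun A B)"
| wf_TMu: "wf_ty (Suc n) A \<Longrightarrow> guarded 0 A \<Longrightarrow> wf_ty n (TMu A)"
| wf_TLater: "wf_ty n A \<Longrightarrow> wf_ty n (TLater A)"
| wf_TBox: "wf_ty 0 A \<Longrightarrow> wf_ty n (TBox A)"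

text \<open>Every occurrence of \<open>TLater\<close> lies beneath an occurrence of \<open>TBox\<close>.\<close>

primrec const_ty :: "ty \<Rightarrow> bool" where
  "const_ty (TVar k) \<longleftrightarrow> True"
| "const_ty TNat \<longleftrightarrow> True"
| "const_ty TOne \<longleftrightarrow> True"
| "const_ty (TProd A B) \<longleftrightarrow> const_ty A \<and> const_ty B"
| "const_ty TZero \<longleftrightarrow> True"
| "const_ty (TSum A B) \<longleftrightarrow> const_ty A \<and> const_ty B"
| "const_ty (TFun A B) \<longleftrightarrow> const_ty A \<and> const_ty B"
| "const_ty (TMu A) \<longleftrightarrow> const_ty A"
| "const_ty (TLater A) \<longleftrightarrow> False"
| "const_ty (TBox A) \<longleftrightarrow> True"

text \<open>The environment lists, for each free type variable, its contravariant and its covariant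
  argument; the domain of an exponential swaps the two.\<close>

primrec tden :: "ty \<Rightarrow> ('v::elts obj \<times> 'v obj) list \<Rightarrow> 'v obj" where
  "tden (TVar k) W = snd (W ! k)"
| "tden TNat W = delta (mkset (range vnat))"
| "tden TOne W = delta (mkset {vunit})"
| "tden (TProd A B) W = prod_obj (tden A W) (tden B W)"
| "tden TZero W = delta (mkset {})"
| "tden (TSum A B) W = sum_obj (tden A W) (tden B W)"
| "tden (TFun A B) W = exp_obj (tden A (map prod.swap W)) (tden B W)"
| "tden (TMu A) W = fst (fixpoint (\<lambda>X. tden A ((X, X) # W)))"
| "tden (TLater A) W = later_obj (tden A W)"
| "tden (TBox A) W = box_obj (tden A W)"

abbreviation cden :: "ty \<Rightarrow> 'v::elts obj" where
  "cden A \<equiv> tden A []"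

text \<open>The isomorphism from the denotation of \<open>TMu A\<close> to that of its unfolding
  \<open>tinst A (TMu A)\<close>, which is \<open>tden A\<close> applied to the denotation of \<open>TMu A\<close>.\<close>

definition unfold_iso :: "ty \<Rightarrow> nat \<Rightarrow> 'v::elts \<Rightarrow> 'v" where
  "unfold_iso A = snd (fixpoint (\<lambda>X. tden A [(X, X)]))"

definition fold_iso :: "ty \<Rightarrow> nat \<Rightarrow> 'v::elts \<Rightarrow> 'v" where
  "fold_iso A i = inv_into (elts_at (cden (TMu A)) i) (unfold_iso A i)"


section \<open>Terms\<close>

text \<open>In \<open>Prev \<sigma> t\<close>, \<open>Box \<sigma> t\<close> and \<open>BoxP \<sigma> t\<close> the explicit substitution
  $[x_1 \leftarrow t_1, \dots, x_n \leftarrow t_n]$ is the list of the $t_k$; it binds the indices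
  \<open>0, \<dots>, n - 1\<close> in the body, with $x_{k+1}$ being index \<open>k\<close>.\<close>

datatype tm =
    Var nat
  | Zero
  | Succ tm
  | Unit
  | MkPair tm tm
  | Proj1 tm
  | Proj2 tm
  | Abort tm
  | In1 tm
  | In2 tm
  | Case tm tm tm
  | Lam tm
  | App tm tm
  | Fold tm
  | Unfold tm
  | Next tm
  | Prev "tm list" tm
  | Ast tm tm
  | Box "tm list" tm
  | Unbox tm
  | BoxP "tm list" tm

fun ren :: "(nat \<Rightarrow> nat) \<Rightarrow> tm \<Rightarrow> tm" where
  "ren r (Var k) = Var (r k)"
| "ren r Zero = Zero"
| "ren r (Succ t) = Succ (ren r t)"
| "ren r Unit = Unit"
| "ren r (MkPair t u) = MkPair (ren r t) (ren r u)"
| "ren r (Proj1 t) = Proj1 (ren r t)"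
| "ren r (Proj2 t) = Proj2 (ren r t)"
| "ren r (Abort t) = Abort (ren r t)"
| "ren r (In1 t) = In1 (ren r t)"
| "ren r (In2 t) = In2 (ren r t)"
| "ren r (Case t u v) = Case (ren r t) (ren (lift_ren 1 r) u) (ren (lift_ren 1 r) v)"
| "ren r (Lam t) = Lam (ren (lift_ren 1 r) t)"
| "ren r (App t u) = App (ren r t) (ren r u)"
| "ren r (Fold t) = Fold (ren r t)"
| "ren r (Unfold t) = Unfold (ren r t)"
| "ren r (Next t) = Next (ren r t)"
| "ren r (Prev \<sigma> t) = Prev (map (ren r) \<sigma>) (ren (lift_ren (length \<sigma>) r) t)"
| "ren r (Ast t u) = Ast (ren r t) (ren r u)"
| "ren r (Box \<sigma> t) = Box (map (ren r) \<sigma>) (ren (lift_ren (length \<sigma>) r) t)"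
| "ren r (Unbox t) = Unbox (ren r t)"
| "ren r (BoxP \<sigma> t) = BoxP (map (ren r) \<sigma>) (ren (lift_ren (length \<sigma>) r) t)"

definition lift_sub :: "nat \<Rightarrow> (nat \<Rightarrow> tm) \<Rightarrow> nat \<Rightarrow> tm" where
  "lift_sub n s k = (if k < n then Var k else ren (\<lambda>m. n + m) (s (k - n)))"

fun sub :: "(nat \<Rightarrow> tm) \<Rightarrow> tm \<Rightarrow> tm" where
  "sub s (Var k) = s k"
| "sub s Zero = Zero"
| "sub s (Succ t) = Succ (sub s t)"
| "sub s Unit = Unit"
| "sub s (MkPair t u) = MkPair (sub s t) (sub s u)"
| "sub s (Proj1 t) = Proj1 (sub s t)"
| "sub s (Proj2 t) = Proj2 (sub s t)"
| "sub s (Abort t) = Abort (sub s t)"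
| "sub s (In1 t) = In1 (sub s t)"
| "sub s (In2 t) = In2 (sub s t)"
| "sub s (Case t u v) = Case (sub s t) (sub (lift_sub 1 s) u) (sub (lift_sub 1 s) v)"
| "sub s (Lam t) = Lam (sub (lift_sub 1 s) t)"
| "sub s (App t u) = App (sub s t) (sub s u)"
| "sub s (Fold t) = Fold (sub s t)"
| "sub s (Unfold t) = Unfold (sub s t)"
| "sub s (Next t) = Next (sub s t)"
| "sub s (Prev \<sigma> t) = Prev (map (sub s) \<sigma>) (sub (lift_sub (length \<sigma>) s) t)"
| "sub s (Ast t u) = Ast (sub s t) (sub s u)"
| "sub s (Box \<sigma> t) = Box (map (sub s) \<sigma>) (sub (lift_sub (length \<sigma>) s) t)"
| "sub s (Unbox t) = Unbox (sub s t)"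
| "sub s (BoxP \<sigma> t) = BoxP (map (sub s) \<sigma>) (sub (lift_sub (length \<sigma>) s) t)"

text \<open>\<open>inst t us\<close> is the simultaneous substitution $t[\vec u/\vec x]$ for the first
  \<open>length us\<close> indices.\<close>

definition inst :: "tm \<Rightarrow> tm list \<Rightarrow> tm" where
  "inst t us = sub (\<lambda>k. if k < length us then us ! k else Var (k - length us)) t"

text \<open>Types in judgements are closed, so a rule that introduces a type not occurring in its
  premises requires that type to be well-formed in the empty context.\<close>

inductive typing :: "ty list \<Rightarrow> tm \<Rightarrow> ty \<Rightarrow> bool" ("_ \<turnstile> _ \<Ztypecolon> _" [50, 50, 50] 50) where
  ty_Var: "k < length \<Gamma> \<Longrightarrow> wf_ty 0 (\<Gamma> ! k) \<Longrightarrow> \<Gamma> \<turnstile> Var k \<Ztypecolon> \<Gamma> ! k"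
| ty_Zero: "\<Gamma> \<turnstile> Zero \<Ztypecolon> TNat"
| ty_Succ: "\<Gamma> \<turnstile> t \<Ztypecolon> TNat \<Longrightarrow> \<Gamma> \<turnstile> Succ t \<Ztypecolon> TNat"
| ty_Unit: "\<Gamma> \<turnstile> Unit \<Ztypecolon> TOne"
| ty_Pair: "\<Gamma> \<turnstile> t \<Ztypecolon> A \<Longrightarrow> \<Gamma> \<turnstile> u \<Ztypecolon> B \<Longrightarrow> \<Gamma> \<turnstile> MkPair t u \<Ztypecolon> TProd A B"
| ty_Proj1: "\<Gamma> \<turnstile> t \<Ztypecolon> TProd A B \<Longrightarrow> \<Gamma> \<turnstile> Proj1 t \<Ztypecolon> A"
| ty_Proj2: "\<Gamma> \<turnstile> t \<Ztypecolon> TProd A B \<Longrightarrow> \<Gamma> \<turnstile> Proj2 t \<Ztypecolon> B"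
| ty_Abort: "\<Gamma> \<turnstile> t \<Ztypecolon> TZero \<Longrightarrow> wf_ty 0 A \<Longrightarrow> \<Gamma> \<turnstile> Abort t \<Ztypecolon> A"
| ty_In1: "\<Gamma> \<turnstile> t \<Ztypecolon> A \<Longrightarrow> wf_ty 0 B \<Longrightarrow> \<Gamma> \<turnstile> In1 t \<Ztypecolon> TSum A B"
| ty_In2: "\<Gamma> \<turnstile> t \<Ztypecolon> B \<Longrightarrow> wf_ty 0 A \<Longrightarrow> \<Gamma> \<turnstile> In2 t \<Ztypecolon> TSum A B"
| ty_Case: "\<Gamma> \<turnstile> t \<Ztypecolon> TSum A B \<Longrightarrow> A # \<Gamma> \<turnstile> u \<Ztypecolon> C \<Longrightarrow> B # \<Gamma> \<turnstile> v \<Ztypecolon> C \<Longrightarrow>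
    \<Gamma> \<turnstile> Case t u v \<Ztypecolon> C"
| ty_Lam: "A # \<Gamma> \<turnstile> t \<Ztypecolon> B \<Longrightarrow> wf_ty 0 A \<Longrightarrow> \<Gamma> \<turnstile> Lam t \<Ztypecolon> TFun A B"
| ty_App: "\<Gamma> \<turnstile> t \<Ztypecolon> TFun A B \<Longrightarrow> \<Gamma> \<turnstile> u \<Ztypecolon> A \<Longrightarrow> \<Gamma> \<turnstile> App t u \<Ztypecolon> B"
| ty_Fold: "\<Gamma> \<turnstile> t \<Ztypecolon> tinst A (TMu A) \<Longrightarrow> wf_ty 0 (TMu A) \<Longrightarrow> \<Gamma> \<turnstile> Fold t \<Ztypecolon> TMu A"
| ty_Unfold: "\<Gamma> \<turnstile> t \<Ztypecolon> TMu A \<Longrightarrow> \<Gamma> \<turnstile> Unfold t \<Ztypecolon> tinst A (TMu A)"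
| ty_Next: "\<Gamma> \<turnstile> t \<Ztypecolon> A \<Longrightarrow> \<Gamma> \<turnstile> Next t \<Ztypecolon> TLater A"
| ty_Prev: "length As = length \<sigma> \<Longrightarrow>
    \<forall>k < length \<sigma>. const_ty (As ! k) \<and> \<Gamma> \<turnstile> \<sigma> ! k \<Ztypecolon> As ! k \<Longrightarrow>
    As \<turnstile> t \<Ztypecolon> TLater A \<Longrightarrow> \<Gamma> \<turnstile> Prev \<sigma> t \<Ztypecolon> A"
| ty_Ast: "\<Gamma> \<turnstile> t \<Ztypecolon> TLater (TFun A B) \<Longrightarrow> \<Gamma> \<turnstile> u \<Ztypecolon> TLater A \<Longrightarrow> \<Gamma> \<turnstile> Ast t u \<Ztypecolon> TLater B"
| ty_Box: "length As = length \<sigma> \<Longrightarrow>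
    \<forall>k < length \<sigma>. const_ty (As ! k) \<and> \<Gamma> \<turnstile> \<sigma> ! k \<Ztypecolon> As ! k \<Longrightarrow>
    As \<turnstile> t \<Ztypecolon> A \<Longrightarrow> \<Gamma> \<turnstile> Box \<sigma> t \<Ztypecolon> TBox A"
| ty_Unbox: "\<Gamma> \<turnstile> t \<Ztypecolon> TBox A \<Longrightarrow> \<Gamma> \<turnstile> Unbox t \<Ztypecolon> A"
| ty_BoxP: "length As = length \<sigma> \<Longrightarrow>
    \<forall>k < length \<sigma>. const_ty (As ! k) \<and> \<Gamma> \<turnstile> \<sigma> ! k \<Ztypecolon> As ! k \<Longrightarrow>
    As \<turnstile> t \<Ztypecolon> TSum A B \<Longrightarrow> \<Gamma> \<turnstile> BoxP \<sigma> t \<Ztypecolon> TSum (TBox A) (TBox B)"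


section \<open>Reduction\<close>

inductive redex :: "tm \<Rightarrow> tm \<Rightarrow> bool" where
  "redex (Proj1 (MkPair t u)) t"
| "redex (Proj2 (MkPair t u)) u"
| "redex (Case (In1 t) u v) (inst u [t])"
| "redex (Case (In2 t) u v) (inst v [t])"
| "redex (App (Lam t) u) (inst t [u])"
| "redex (Unfold (Fold t)) t"
| "\<sigma> \<noteq> [] \<Longrightarrow> redex (Prev \<sigma> t) (Prev [] (inst t \<sigma>))"
| "redex (Prev [] (Next t)) t"
| "redex (Ast (Next t) (Next u)) (Next (App t u))"
| "\<sigma> \<noteq> [] \<Longrightarrow> redex (Box \<sigma> t) (Box [] (inst t \<sigma>))"
| "redex (Unbox (Box \<sigma> t)) (inst t \<sigma>)"
| "\<sigma> \<noteq> [] \<Longrightarrow> redex (BoxP \<sigma> t) (BoxP [] (inst t \<sigma>))"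
| "redex (BoxP [] (In1 t)) (In1 (Box [] t))"
| "redex (BoxP [] (In2 t)) (In2 (Box [] t))"

inductive val :: "tm \<Rightarrow> bool" where
  "val ((Succ ^^ n) Zero)"
| "val Unit"
| "val (MkPair t u)"
| "val (In1 t)"
| "val (In2 t)"
| "val (Lam t)"
| "val (Fold t)"
| "val (Next t)"
| "val (Box \<sigma> t)"

text \<open>An evaluation context is represented by the function that fills its hole.\<close>

inductive ectx :: "(tm \<Rightarrow> tm) \<Rightarrow> bool" where
  "ectx (\<lambda>x. x)"
| "ectx E \<Longrightarrow> ectx (\<lambda>x. Succ (E x))"
| "ectx E \<Longrightarrow> ectx (\<lambda>x. Proj1 (E x))"
| "ectx E \<Longrightarrow> ectx (\<lambda>x. Proj2 (E x))"
| "ectx E \<Longrightarrow> ectx (\<lambda>x. Case (E x) u v)"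
| "ectx E \<Longrightarrow> ectx (\<lambda>x. App (E x) t)"
| "ectx E \<Longrightarrow> ectx (\<lambda>x. Unfold (E x))"
| "ectx E \<Longrightarrow> ectx (\<lambda>x. Prev [] (E x))"
| "ectx E \<Longrightarrow> ectx (\<lambda>x. Ast (E x) t)"
| "ectx E \<Longrightarrow> val v \<Longrightarrow> ectx (\<lambda>x. Ast v (E x))"
| "ectx E \<Longrightarrow> ectx (\<lambda>x. Unbox (E x))"
| "ectx E \<Longrightarrow> ectx (\<lambda>x. BoxP [] (E x))"

inductive step :: "tm \<Rightarrow> tm \<Rightarrow> bool" where
  "ectx E \<Longrightarrow> redex t u \<Longrightarrow> step (E t) (E u)"

abbreviation steps :: "tm \<Rightarrow> tm \<Rightarrow> bool" (infix "\<Zsurj>" 50) where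
  "t \<Zsurj> u \<equiv> step\<^sup>*\<^sup>* t u"


section \<open>Denotation of terms\<close>

text \<open>Elements of the denotation of a context at stage \<open>i\<close> are lists, indexed like the
  context.  \<open>restrict_env\<close> and \<open>transport_env\<close> act on them componentwise.\<close>

definition restrict_env :: "ty list \<Rightarrow> nat \<Rightarrow> nat \<Rightarrow> 'v::elts list \<Rightarrow> 'v list" where
  "restrict_env \<Gamma> i j \<gamma> = map2 (\<lambda>A x. restrict_to (cden A) i j x) \<Gamma> \<gamma>"

definition transport_env :: "ty list \<Rightarrow> nat \<Rightarrow> nat \<Rightarrow> 'v::elts list \<Rightarrow> 'v list" where
  "transport_env \<Gamma> i j \<gamma> = map2 (\<lambda>A x. transport (cden A) i j x) \<Gamma> \<gamma>"

text \<open>\<open>denotes \<Gamma> t A f\<close>: some derivation of $\Gamma \vdash t : A$ has denotation \<open>f\<close>, where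
  \<open>f i \<gamma>\<close> is its value at stage \<open>i\<close> and \<open>\<gamma>\<close>.  A relation is used because terms carry no type
  annotations, so that a judgement may have several derivations.\<close>

inductive denotes :: "ty list \<Rightarrow> tm \<Rightarrow> ty \<Rightarrow> (nat \<Rightarrow> 'v::elts list \<Rightarrow> 'v) \<Rightarrow> bool" where
  den_Var: "k < length \<Gamma> \<Longrightarrow> wf_ty 0 (\<Gamma> ! k) \<Longrightarrow>
    denotes \<Gamma> (Var k) (\<Gamma> ! k) (\<lambda>i \<gamma>. \<gamma> ! k)"
| den_Zero: "denotes \<Gamma> Zero TNat (\<lambda>i \<gamma>. vnat 0)"
| den_Succ: "denotes \<Gamma> t TNat f \<Longrightarrow> denotes \<Gamma> (Succ t) TNat (\<lambda>i \<gamma>. vsucc (f i \<gamma>))"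
| den_Unit: "denotes \<Gamma> Unit TOne (\<lambda>i \<gamma>. vunit)"
| den_Pair: "denotes \<Gamma> t A f \<Longrightarrow> denotes \<Gamma> u B g \<Longrightarrow>
    denotes \<Gamma> (MkPair t u) (TProd A B) (\<lambda>i \<gamma>. vpair (f i \<gamma>) (g i \<gamma>))"
| den_Proj1: "denotes \<Gamma> t (TProd A B) f \<Longrightarrow> denotes \<Gamma> (Proj1 t) A (\<lambda>i \<gamma>. vfst (f i \<gamma>))"
| den_Proj2: "denotes \<Gamma> t (TProd A B) f \<Longrightarrow> denotes \<Gamma> (Proj2 t) B (\<lambda>i \<gamma>. vsnd (f i \<gamma>))"
| den_Abort: "denotes \<Gamma> t TZero f \<Longrightarrow> wf_ty 0 A \<Longrightarrow>
    denotes \<Gamma> (Abort t) A (\<lambda>i \<gamma>. undefined)" \<comment> \<open>\<open>f i \<gamma>\<close> would be an element of the empty set\<close>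
| den_In1: "denotes \<Gamma> t A f \<Longrightarrow> wf_ty 0 B \<Longrightarrow>
    denotes \<Gamma> (In1 t) (TSum A B) (\<lambda>i \<gamma>. vin 1 (f i \<gamma>))"
| den_In2: "denotes \<Gamma> t B f \<Longrightarrow> wf_ty 0 A \<Longrightarrow>
    denotes \<Gamma> (In2 t) (TSum A B) (\<lambda>i \<gamma>. vin 2 (f i \<gamma>))"
| den_Case: "denotes \<Gamma> t (TSum A B) f \<Longrightarrow> denotes (A # \<Gamma>) u C g \<Longrightarrow> denotes (B # \<Gamma>) v C h \<Longrightarrow>
    denotes \<Gamma> (Case t u v) C (\<lambda>i \<gamma>. vcase (\<lambda>a. g i (a # \<gamma>)) (\<lambda>b. h i (b # \<gamma>)) (f i \<gamma>))"
| den_Lam: "denotes (A # \<Gamma>) t B f \<Longrightarrow> wf_ty 0 A \<Longrightarrow>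
    denotes \<Gamma> (Lam t) (TFun A B)
      (\<lambda>i \<gamma>. vtuple {1..i} (\<lambda>j. vlam (stage (cden A) j) (\<lambda>a. f j (a # restrict_env \<Gamma> i j \<gamma>))))"
| den_App: "denotes \<Gamma> t (TFun A B) f \<Longrightarrow> denotes \<Gamma> u A g \<Longrightarrow>
    denotes \<Gamma> (App t u) B (\<lambda>i \<gamma>. vapp (vproj (f i \<gamma>) i) (g i \<gamma>))"
| den_Fold: "denotes \<Gamma> t (tinst A (TMu A)) f \<Longrightarrow> wf_ty 0 (TMu A) \<Longrightarrow>
    denotes \<Gamma> (Fold t) (TMu A) (\<lambda>i \<gamma>. fold_iso A i (f i \<gamma>))"
| den_Unfold: "denotes \<Gamma> t (TMu A) f \<Longrightarrow>
    denotes \<Gamma> (Unfold t) (tinst A (TMu A)) (\<lambda>i \<gamma>. unfold_iso A i (f i \<gamma>))"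
| den_Next: "denotes \<Gamma> t A f \<Longrightarrow>
    denotes \<Gamma> (Next t) (TLater A)
      (\<lambda>i \<gamma>. if i \<le> 1 then vunit else restr (cden A) (i - 1) (f i \<gamma>))"
| den_Prev: "length As = length \<sigma> \<Longrightarrow> length fs = length \<sigma> \<Longrightarrow>
    \<forall>k < length \<sigma>. const_ty (As ! k) \<and> denotes \<Gamma> (\<sigma> ! k) (As ! k) (fs ! k) \<Longrightarrow>
    denotes As t (TLater A) f \<Longrightarrow>
    denotes \<Gamma> (Prev \<sigma> t) A
      (\<lambda>i \<gamma>. f (Suc i) (transport_env As i (Suc i) (map (\<lambda>g. g i \<gamma>) fs)))"
| den_Ast: "denotes \<Gamma> t (TLater (TFun A B)) f \<Longrightarrow> denotes \<Gamma> u (TLater A) g \<Longrightarrow>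
    denotes \<Gamma> (Ast t u) (TLater B)
      (\<lambda>i \<gamma>. if i \<le> 1 then vunit else vapp (vproj (f i \<gamma>) (i - 1)) (g i \<gamma>))"
| den_Box: "length As = length \<sigma> \<Longrightarrow> length fs = length \<sigma> \<Longrightarrow>
    \<forall>k < length \<sigma>. const_ty (As ! k) \<and> denotes \<Gamma> (\<sigma> ! k) (As ! k) (fs ! k) \<Longrightarrow>
    denotes As t A f \<Longrightarrow>
    denotes \<Gamma> (Box \<sigma> t) (TBox A)
      (\<lambda>i \<gamma>. vtuple {1..} (\<lambda>j. f j (transport_env As i j (map (\<lambda>g. g i \<gamma>) fs))))"
| den_Unbox: "denotes \<Gamma> t (TBox A) f \<Longrightarrow> denotes \<Gamma> (Unbox t) A (\<lambda>i \<gamma>. vproj (f i \<gamma>) i)"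
| den_BoxP: "length As = length \<sigma> \<Longrightarrow> length fs = length \<sigma> \<Longrightarrow>
    \<forall>k < length \<sigma>. const_ty (As ! k) \<and> denotes \<Gamma> (\<sigma> ! k) (As ! k) (fs ! k) \<Longrightarrow>
    denotes As t (TSum A B) f \<Longrightarrow>
    denotes \<Gamma> (BoxP \<sigma> t) (TSum (TBox A) (TBox B))
      (\<lambda>i \<gamma>. THE b. \<exists>d a.
         (\<forall>j\<ge>1. f j (transport_env As i j (map (\<lambda>g. g i \<gamma>) fs)) = vin d (a j)) \<and>
         b = vin d (vtuple {1..} a))"


section \<open>The logical relation\<close>

text \<open>The relation is defined by recursion on, lexicographically, the nesting depth of \<open>TBox\<close>,
  the stage, and the size of the part of the type that is not beneath \<open>TLater\<close> or \<open>TBox\<close>.\<close>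

primrec box_depth :: "ty \<Rightarrow> nat" where
  "box_depth (TVar k) = 0"
| "box_depth TNat = 0"
| "box_depth TOne = 0"
| "box_depth (TProd A B) = max (box_depth A) (box_depth B)"
| "box_depth TZero = 0"
| "box_depth (TSum A B) = max (box_depth A) (box_depth B)"
| "box_depth (TFun A B) = max (box_depth A) (box_depth B)"
| "box_depth (TMu A) = box_depth A"
| "box_depth (TLater A) = box_depth A"
| "box_depth (TBox A) = Suc (box_depth A)"

primrec usize :: "ty \<Rightarrow> nat" where
  "usize (TVar k) = 1"
| "usize TNat = 1"
| "usize TOne = 1"
| "usize (TProd A B) = Suc (usize A + usize B)"
| "usize TZero = 1"
| "usize (TSum A B) = Suc (usize A + usize B)"
| "usize (TFun A B) = Suc (usize A + usize B)"
| "usize (TMu A) = Suc (usize A)"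
| "usize (TLater A) = 1"
| "usize (TBox A) = 1"

lemma box_depth_tren [simp]: "box_depth (tren r A) = box_depth A"
  by (induction A arbitrary: r) auto

lemma usize_tren [simp]: "usize (tren r A) = usize A"
  by (induction A arbitrary: r) auto

lemma box_depth_tsub:
  "wf_ty n A \<Longrightarrow> box_depth A \<le> m \<Longrightarrow> \<forall>k<n. box_depth (s k) \<le> m \<Longrightarrow> box_depth (tsub s A) \<le> m"
proof (induction n A arbitrary: s m rule: wf_ty.induct)
  case (wf_TMu n A)
  have "\<forall>k<Suc n. box_depth (lift_tsub s k) \<le> m"
    using wf_TMu.prems(2) by (auto simp: lift_tsub_def)
  then show ?case using wf_TMu by simp
next
  case (wf_TBox A n)
  show ?case using wf_TBox.IH[of "box_depth A" s] wf_TBox.prems by simp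
qed auto

lemma usize_tsub:
  "\<forall>k. \<not> guarded k A \<longrightarrow> usize (s k) = 1 \<Longrightarrow> usize (tsub s A) = usize A"
proof (induction A arbitrary: s)
  case (TMu A)
  have "\<forall>k. \<not> guarded k A \<longrightarrow> usize (lift_tsub s k) = 1"
  proof (intro allI impI)
    fix k assume k: "\<not> guarded k A"
    show "usize (lift_tsub s k) = 1"
      using k TMu.prems by (cases k) (auto simp: lift_tsub_def)
  qed
  then show ?case using TMu.IH by simp
qed auto

lemma unfolding_decreases:
  assumes "wf_ty 0 (TMu A)"
  shows "box_depth (tinst A (TMu A)) \<le> box_depth (TMu A)"
    and "usize (tinst A (TMu A)) < usize (TMu A)"
proof -
  from assms have wf: "wf_ty (Suc 0) A" and g: "guarded 0 A"
    by (auto elim: wf_ty.cases)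
  show "box_depth (tinst A (TMu A)) \<le> box_depth (TMu A)"
    unfolding tinst_def by (rule box_depth_tsub[OF wf]) auto
  have "usize (tinst A (TMu A)) = usize A"
    unfolding tinst_def using g by (intro usize_tsub) auto
  then show "usize (tinst A (TMu A)) < usize (TMu A)"
    by simp
qed

text \<open>\<open>in_dom A i a t\<close>: the relation at \<open>A\<close> and \<open>i\<close> may relate \<open>a\<close> and \<open>t\<close> at all.\<close>

definition in_dom :: "ty \<Rightarrow> nat \<Rightarrow> 'v::elts \<Rightarrow> tm \<Rightarrow> bool" where
  "in_dom A i a t \<longleftrightarrow> wf_ty 0 A \<and> 1 \<le> i \<and> a \<in> elts_at (cden A) i \<and> [] \<turnstile> t \<Ztypecolon> A"

context
  notes conj_cong [fundef_cong]
begin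

function (sequential) logrel :: "ty \<Rightarrow> nat \<Rightarrow> 'v::elts \<Rightarrow> tm \<Rightarrow> bool" where
  "logrel (TVar k) i a t \<longleftrightarrow> False"
| "logrel TNat i a t \<longleftrightarrow> in_dom TNat i a t \<and>
     (\<exists>n. a = vnat n \<and> t \<Zsurj> (Succ ^^ n) Zero)"
| "logrel TOne i a t \<longleftrightarrow> in_dom TOne i a t \<and> t \<Zsurj> Unit"
| "logrel TZero i a t \<longleftrightarrow> False"
| "logrel (TProd A B) i a t \<longleftrightarrow> in_dom (TProd A B) i a t \<and>
     (\<exists>a1 a2 t1 t2. a = vpair a1 a2 \<and> t \<Zsurj> MkPair t1 t2 \<and> logrel A i a1 t1 \<and> logrel B i a2 t2)"
| "logrel (TSum A B) i a t \<longleftrightarrow> in_dom (TSum A B) i a t \<and>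
     ((\<exists>b u. a = vin 1 b \<and> t \<Zsurj> In1 u \<and> logrel A i b u) \<or>
      (\<exists>b u. a = vin 2 b \<and> t \<Zsurj> In2 u \<and> logrel B i b u))"
| "logrel (TFun A B) i a t \<longleftrightarrow> in_dom (TFun A B) i a t \<and>
     (\<exists>s. t \<Zsurj> Lam s \<and>
       (\<forall>j \<in> {1..i}. \<forall>b u. logrel A j b u \<longrightarrow> logrel B j (vapp (vproj a j) b) (inst s [u])))"
| "logrel (TMu A) i a t \<longleftrightarrow> in_dom (TMu A) i a t \<and>
     (\<exists>u. t \<Zsurj> Fold u \<and> logrel (tinst A (TMu A)) i (unfold_iso A i a) u)"
| "logrel (TLater A) i a t \<longleftrightarrow> in_dom (TLater A) i a t \<and>
     (\<exists>u. t \<Zsurj> Next u \<and> (i > 1 \<longrightarrow> logrel A (i - 1) a u))"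
| "logrel (TBox A) i a t \<longleftrightarrow> in_dom (TBox A) i a t \<and>
     (\<exists>u. t \<Zsurj> Box [] u \<and> (\<forall>j \<in> {1..}. logrel A j (vproj a j) u))"
  by pat_completeness auto
termination
  by (relation "inv_image (less_than <*lex*> less_than <*lex*> less_than)
        (\<lambda>(A, i, a, t). (box_depth A, i, usize A))")
     (auto simp: in_dom_def less_le dest: unfolding_decreases)

end

end

theory Submission
  imports Defs
begin

text \<open>
  Adequacy is the fundamental lemma of the logical relation: if \<open>\<gamma>\<close> is related to a closing
  substitution \<open>s\<close> at stage \<open>i\<close>, then the value of \<open>t\<close> at \<open>i\<close> and \<open>\<gamma>\<close> is related to \<open>sub s t\<close>.  The
  explicit substitutions of \<open>Prev\<close>, \<open>Box\<close> and \<open>BoxP\<close> move to other stages, which is possible because at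
  constant types the relation does not depend on the stage.  For \<open>BoxP\<close> the terms obtained at the
  different stages must coincide, which follows from confluence of reduction.

  The denotation of \<open>TMu A\<close> is an arbitrary solution of its equation, so that solutions have to be
  shown to exist for nested recursive types, whose inner solutions were chosen arbitrarily for each
  argument.  Types are therefore compared with an interpretation that has solutions on the nose;
  contractiveness yields the comparison stage by stage.

  Normalisation may not rely on a model.  It follows from the same argument for the
  unary predicate on terms that remains of the logical relation when denotations are erased.
\<close>

text \<open>The obstacle with recursive types is that \<open>fixpoint\<close> makes a choice. Two
  arguments that agree up to some stage may be given inner solutions whose underlying sets have
  nothing in common. Read through \<open>tden\<close>, the operator of a guarded type is therefore
  contractive only up to isomorphism, and its literal iterates need not converge. Composing
  isomorphisms through arrows would call for maps in both directions at every type; a relation that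
  is bijective up to stage n passes through an arrow as it stands, and turning it round gives the
  other direction.

  A judgement may have several denotations. The fundamental lemma is an induction on
  \<open>denotes\<close>, so it speaks of each of them, and \<open>typing_denotes\<close> adds that
  there is one.

  Well-typedness is part of \<open>logrel\<close>. A term reached by reduction takes its type from
  there, while a term obtained by expansion takes it from the closing substitution.\<close>

declare One_nat_def [simp del]

section \<open>Sets and objects\<close>

text \<open>The global elements of X as plain sequences, before their coding by
  \<open>vtuple {1..}\<close> in \<open>global_elements\<close>. The entry at 0 is left
  free.\<close>

definition glob :: "'v::elts obj \<Rightarrow> (nat \<Rightarrow> 'v) \<Rightarrow> bool" where
  "glob X y \<longleftrightarrow> (\<forall>j\<ge>1. y j \<in> elts_at X j \<and> restr X j (y (Suc j)) = y j)"

text \<open>The side condition that \<open>exp_obj\<close> states inline: f is a morphism between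
  the truncations of X and Y to the stages 1 to i.\<close>

definition exp_mor :: "'v::elts obj \<Rightarrow> 'v obj \<Rightarrow> nat \<Rightarrow> (nat \<Rightarrow> 'v \<Rightarrow> 'v) \<Rightarrow> bool" where
  "exp_mor X Y i f \<longleftrightarrow> (\<forall>j \<in> {1..i}. \<forall>x \<in> elts_at X j. f j x \<in> elts_at Y j) \<and>
     (\<forall>j \<in> {1..<i}. \<forall>x \<in> elts_at X (Suc j). f j (restr X j x) = restr Y j (f (Suc j) x))"

abbreviation ev :: "'v::elts \<Rightarrow> nat \<Rightarrow> 'v \<Rightarrow> 'v" where "ev F j x \<equiv> vapp (vproj F j) x"

abbreviation tup :: "'v::elts obj \<Rightarrow> nat \<Rightarrow> (nat \<Rightarrow> 'v \<Rightarrow> 'v) \<Rightarrow> 'v" where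
  "tup X i f \<equiv> vtuple {1..i} (\<lambda>j. vlam (stage X j) (f j))"

locale zf_model =
  fixes U :: "'v::elts itself"
  assumes zf: "zf_universe U"
begin

section \<open>Smallness and the coding of pairs, numbers and tuples\<close>

lemma small_elts: "small (elts (x::'v))"
  by (simp add: small_def)

lemma elts_mkset: "small X \<Longrightarrow> elts (mkset X) = (X :: 'v set)"
  by (simp add: small_def mkset_def f_inv_into_f)

lemma small_subset: "small X \<Longrightarrow> Y \<subseteq> X \<Longrightarrow> small (Y :: 'v set)"
  using zf unfolding zf_universe_def by blast

lemma small_Union_elts: "small X \<Longrightarrow> small (\<Union> (elts ` (X :: 'v set)))"
  using zf unfolding zf_universe_def by blast

lemma small_Pow: "small X \<Longrightarrow> small {y. elts y \<subseteq> (X :: 'v set)}"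
  using zf unfolding zf_universe_def by blast

lemma small_image: "small X \<Longrightarrow> small (f ` X :: 'v set)" for X :: "'v set"
  using zf unfolding zf_universe_def by blast

lemma small_range: "small (range f :: 'v set)" for f :: "nat \<Rightarrow> 'v"
  using zf unfolding zf_universe_def by blast

lemma small_image_nat: "small (f ` J :: 'v set)" for f :: "nat \<Rightarrow> 'v"
  using small_range[of f] by (rule small_subset) auto

lemma small_empty: "small ({} :: 'v set)"
  using small_image_nat[of undefined "{}"] by simp

text \<open>Pairing is not among the axioms of \<open>zf_universe\<close>; it is an instance of the
  smallness of images of the natural numbers.\<close>

lemma small_doubleton: "small {x, y :: 'v}"
proof -
  have "{x, y} = (\<lambda>n::nat. if n = 0 then x else y) ` {0, 1}" by auto
  then show ?thesis by (metis small_image_nat)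
qed

lemma small_singleton: "small {x :: 'v}"
  using small_doubleton[of x x] by simp

lemma small_Un: assumes "small X" "small Y" shows "small (X \<union> Y :: 'v set)"
proof -
  have "X \<union> Y = \<Union> (elts ` {mkset X, mkset Y})"
    using assms by (simp add: elts_mkset)
  then show ?thesis using small_Union_elts[OF small_doubleton[of "mkset X" "mkset Y"]] by simp
qed

lemma small_UN_nat: assumes "\<And>j. small (S j :: 'v set)" shows "small (\<Union>j::nat. S j)"
proof -
  have "(\<Union>j. S j) = \<Union> (elts ` range (\<lambda>j. mkset (S j)))"
    using assms by (simp add: elts_mkset)
  then show ?thesis using small_Union_elts[OF small_range[of "\<lambda>j. mkset (S j)"]] by simp
qed

lemma small_UN:
  fixes X :: "'v set"
  assumes "small X" "\<And>x. x \<in> X \<Longrightarrow> small (S x :: 'v set)"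
  shows "small (\<Union>x\<in>X. S x)"
proof -
  have "(\<Union>x\<in>X. S x) = \<Union> (elts ` ((\<lambda>x. mkset (S x)) ` X))"
    using assms by (simp add: elts_mkset)
  then show ?thesis using small_Union_elts[OF small_image[OF assms(1), of "\<lambda>x. mkset (S x)"]] by simp
qed

lemma small_pairs: assumes "small X" "small Y"
  shows "small {vpair x y | x y :: 'v. x \<in> X \<and> y \<in> Y}"
proof -
  have "{vpair x y | x y. x \<in> X \<and> y \<in> Y} = (\<Union>x\<in>X. (\<lambda>y. vpair x y) ` Y)" by auto
  then show ?thesis using small_UN[OF assms(1)] small_image[OF assms(2)] by simp
qed

lemma mkset_eq_iff: "small X \<Longrightarrow> small Y \<Longrightarrow> mkset X = mkset Y \<longleftrightarrow> X = (Y :: 'v set)"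
  by (metis elts_mkset)

lemma vpair_inject [simp]: "vpair x y = vpair x' y' \<longleftrightarrow> x = x' \<and> y = (y' :: 'v)"
  unfolding vpair_def by (auto simp: mkset_eq_iff small_doubleton small_singleton doubleton_eq_iff)

lemma vfst_vpair [simp]: "vfst (vpair x y) = (x :: 'v)"
  unfolding vfst_def by auto

lemma vsnd_vpair [simp]: "vsnd (vpair x y) = (y :: 'v)"
  unfolding vsnd_def by auto

lemma elts_vsucc: "elts (vsucc x) = insert x (elts (x :: 'v))"
  unfolding vsucc_def using small_Un[OF small_singleton small_elts, of x x] by (simp add: elts_mkset)

text \<open>If x and y differ, equality of their successors makes each an element of the other,
  which foundation excludes.\<close>

lemma vsucc_inject: assumes "vsucc x = vsucc (y :: 'v)" shows "x = y"
proof (rule ccontr)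
  assume "x \<noteq> y"
  moreover have "insert x (elts x) = insert y (elts y)" using assms by (metis elts_vsucc)
  ultimately have "x \<in> elts y" "y \<in> elts x" by auto
  moreover have "wf {(x, y :: 'v). x \<in> elts y}" using zf by (simp add: zf_universe_def)
  ultimately show False using wf_not_sym by fastforce
qed

lemma vnat_Suc: "vnat (Suc n) = vsucc (vnat n :: 'v)"
  by (simp add: vnat_def)

lemma vnat_inject [simp]: "vnat m = (vnat n :: 'v) \<longleftrightarrow> m = n"
proof -
  have ne: "vnat 0 \<noteq> (vnat (Suc n) :: 'v)" for n
  proof
    assume "vnat 0 = (vnat (Suc n) :: 'v)"
    then have "elts (vnat 0 :: 'v) = elts (vnat (Suc n))" by simp
    then show False by (simp add: vnat_Suc elts_vsucc vnat_def elts_mkset small_empty)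
  qed
  have "vnat m = (vnat n :: 'v) \<Longrightarrow> m = n"
  proof (induction m arbitrary: n)
    case 0 then show ?case using ne by (cases n) simp_all
  next
    case (Suc m)
    show ?case
    proof (cases n)
      case 0 with Suc.prems ne[of m] show ?thesis by metis
    next
      case (Suc k)
      with Suc.prems have "vnat m = (vnat k :: 'v)" by (simp add: vnat_Suc vsucc_inject)
      with Suc.IH Suc show ?thesis by simp
    qed
  qed
  then show ?thesis by auto
qed

lemma vin_inject [simp]: "vin d a = vin d' a' \<longleftrightarrow> d = d' \<and> a = (a' :: 'v)"
  by (simp add: vin_def)

lemma vcase_vin [simp]:
  "vcase f g (vin 1 a) = f (a :: 'v)" "vcase f g (vin (Suc 0) a) = f (a :: 'v)" "vcase f g (vin 2 a) = g (a :: 'v)"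
  by (simp_all add: vcase_def vin_def)

lemma small_graph: "small ((\<lambda>x. vpair x (f x)) ` elts (X :: 'v))"
  by (rule small_image[OF small_elts])

lemma vapp_vlam [simp]: "x \<in> elts X \<Longrightarrow> vapp (vlam X f) x = (f x :: 'v)"
  unfolding vapp_def vlam_def by (subst elts_mkset[OF small_graph]) auto

lemma vlam_cong: "(\<And>x. x \<in> elts X \<Longrightarrow> f x = (g x :: 'v)) \<Longrightarrow> vlam X f = vlam X g"
  unfolding vlam_def by (metis (no_types, lifting) image_cong)

lemma vproj_vtuple [simp]: "j \<in> J \<Longrightarrow> vproj (vtuple J x) j = (x j :: 'v)"
  unfolding vproj_def vapp_def vtuple_def by (subst elts_mkset[OF small_image_nat]) auto

lemma vtuple_cong: "(\<And>j. j \<in> J \<Longrightarrow> x j = (y j :: 'v)) \<Longrightarrow> vtuple J x = vtuple J y"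
  unfolding vtuple_def by (metis (no_types, lifting) image_cong)

lemma vtuple_eq_iff: "vtuple J x = vtuple J y \<longleftrightarrow> (\<forall>j\<in>J. x j = (y j :: 'v))"
  by (metis vproj_vtuple vtuple_cong)

text \<open>A tuple is a set of pairs of an index and an entry. If all entries lie in one small set
  Z, the tuples are subsets of one product and so lie in one power set.\<close>

lemma small_vtuples:
  assumes "small Z" "\<And>x. x \<in> S \<Longrightarrow> \<exists>y. x = vtuple J y \<and> (\<forall>j\<in>J. y j \<in> Z)"
  shows "small (S :: 'v set)"
proof (rule small_subset[OF small_Pow[OF small_pairs[OF small_range[of vnat] assms(1)]]])
  show "S \<subseteq> {y. elts y \<subseteq> {vpair x y |x y. x \<in> range vnat \<and> y \<in> Z}}"
  proof
    fix x assume "x \<in> S"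
    then obtain y where x: "x = vtuple J y" "\<forall>j\<in>J. y j \<in> Z" using assms(2) by blast
    then have "elts x \<subseteq> {vpair x y |x y. x \<in> range vnat \<and> y \<in> Z}"
      unfolding x(1) vtuple_def by (subst elts_mkset[OF small_image_nat]) auto
    then show "x \<in> {y. elts y \<subseteq> {vpair x y |x y. x \<in> range vnat \<and> y \<in> Z}}" by simp
  qed
qed

section \<open>Elements and restriction maps of the constructions on objects\<close>

lemma elts_delta: "elts_at (delta Z) i = elts (Z :: 'v)" "restr (delta Z) i x = x"
  by (simp_all add: delta_def)

lemma elts_prod: "elts_at (prod_obj X Y) i = {vpair x y | x y :: 'v. x \<in> elts_at X i \<and> y \<in> elts_at Y i}"
  by (simp add: prod_obj_def elts_mkset small_pairs small_elts)

lemma restr_prod: "restr (prod_obj X Y) i (vpair x y) = vpair (restr X i x) (restr Y i y :: 'v)"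
  by (simp add: prod_obj_def)

lemma elts_sum: "elts_at (sum_obj X Y) i = vin 1 ` elts_at X i \<union> vin 2 ` (elts_at Y i :: 'v set)"
  by (simp add: sum_obj_def elts_mkset small_Un small_image small_elts)

lemma restr_sum: "restr (sum_obj X Y) i (vin 1 x) = vin 1 (restr X i x :: 'v)"
    "restr (sum_obj X Y) i (vin (Suc 0) x) = vin (Suc 0) (restr X i x :: 'v)"
    "restr (sum_obj X Y) i (vin 2 y) = vin 2 (restr Y i y :: 'v)"
  by (simp_all add: sum_obj_def)

lemma elts_later: "elts_at (later_obj X) i = (if i \<le> 1 then {vunit} else elts_at X (i - 1) :: 'v set)"
  by (simp add: later_obj_def elts_mkset small_singleton)

lemma restr_later: "restr (later_obj X) i x = (if i \<le> 1 then vunit else restr X (i - 1) x :: 'v)"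
  by (simp add: later_obj_def)

lemma elts_exp: "elts_at (exp_obj X Y) i =
  {vtuple {1..i} (\<lambda>j. vlam (stage X j) (f j)) | f :: nat \<Rightarrow> 'v \<Rightarrow> 'v. exp_mor X Y i f}" (is "_ = ?S")
proof -
  \<comment> \<open>The graph of the j-th component is a subset of the product of stage j of X and
    stage j of Y; Z collects these power sets over all stages.\<close>
  define Z where "Z = (\<Union>j::nat. {y. elts y \<subseteq> {vpair a b | a b. a \<in> elts_at X j \<and> b \<in> elts_at Y j}})"
  have "small ?S"
  proof (rule small_vtuples[where Z = Z and J = "{1..i}"])
    show "small Z" unfolding Z_def
      by (intro small_UN_nat small_Pow small_pairs small_elts)
    fix F assume "F \<in> ?S"
    then obtain f where F: "F = vtuple {1..i} (\<lambda>j. vlam (stage X j) (f j))" and f: "exp_mor X Y i f"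
      by blast
    have "vlam (stage X j) (f j) \<in> Z" if "j \<in> {1..i}" for j
    proof -
      have "elts (vlam (stage X j) (f j)) \<subseteq> {vpair a b | a b. a \<in> elts_at X j \<and> b \<in> elts_at Y j}"
        unfolding vlam_def using f that by (subst elts_mkset[OF small_graph]) (auto simp: exp_mor_def)
      then show ?thesis unfolding Z_def by blast
    qed
    then show "\<exists>y. F = vtuple {1..i} y \<and> (\<forall>j\<in>{1..i}. y j \<in> Z)" using F by blast
  qed
  then show ?thesis
    by (simp add: exp_obj_def elts_mkset exp_mor_def)
qed

lemma ev_tup: "1 \<le> j \<Longrightarrow> j \<le> i \<Longrightarrow> x \<in> elts_at X j \<Longrightarrow> ev (tup X i f) j x = (f j x :: 'v)"
  by simp

lemma exp_mor_cong: "(\<And>j x. 1 \<le> j \<Longrightarrow> j \<le> i \<Longrightarrow> x \<in> elts_at X j \<Longrightarrow> f j x = g j x) \<Longrightarrow> is_obj X \<Longrightarrow>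
   exp_mor X Y i f \<longleftrightarrow> exp_mor X (Y :: 'v obj) i g"
  by (force simp: exp_mor_def is_obj_def)

lemma tup_cong: "(\<And>j x. 1 \<le> j \<Longrightarrow> j \<le> i \<Longrightarrow> x \<in> elts_at X j \<Longrightarrow> f j x = (g j x :: 'v)) \<Longrightarrow> tup X i f = tup X i g"
  by (intro vtuple_cong vlam_cong) auto

lemma tup_in_exp: "exp_mor X (Y :: 'v obj) i f \<Longrightarrow> tup X i f \<in> elts_at (exp_obj X Y) i"
  by (auto simp: elts_exp)

lemma exp_eta: fixes X Y :: "'v obj" assumes "F \<in> elts_at (exp_obj X Y) i" shows "F = tup X i (ev F)"
proof -
  obtain f where F: "F = tup X i f" using assms by (auto simp: elts_exp)
  show ?thesis unfolding F by (rule tup_cong) simp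
qed

lemma exp_ev: fixes X Y :: "'v obj" assumes "F \<in> elts_at (exp_obj X Y) i" "is_obj X" shows "exp_mor X Y i (ev F)"
proof -
  obtain f where F: "F = tup X i f" "exp_mor X Y i f" using assms by (auto simp: elts_exp)
  have "exp_mor X Y i (ev (tup X i f)) \<longleftrightarrow> exp_mor X Y i f"
    by (rule exp_mor_cong) (use assms in auto)
  then show ?thesis unfolding F(1) using F(2) by simp
qed

lemma exp_ext:
  fixes X Y :: "'v obj" assumes "F \<in> elts_at (exp_obj X Y) i" "G \<in> elts_at (exp_obj X Y) i"
    and "\<And>j x. 1 \<le> j \<Longrightarrow> j \<le> i \<Longrightarrow> x \<in> elts_at X j \<Longrightarrow> ev F j x = ev G j x"
  shows "F = G"
  using exp_eta[OF assms(1)] exp_eta[OF assms(2)] tup_cong[of i X "ev F" "ev G"] assms(3) by simp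

lemma ev_restr: "1 \<le> j \<Longrightarrow> j \<le> i \<Longrightarrow> vproj (restr (exp_obj X Y) i F) j = (vproj F j :: 'v)"
  by (simp add: exp_obj_def)

lemma restr_exp:
  fixes X Y :: "'v obj" assumes "F \<in> elts_at (exp_obj X Y) (Suc i)"
  shows "restr (exp_obj X Y) i F = tup X i (ev F)"
proof -
  have F: "F = tup X (Suc i) (ev F)" by (rule exp_eta[OF assms])
  have "restr (exp_obj X Y) i F = vtuple {1..i} (vproj F)" by (simp add: exp_obj_def)
  also have "\<dots> = tup X i (ev F)"
  proof (rule vtuple_cong)
    fix j assume j: "j \<in> {1..i}"
    have "vproj (tup X (Suc i) (ev F)) j = vlam (stage X j) (ev F j)"
      by (rule vproj_vtuple) (use j in auto)
    then show "vproj F j = vlam (stage X j) (ev F j)" using F by simp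
  qed
  finally show ?thesis .
qed

lemma elts_global: "elts (global_elements X) = {vtuple {1..} x | x :: nat \<Rightarrow> 'v. glob X x}" (is "_ = ?S")
proof -
  have "small ?S"
  proof (rule small_vtuples[where Z = "\<Union>j::nat. elts_at X j" and J = "{1..}"])
    show "small (\<Union>j::nat. elts_at X j)" by (intro small_UN_nat small_elts)
  qed (auto simp: glob_def)
  then show ?thesis by (simp add: global_elements_def glob_def elts_mkset)
qed

lemma elts_box: "elts_at (box_obj X) i = {vtuple {1..} x | x :: nat \<Rightarrow> 'v. glob X x}"
  by (simp add: box_obj_def elts_delta elts_global)

lemma restr_box: "restr (box_obj X) i x = (x :: 'v)"
  by (simp add: box_obj_def elts_delta)

lemma glob_cong: "(\<And>j. 1 \<le> j \<Longrightarrow> x j = y j) \<Longrightarrow> glob X x \<longleftrightarrow> glob X (y :: nat \<Rightarrow> 'v)"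
  by (auto simp: glob_def)

lemma box_proj: assumes "x \<in> elts_at (box_obj X) i" shows "glob X (vproj x)" "x = vtuple {1..} (vproj (x :: 'v))"
proof -
  obtain y where y: "x = vtuple {1..} y" "glob X y" using assms by (auto simp: elts_box)
  show "glob X (vproj x)" using y by (subst glob_cong[of _ y]) auto
  show "x = vtuple {1..} (vproj x)" unfolding y by (intro vtuple_cong) simp
qed

lemma is_objD: "is_obj X \<Longrightarrow> 1 \<le> i \<Longrightarrow> x \<in> elts_at X (Suc i) \<Longrightarrow> restr X i x \<in> elts_at X i"
  by (simp add: is_obj_def)

lemma is_obj_delta: "is_obj (delta (Z :: 'v))"
  by (simp add: is_obj_def elts_delta)

lemma is_obj_prod: "is_obj X \<Longrightarrow> is_obj Y \<Longrightarrow> is_obj (prod_obj X (Y :: 'v obj))"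
  by (auto simp: is_obj_def elts_prod restr_prod)

lemma is_obj_sum: "is_obj X \<Longrightarrow> is_obj Y \<Longrightarrow> is_obj (sum_obj X (Y :: 'v obj))"
  by (auto simp: is_obj_def elts_sum restr_sum)

lemma exp_mor_mono: "exp_mor X (Y :: 'v obj) i f \<Longrightarrow> j \<le> i \<Longrightarrow> exp_mor X Y j f"
  by (auto simp: exp_mor_def)

lemma is_obj_exp: "is_obj X \<Longrightarrow> is_obj (exp_obj X (Y :: 'v obj))"
  unfolding is_obj_def[of "exp_obj X Y"]
proof (intro impI allI ballI)
  fix i F assume X: "is_obj X" and F: "F \<in> elts_at (exp_obj X Y) (Suc i)"
  have "exp_mor X Y i (ev F)" by (rule exp_mor_mono[OF exp_ev[OF F X]]) simp
  then show "restr (exp_obj X Y) i F \<in> elts_at (exp_obj X Y) i"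
    by (simp only: restr_exp[OF F] tup_in_exp)
qed

lemma is_obj_later: "is_obj X \<Longrightarrow> is_obj (later_obj (X :: 'v obj))"
  unfolding is_obj_def elts_later restr_later
  by (auto elim!: allE[of _ "_ - Suc 0"])

lemma is_obj_box: "is_obj (box_obj (X :: 'v obj))"
  by (simp add: box_obj_def is_obj_delta)

end

section \<open>Renaming and substitution in types\<close>

inductive_cases wf_tyE [elim!]:
  "wf_ty n (TVar k)" "wf_ty n (TProd A B)" "wf_ty n (TSum A B)" "wf_ty n (TFun A B)"
  "wf_ty n (TMu A)" "wf_ty n (TLater A)" "wf_ty n (TBox A)"

lemmas wf_ty_intros [intro] = wf_ty.intros

lemma guarded_tren: "(\<And>j. r j = k \<Longrightarrow> guarded j A) \<Longrightarrow> guarded k (tren r A)"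
proof (induction A arbitrary: r k)
  case (TMu A)
  have "guarded j A" if "lift_ren 1 r j = Suc k" for j
    using that TMu.prems[of "j - 1"] by (cases j) (auto simp: lift_ren_def)
  then show ?case using TMu.IH by simp
qed auto

lemma wf_ty_tren: "wf_ty m A \<Longrightarrow> (\<And>k. k < m \<Longrightarrow> r k < m') \<Longrightarrow> wf_ty m' (tren r A)"
proof (induction m A arbitrary: r m' rule: wf_ty.induct)
  case (wf_TMu n A)
  have "wf_ty (Suc m') (tren (lift_ren 1 r) A)"
    using wf_TMu.prems by (intro wf_TMu.IH) (auto simp: lift_ren_def)
  moreover have "guarded 0 (tren (lift_ren 1 r) A)"
    using wf_TMu.hyps by (intro guarded_tren) (auto simp: lift_ren_def split: if_splits)
  ultimately show ?case by auto
qed auto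

lemma guarded_tsub: "(\<And>j. \<not> guarded j A \<Longrightarrow> guarded k (s j)) \<Longrightarrow> guarded k (tsub s A)"
proof (induction A arbitrary: s k)
  case (TMu A)
  have "guarded (Suc k) (lift_tsub s j)" if "\<not> guarded j A" for j
    using that TMu.prems[of "j - 1"] by (cases j) (auto simp: lift_tsub_def intro!: guarded_tren)
  then show ?case using TMu.IH by simp
qed auto

lemma wf_ty_tsub:
  "wf_ty m A \<Longrightarrow> (\<And>k. k < m \<Longrightarrow> wf_ty m' (s k)) \<Longrightarrow> wf_ty m' (tsub s A)"
proof (induction m A arbitrary: s m' rule: wf_ty.induct)
  case (wf_TMu n A)
  have "wf_ty (Suc m') (tsub (lift_tsub s) A)"
    using wf_TMu.prems by (intro wf_TMu.IH) (auto simp: lift_tsub_def intro!: wf_ty_tren)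
  \<comment> \<open>Index 0 is guarded in A by assumption, so j is positive; its image is a shifted
    type, in which index 0 does not occur.\<close>
  moreover have "guarded 0 (lift_tsub s j)" if "\<not> guarded j A" for j
    using that wf_TMu.hyps by (cases j) (auto simp: lift_tsub_def intro!: guarded_tren)
  then have "guarded 0 (tsub (lift_tsub s) A)"
    by (rule guarded_tsub)
  ultimately show ?case by auto
qed auto

lemma wf_ty_tinst: "wf_ty 0 (TMu A) \<Longrightarrow> wf_ty 0 (tinst A (TMu A))"
  unfolding tinst_def by (rule wf_ty_tsub[where m = "Suc 0"]) auto

lemma const_ty_tren [simp]: "const_ty (tren r A) = const_ty A"
  by (induction A arbitrary: r) auto

lemma const_ty_tsub: "const_ty A \<Longrightarrow> (\<And>k. const_ty (s k)) \<Longrightarrow> const_ty (tsub s A)"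
  by (induction A arbitrary: s) (auto simp: lift_tsub_def)

lemma const_ty_tinst: "const_ty (TMu A) \<Longrightarrow> const_ty (tinst A (TMu A))"
  unfolding tinst_def by (rule const_ty_tsub) auto

section \<open>Denotations of renamed and substituted types\<close>

abbreviation diag :: "'v obj list \<Rightarrow> ('v obj \<times> 'v obj) list" where
  "diag \<equiv> map (\<lambda>X. (X, X))"

text \<open>Closed types are only ever evaluated in diagonal environments: \<open>TMu\<close> adds a
  pair \<open>(X, X)\<close>, and the swap made for the domain of an arrow does nothing to such
  pairs.\<close>

lemma swap_diag [simp]: "map (prod.swap \<circ> (\<lambda>X. (X, X))) W = diag W"
  by simp

text \<open>\<open>fixpoint\<close> depends on nothing but the operator it is given, and equal
  operators receive the same choice. This is why the lemma and its companions for renaming and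
  substitution are equations and not mere isomorphisms.\<close>

lemma tden_cong:
  "wf_ty m A \<Longrightarrow> \<forall>k<m. k < length W \<and> k < length W' \<and> W' ! k = W ! k \<Longrightarrow>
   tden A W = tden A W'"
proof (induction m A arbitrary: W W' rule: wf_ty.induct)
  case (wf_TMu n A)
  have "tden A ((X, X) # W) = tden A ((X, X) # W')" for X
    using wf_TMu.prems by (intro wf_TMu.IH) (auto simp: less_Suc_eq_0_disj)
  then show ?case by simp
next
  case (wf_TFun n A B)
  have "tden A (map prod.swap W) = tden A (map prod.swap W')"
    using wf_TFun.prems by (intro wf_TFun.IH) auto
  moreover have "tden B W = tden B W'"
    using wf_TFun.prems by (intro wf_TFun.IH) auto
  ultimately show ?case by simp
next
  case (wf_TBox A n)
  have "tden A W = tden A W'" by (rule wf_TBox.IH) simp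
  then show ?case by simp
next
  case (wf_TProd n A B)
  then show ?case by (metis tden.simps(4))
next
  case (wf_TSum n A B)
  then show ?case by (metis tden.simps(6))
next
  case (wf_TLater n A)
  then show ?case by (metis tden.simps(9))
qed auto

lemma tden_closed: "wf_ty 0 A \<Longrightarrow> tden A W = cden A"
  by (rule tden_cong) auto

lemma tden_tren:
  "wf_ty m A \<Longrightarrow> length W' = m \<Longrightarrow> (\<And>k. k < m \<Longrightarrow> r k < length W \<and> W' ! k = W ! r k) \<Longrightarrow>
   tden (tren r A) W = tden A W'"
proof (induction m A arbitrary: r W W' rule: wf_ty.induct)
  case (wf_TMu n A)
  have "tden (tren (lift_ren 1 r) A) ((X, X) # W) = tden A ((X, X) # W')" for X
    using wf_TMu.prems by (intro wf_TMu.IH) (auto simp: lift_ren_def nth_Cons')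
  then show ?case by simp
next
  case (wf_TFun n A B)
  have "tden (tren r A) (map prod.swap W) = tden A (map prod.swap W')"
    using wf_TFun.prems by (intro wf_TFun.IH) auto
  moreover have "tden (tren r B) W = tden B W'"
    using wf_TFun.prems by (intro wf_TFun.IH) auto
  ultimately show ?case by simp
next
  case (wf_TBox A n)
  have "tden (tren r A) W = tden A []" by (rule wf_TBox.IH) auto
  then show ?case using tden_closed[OF wf_TBox.hyps, of W'] by simp
qed auto

lemma tden_tsub:
  "wf_ty m A \<Longrightarrow> length W' = m \<Longrightarrow>
   (\<And>k. k < m \<Longrightarrow> wf_ty (length W) (s k) \<and> W' ! k = tden (s k) (diag W)) \<Longrightarrow>
   tden (tsub s A) (diag W) = tden A (diag W')"
proof (induction m A arbitrary: s W W' rule: wf_ty.induct)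
  case (wf_TMu n A)
  have "tden (tsub (lift_tsub s) A) (diag (X # W)) = tden A (diag (X # W'))" for X
  proof (rule wf_TMu.IH)
    fix k assume k: "k < Suc n"
    show "wf_ty (length (X # W)) (lift_tsub s k) \<and> (X # W') ! k = tden (lift_tsub s k) (diag (X # W))"
    proof (cases k)
      case (Suc l)
      with k wf_TMu.prems(2)[of l] have l: "wf_ty (length W) (s l)" "W' ! l = tden (s l) (diag W)" by auto
      have "tden (tren Suc (s l)) (diag (X # W)) = tden (s l) (diag W)"
        by (rule tden_tren[OF l(1)]) auto
      with l Suc show ?thesis by (auto simp: lift_tsub_def intro!: wf_ty_tren)
    qed (auto simp: lift_tsub_def)
  qed (use wf_TMu.prems in auto)
  then show ?case by simp
next
  case (wf_TBox A n)
  \<comment> \<open>The body of \<open>TBox\<close> is well-formed without free variables, so with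
    the empty environment nothing has to be known about s.\<close>
  have "tden (tsub s A) (diag W) = tden A (diag [])"
    by (rule wf_TBox.IH) auto
  then show ?case using tden_closed[OF wf_TBox.hyps, of "diag W'"] by simp
qed auto

text \<open>\<open>unfold_iso\<close> is chosen for the operator given by \<open>tden A\<close>;
  this equation makes its codomain the denotation of the unfolded type itself.\<close>

lemma tden_tinst: "wf_ty 0 (TMu A) \<Longrightarrow> tden (tinst A (TMu A)) [] = tden A [(cden (TMu A), cden (TMu A))]"
  unfolding tinst_def
  using tden_tsub[where m = "Suc 0" and A = A and W = "[]" and W' = "[cden (TMu A)]" and s = "\<lambda>k. if k = 0 then TMu A else TVar (k - 1)"]
  by (auto simp: One_nat_def)

section \<open>Fixed points of contractive operators\<close>

text \<open>Contractiveness for the ultrametric in which sequences that agree below n have distance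
  at most 2^-n. \<open>cfix\<close> is the corresponding Banach fixed point.\<close>

definition contractive :: "((nat \<Rightarrow> 'b) \<Rightarrow> nat \<Rightarrow> 'b) \<Rightarrow> bool" where
  "contractive G \<longleftrightarrow> (\<forall>n f g. (\<forall>m<n. f m = g m) \<longrightarrow> G f n = G g n)"

text \<open>For contractive G, entry n of the iterates no longer changes after n + 1 applications,
  so the diagonal below is their limit.\<close>

definition cfix :: "'b \<Rightarrow> ((nat \<Rightarrow> 'b) \<Rightarrow> nat \<Rightarrow> 'b) \<Rightarrow> nat \<Rightarrow> 'b" where
  "cfix z G n = (G ^^ Suc n) (\<lambda>_. z) n"

lemma contractiveD:
  assumes "contractive G" "\<And>m. m < n \<Longrightarrow> f m = g m"
  shows "G f n = G g n"
  by (rule assms(1)[unfolded contractive_def, rule_format]) (rule assms(2))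

lemma cfix_approx: assumes "contractive G" "m < k" shows "(G ^^ k) (\<lambda>_. z) m = cfix z G m"
proof -
  have "m < k \<Longrightarrow> m < k' \<Longrightarrow> (G ^^ k) (\<lambda>_. z) m = (G ^^ k') (\<lambda>_. z) m" for k k'
  proof (induction m arbitrary: k k' rule: less_induct)
    case (less m)
    obtain l l' where k: "k = Suc l" "k' = Suc l'" using less.prems by (metis lessE)
    have "G ((G ^^ l) (\<lambda>_. z)) m = G ((G ^^ l') (\<lambda>_. z)) m"
    proof (rule contractiveD[OF assms(1)])
      fix j assume "j < m"
      then show "(G ^^ l) (\<lambda>_. z) j = (G ^^ l') (\<lambda>_. z) j"
        using less.IH[of j l l'] less.prems k by simp
    qed
    then show ?case by (simp add: k)
  qed
  then show ?thesis using assms(2) unfolding cfix_def by blast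
qed

lemma cfix_unfold: assumes "contractive G" shows "cfix z G = G (cfix z G)"
proof
  fix n
  have "G (cfix z G) n = G ((G ^^ n) (\<lambda>_. z)) n"
    by (rule contractiveD[OF assms]) (simp add: cfix_approx[OF assms])
  then show "cfix z G n = G (cfix z G) n" by (simp add: cfix_def)
qed

text \<open>The two operators are compared only up to n, because they will stem from environments
  that agree no further.\<close>

lemma cfix_cong:
  assumes "\<And>n' f g. n' \<le> n \<Longrightarrow> (\<And>m. m < n' \<Longrightarrow> f m = g m) \<Longrightarrow> G f n' = G' g n'"
    and "contractive G" "contractive G'"
  shows "cfix z G n = cfix z G' n"
proof -
  have "n' \<le> n \<Longrightarrow> cfix z G n' = cfix z G' n'" for n'
  proof (induction n' rule: less_induct)
    case (less m)
    have "G (cfix z G) m = G' (cfix z G') m"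
      using less by (intro assms(1)) auto
    then show ?case by (metis cfix_unfold[OF assms(2)] cfix_unfold[OF assms(3)])
  qed
  then show ?thesis by simp
qed

text \<open>An object is seen as a sequence whose \<open>n\<close>-th entry consists of stage \<open>n\<close> and the restriction
  out of it, which is missing for \<open>n = 0\<close>.\<close>

definition view :: "'v obj \<Rightarrow> nat \<Rightarrow> 'v \<times> ('v \<Rightarrow> 'v)" where
  "view X n = (stage X n, case n of 0 \<Rightarrow> (\<lambda>x. x) | Suc i \<Rightarrow> restr X i)"

definition of_view :: "(nat \<Rightarrow> 'v \<times> ('v \<Rightarrow> 'v)) \<Rightarrow> 'v obj" where
  "of_view g = Obj (\<lambda>i. fst (g i)) (\<lambda>i. snd (g (Suc i)))"

lemma of_view_view [simp]: "of_view (view X) = X"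
  by (cases X) (simp add: of_view_def view_def)

text \<open>\<open>of_view\<close> forgets the map stored in entry 0, so
  \<open>view (of_view f)\<close> may differ from f there. What survives is that each entry depends
  on the same entry of f alone.\<close>

lemma view_of_view: "f n = g n \<Longrightarrow> view (of_view f) n = view (of_view g) n"
  by (cases n) (simp_all add: of_view_def view_def)

lemma view_inject: "(\<And>n. view X n = view Y n) \<Longrightarrow> X = Y"
  by (metis of_view_view ext)

definition ofix :: "('v::elts obj \<Rightarrow> 'v obj) \<Rightarrow> 'v obj" where
  "ofix G = of_view (cfix (mkset {}, \<lambda>x. x) (\<lambda>g. view (G (of_view g))))"

definition ocontractive :: "('v obj \<Rightarrow> 'v obj) \<Rightarrow> bool" where
  "ocontractive G \<longleftrightarrow> (\<forall>n X Y. (\<forall>m<n. view X m = view Y m) \<longrightarrow> view (G X) n = view (G Y) n)"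

lemma ocontractive_imp_contractive:
  "ocontractive G \<Longrightarrow> contractive (\<lambda>g. view (G (of_view g)))"
  unfolding ocontractive_def contractive_def by (metis view_of_view)

lemma ofix_unfold: "ocontractive G \<Longrightarrow> ofix G = G (ofix G)"
  unfolding ofix_def using cfix_unfold[OF ocontractive_imp_contractive, of G]
  by (metis of_view_view)

lemma ofix_view_cong:
  assumes "\<And>n' X Y. n' \<le> n \<Longrightarrow> (\<And>m. m < n' \<Longrightarrow> view X m = view Y m) \<Longrightarrow> view (G X) n' = view (G' Y) n'"
    and "ocontractive G" "ocontractive G'"
  shows "view (ofix G) n = view (ofix G') n"
  unfolding ofix_def
  by (rule view_of_view, rule cfix_cong)
     (auto intro!: ocontractive_imp_contractive assms view_of_view)

lemma is_obj_ofix: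
  assumes c: "ocontractive G" and G: "\<And>X. is_obj X \<Longrightarrow> is_obj (G X)"
  shows "is_obj (ofix G)"
proof -
  define z where "z = (mkset {} :: 'a, \<lambda>x :: 'a. x)"
  define H where "H = (\<lambda>g. view (G (of_view g)))"
  have "is_obj (of_view (\<lambda>_. z))" by (simp add: of_view_def z_def is_obj_def)
  then have obj: "is_obj (of_view ((H ^^ k) (\<lambda>_. z)))" for k
    by (induction k) (auto simp: H_def G)
  have eq: "cfix z H m = (H ^^ k) (\<lambda>_. z) m" if "m < k" for m k
    using cfix_approx[of H m k z] that ocontractive_imp_contractive[OF c] by (simp add: H_def)
  \<comment> \<open>The condition at stage i involves only the entries i and i + 1, and both are
    final in iterate i + 2, which is an object.\<close>
  have "restr (of_view (cfix z H)) i x \<in> elts_at (of_view (cfix z H)) i"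
    if "i \<ge> 1" "x \<in> elts_at (of_view (cfix z H)) (Suc i)" for i x
    using that obj[of "i + 2"] eq[of i "i + 2"] eq[of "Suc i" "i + 2"]
    by (simp add: is_obj_def of_view_def)
  then show ?thesis unfolding ofix_def is_obj_def by (simp add: z_def H_def)
qed

lemma view_prod: "view X n = view X' n \<Longrightarrow> view Y n = view Y' n \<Longrightarrow>
   view (prod_obj X Y) n = view (prod_obj X' Y') n"
  by (cases n) (simp_all add: view_def prod_obj_def)

lemma view_sum: "view X n = view X' n \<Longrightarrow> view Y n = view Y' n \<Longrightarrow>
   view (sum_obj X Y) n = view (sum_obj X' Y') n"
  by (cases n) (simp_all add: view_def sum_obj_def)

text \<open>Entry n of the result uses only entry n - 1 of the argument. All contractiveness of
  guarded types comes from this shift.\<close>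

lemma view_later: "(\<And>m. m < n \<Longrightarrow> view X m = view X' m) \<Longrightarrow>
   view (later_obj X) n = view (later_obj X') n"
proof (cases n)
  case (Suc p)
  assume *: "\<And>m. m < n \<Longrightarrow> view X m = view X' m"
  show ?thesis using *[of p] Suc by (cases p) (simp_all add: view_def later_obj_def cong: if_cong)
qed (simp add: view_def later_obj_def)

text \<open>Stage n of an exponential contains components for all stages up to n, so agreement at n
  alone would not do.\<close>

lemma view_exp:
  assumes "\<And>m. m \<le> n \<Longrightarrow> view X m = view X' m" "\<And>m. m \<le> n \<Longrightarrow> view Y m = view Y' m"
  shows "view (exp_obj X Y) n = view (exp_obj X' Y') n"
proof -
  have st: "stage X j = stage X' j" "stage Y j = stage Y' j" if "j \<le> n" for j
    using assms[OF that] by (auto simp: view_def)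
  have rs: "restr X j = restr X' j" "restr Y j = restr Y' j" if "j < n" for j
    using assms[of "Suc j"] that by (auto simp: view_def)
  have "exp_mor X Y n f = exp_mor X' Y' n f" for f
    unfolding exp_mor_def using st rs by auto
  moreover have "tup X n f = tup X' n f" for f
    unfolding vtuple_def using st by (metis (no_types, lifting) atLeastAtMost_iff image_cong)
  ultimately have "stage (exp_obj X Y) n = stage (exp_obj X' Y') n"
    by (simp add: exp_obj_def exp_mor_def)
  then show ?thesis by (cases n) (simp_all add: view_def exp_obj_def)
qed

section \<open>Interpretation of recursive types\<close>

text \<open>The constructions on objects determine stage \<open>n\<close> of the result literally from the stages up to
  \<open>n\<close> of the arguments.  Hence a guarded type has a fixed point on the nose, in contrast to the fixed
  point chosen by \<open>tden\<close>, which is only specified up to isomorphism.\<close>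

primrec canon :: "ty \<Rightarrow> 'v::elts obj list \<Rightarrow> 'v obj" where
  "canon (TVar k) V = V ! k"
| "canon TNat V = delta (mkset (range vnat))"
| "canon TOne V = delta (mkset {vunit})"
| "canon (TProd A B) V = prod_obj (canon A V) (canon B V)"
| "canon TZero V = delta (mkset {})"
| "canon (TSum A B) V = sum_obj (canon A V) (canon B V)"
| "canon (TFun A B) V = exp_obj (canon A V) (canon B V)"
| "canon (TMu A) V = ofix (\<lambda>X. canon A (X # V))"
| "canon (TLater A) V = later_obj (canon A V)"
| "canon (TBox A) V = box_obj (canon A V)"

text \<open>Beneath \<open>TLater\<close> a variable is consulted only at earlier stages, so
  agreement at n itself is demanded just of the variables with an unguarded occurrence.\<close>

definition agree :: "nat \<Rightarrow> ty \<Rightarrow> nat \<Rightarrow> (nat \<Rightarrow> 'b) list \<Rightarrow> (nat \<Rightarrow> 'b) list \<Rightarrow> bool" where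
  "agree m A n fs gs \<longleftrightarrow> (\<forall>k<m. k < length fs \<and> k < length gs \<and> (\<forall>i<n. (fs ! k) i = (gs ! k) i) \<and>
     (\<not> guarded k A \<longrightarrow> (fs ! k) n = (gs ! k) n))"

lemma agree_le: "agree m A n fs gs \<Longrightarrow> n' \<le> n \<Longrightarrow> agree m A n' fs gs"
  unfolding agree_def by (metis le_neq_implies_less order_less_le_trans)

lemma agree_binary:
  "agree m (TProd A B) n fs gs \<longleftrightarrow> agree m A n fs gs \<and> agree m B n fs gs"
  "agree m (TSum A B) n fs gs \<longleftrightarrow> agree m A n fs gs \<and> agree m B n fs gs"
  "agree m (TFun A B) n fs gs \<longleftrightarrow> agree m A n fs gs \<and> agree m B n fs gs"
  unfolding agree_def by auto

lemma agree_TLater: "agree m (TLater A) n fs gs \<Longrightarrow> i < n \<Longrightarrow> agree m A i fs gs"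
  unfolding agree_def by auto

lemma agree_TMu:
  "agree m (TMu A) n fs gs \<Longrightarrow> guarded 0 A \<Longrightarrow> (\<And>i. i < n \<Longrightarrow> f i = g i) \<Longrightarrow>
   agree (Suc m) A n (f # fs) (g # gs)"
  unfolding agree_def by (auto simp: less_Suc_eq_0_disj)

lemma agree_refl: "m \<le> length fs \<Longrightarrow> agree m A n fs fs"
  unfolding agree_def by auto

text \<open>One induction yields that \<open>canon\<close> is non-expansive in every variable and
  contractive in the guarded ones. The two must go together, since the value at \<open>TMu\<close>
  is determined only once the body is known to be contractive.\<close>

lemma canon_agree:
  "wf_ty m A \<Longrightarrow> agree m A n (map view V) (map view V') \<Longrightarrow> view (canon A V) n = view (canon A V') n"
proof (induction m A arbitrary: n V V' rule: wf_ty.induct)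
  case (wf_TVar k n) then show ?case by (auto simp: agree_def)
next
  case (wf_TProd n A B) then show ?case by (auto intro!: view_prod simp: agree_binary)
next
  case (wf_TSum n A B) then show ?case by (auto intro!: view_sum simp: agree_binary)
next
  case (wf_TFun m A B)
  have "agree m A i (map view V) (map view V')" "agree m B i (map view V) (map view V')" if "i \<le> n" for i
    using agree_le[OF wf_TFun.prems that] by (auto simp: agree_binary)
  then show ?case using wf_TFun.IH by (auto intro!: view_exp)
next
  case (wf_TMu m A)
  \<comment> \<open>Contractiveness of the body is the induction hypothesis with one and the same U
    on both sides.\<close>
  have c: "ocontractive (\<lambda>X. canon A (X # U))" if "m \<le> length U" for U :: "'a obj list"
    unfolding ocontractive_def using that
    by (auto intro!: wf_TMu.IH agree_TMu[where m = m] agree_refl wf_TMu.hyps)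
  have len: "m \<le> length V" "m \<le> length V'"
    using wf_TMu.prems by (auto simp: agree_def) (meson leI less_irrefl)+
  show ?case
    unfolding canon.simps
  proof (rule ofix_view_cong)
    fix n' and X Y :: "'a obj"
    assume "n' \<le> n" "\<And>i. i < n' \<Longrightarrow> view X i = view Y i"
    then show "view (canon A (X # V)) n' = view (canon A (Y # V')) n'"
      using wf_TMu.hyps agree_le[OF wf_TMu.prems] by (auto intro!: wf_TMu.IH agree_TMu)
  qed (use c len in auto)
next
  case (wf_TLater n A) then show ?case by (auto intro!: view_later dest: agree_TLater)
next
  case (wf_TBox A m)
  \<comment> \<open>\<open>box_obj\<close> looks at all stages, beyond any n. The body is closed,
    however, and for zero variables agreement is vacuous at every stage.\<close>
  have "canon A V = canon A V'"
    by (rule view_inject) (auto intro: wf_TBox.IH simp: agree_def)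
  then show ?case by simp
qed auto

lemma canon_ocontractive:
  "wf_ty m (TMu A) \<Longrightarrow> m \<le> length V \<Longrightarrow> ocontractive (\<lambda>X. canon A (X # V))"
  unfolding ocontractive_def by (auto intro!: canon_agree agree_TMu agree_refl)

lemma canon_TMu:
  "wf_ty m (TMu A) \<Longrightarrow> m \<le> length V \<Longrightarrow> canon A (canon (TMu A) V # V) = canon (TMu A) V"
  using ofix_unfold[OF canon_ocontractive, of m A V] by simp

text \<open>The parametric relation between \<open>tden A\<close> and \<open>canon A\<close>; at \<open>TMu A\<close> it follows the chosen
  isomorphism on the left and the identity on the right.  Being a relation rather than a function, it
  needs no separate treatment of contravariant arguments.\<close>

primrec tr :: "ty \<Rightarrow> 'v::elts obj list \<Rightarrow> 'v obj list \<Rightarrow> (nat \<Rightarrow> 'v \<Rightarrow> 'v \<Rightarrow> bool) list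
    \<Rightarrow> nat \<Rightarrow> 'v \<Rightarrow> 'v \<Rightarrow> bool" where
  "tr (TVar k) W V \<rho> = \<rho> ! k"
| "tr TNat W V \<rho> = (\<lambda>i x y. x = y \<and> x \<in> elts (mkset (range vnat)))"
| "tr TOne W V \<rho> = (\<lambda>i x y. x = y \<and> x \<in> elts (mkset {vunit}))"
| "tr (TProd A B) W V \<rho> = (\<lambda>i p q. \<exists>x y x' y'. p = vpair x y \<and> q = vpair x' y' \<and>
     tr A W V \<rho> i x x' \<and> tr B W V \<rho> i y y')"
| "tr TZero W V \<rho> = (\<lambda>i x y. x = y \<and> x \<in> elts (mkset {}))"
| "tr (TSum A B) W V \<rho> = (\<lambda>i p q. (\<exists>x x'. p = vin 1 x \<and> q = vin 1 x' \<and> tr A W V \<rho> i x x') \<or>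
     (\<exists>x x'. p = vin 2 x \<and> q = vin 2 x' \<and> tr B W V \<rho> i x x'))"
| "tr (TFun A B) W V \<rho> = (\<lambda>i F G. F \<in> elts_at (tden (TFun A B) (diag W)) i \<and>
     G \<in> elts_at (canon (TFun A B) V) i \<and>
     (\<forall>j\<in>{1..i}. \<forall>x y. tr A W V \<rho> j x y \<longrightarrow> tr B W V \<rho> j (ev F j x) (ev G j y)))"
| "tr (TMu A) W V \<rho> = cfix (\<lambda>_ _. False) (\<lambda>R i x y. x \<in> elts_at (tden (TMu A) (diag W)) i \<and>
     tr A (tden (TMu A) (diag W) # W) (canon (TMu A) V # V) (R # \<rho>) i
       (snd (fixpoint (\<lambda>X. tden A ((X, X) # diag W))) i x) y)"
| "tr (TLater A) W V \<rho> = (\<lambda>i x y. if i \<le> 1 then x = vunit \<and> y = vunit else tr A W V \<rho> (i - 1) x y)"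
| "tr (TBox A) W V \<rho> = (\<lambda>i x y. x \<in> elts_at (tden (TBox A) (diag W)) i \<and>
     y \<in> elts_at (canon (TBox A) V) i \<and> (\<forall>j\<ge>1. tr A W V \<rho> j (vproj x j) (vproj y j)))"

text \<open>The counterpart of \<open>canon_agree\<close> for relations. It makes the operator
  inside \<open>tr (TMu A)\<close> contractive, so that its \<open>cfix\<close> is a genuine fixed
  point.\<close>

lemma tr_agree:
  "wf_ty m A \<Longrightarrow> agree m A n \<rho> \<rho>' \<Longrightarrow> tr A W V \<rho> n = tr A W V \<rho>' n"
proof (induction m A arbitrary: n W V \<rho> \<rho>' rule: wf_ty.induct)
  case (wf_TVar k n) then show ?case by (auto simp: agree_def)
next
  case (wf_TProd m A B)
  have "tr A W V \<rho> n = tr A W V \<rho>' n" "tr B W V \<rho> n = tr B W V \<rho>' n"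
    using wf_TProd.IH[of n \<rho> \<rho>'] wf_TProd.prems by (auto simp: agree_binary)
  then show ?case by simp
next
  case (wf_TSum m A B)
  have "tr A W V \<rho> n = tr A W V \<rho>' n" "tr B W V \<rho> n = tr B W V \<rho>' n"
    using wf_TSum.IH[of n \<rho> \<rho>'] wf_TSum.prems by (auto simp: agree_binary)
  then show ?case by simp
next
  case (wf_TFun m A B)
  have "tr A W V \<rho> i = tr A W V \<rho>' i" "tr B W V \<rho> i = tr B W V \<rho>' i" if "i \<le> n" for i
    using agree_le[OF wf_TFun.prems that] wf_TFun.IH[of i \<rho> \<rho>'] by (auto simp: agree_binary)
  then show ?case by (simp del: tden.simps canon.simps)
next
  case (wf_TMu m A)
  have c: "contractive (\<lambda>R i x y. x \<in> elts_at X i \<and> tr A W V (R # \<sigma>) i (h i x) y)"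
    if "m \<le> length \<sigma>" for X h W V and \<sigma> :: "(nat \<Rightarrow> 'a \<Rightarrow> 'a \<Rightarrow> bool) list"
  proof -
    have "tr A W V (R # \<sigma>) n = tr A W V (R' # \<sigma>) n" if "\<forall>i<n. R i = R' i" for R R' n
      using that \<open>m \<le> length \<sigma>\<close> by (intro wf_TMu.IH agree_TMu agree_refl wf_TMu.hyps) auto
    then show ?thesis unfolding contractive_def by (metis (mono_tags, lifting))
  qed
  have len: "m \<le> length \<rho>" "m \<le> length \<rho>'"
    using wf_TMu.prems by (auto simp: agree_def) (meson leI less_irrefl)+
  show ?case
    unfolding tr.simps
  proof (rule cfix_cong)
    fix n' and f g :: "nat \<Rightarrow> 'a \<Rightarrow> 'a \<Rightarrow> bool"
    assume *: "n' \<le> n" "\<And>m. m < n' \<Longrightarrow> f m = g m"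
    have "tr A W V (f # \<rho>) n' = tr A W V (g # \<rho>') n'" for W V
      using * wf_TMu.hyps agree_le[OF wf_TMu.prems] by (auto intro!: wf_TMu.IH agree_TMu)
    then show "(\<lambda>x y. x \<in> elts_at (tden (TMu A) (diag W)) n' \<and>
         tr A (tden (TMu A) (diag W) # W) (canon (TMu A) V # V) (f # \<rho>) n'
          (snd (fixpoint (\<lambda>X. tden A ((X, X) # diag W))) n' x) y) =
      (\<lambda>x y. x \<in> elts_at (tden (TMu A) (diag W)) n' \<and>
         tr A (tden (TMu A) (diag W) # W) (canon (TMu A) V # V) (g # \<rho>') n'
          (snd (fixpoint (\<lambda>X. tden A ((X, X) # diag W))) n' x) y)" by simp
  qed (use c len in \<open>auto simp del: tden.simps canon.simps\<close>)
next
  case (wf_TLater m A)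
  have "tr A W V \<rho> i = tr A W V \<rho>' i" if "i < n" for i
    using agree_TLater[OF wf_TLater.prems that] wf_TLater.IH by auto
  then show ?case by (auto intro!: ext)
next
  case (wf_TBox A m)
  have "tr A W V \<rho> i = tr A W V \<rho>' i" for i
    by (rule wf_TBox.IH) (auto simp: agree_def)
  then show ?case by (simp del: tden.simps canon.simps)
qed auto

lemma tr_TMu:
  assumes "wf_ty m (TMu A)" "m \<le> length \<rho>"
  shows "tr (TMu A) W V \<rho> i x y \<longleftrightarrow> x \<in> elts_at (tden (TMu A) (diag W)) i \<and>
     tr A (tden (TMu A) (diag W) # W) (canon (TMu A) V # V) (tr (TMu A) W V \<rho> # \<rho>) i
       (snd (fixpoint (\<lambda>X. tden A ((X, X) # diag W))) i x) y"
proof -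
  have "contractive (\<lambda>R i x y. x \<in> elts_at X i \<and> tr A W V (R # \<rho>) i (h i x) y)" for X h W V
  proof -
    have "tr A W V (R # \<rho>) n = tr A W V (R' # \<rho>) n" if "\<forall>i<n. R i = R' i" for R R' n
      using that assms by (auto intro!: tr_agree agree_TMu agree_refl)
    then show ?thesis unfolding contractive_def by (metis (mono_tags, lifting))
  qed
  note c = this
  show ?thesis
    unfolding tr.simps(8)
    by (subst cfix_unfold[OF c]) (rule refl)
qed

section \<open>Isomorphisms up to a stage, given as relations\<close>

definition bijrel :: "'v set \<Rightarrow> 'v set \<Rightarrow> ('v \<Rightarrow> 'v \<Rightarrow> bool) \<Rightarrow> bool" where
  "bijrel S T R \<longleftrightarrow> (\<forall>x y. R x y \<longrightarrow> x \<in> S \<and> y \<in> T) \<and> (\<forall>x\<in>S. \<exists>y. R x y) \<and> (\<forall>y\<in>T. \<exists>x. R x y) \<and>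
     (\<forall>x y y'. R x y \<longrightarrow> R x y' \<longrightarrow> y = y') \<and> (\<forall>x x' y. R x y \<longrightarrow> R x' y \<longrightarrow> x = x')"

text \<open>R is the graph of an isomorphism between the truncations of X and Y to the stages 1 to
  n. Nothing is demanded beyond n, so such relations can be established by induction on n.\<close>

definition rel_iso :: "nat \<Rightarrow> 'v::elts obj \<Rightarrow> 'v obj \<Rightarrow> (nat \<Rightarrow> 'v \<Rightarrow> 'v \<Rightarrow> bool) \<Rightarrow> bool" where
  "rel_iso n X Y R \<longleftrightarrow> (\<forall>i. 1 \<le> i \<longrightarrow> i \<le> n \<longrightarrow> bijrel (elts_at X i) (elts_at Y i) (R i)) \<and>
     (\<forall>i x y. 1 \<le> i \<longrightarrow> i < n \<longrightarrow> R (Suc i) x y \<longrightarrow> R i (restr X i x) (restr Y i y))"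

lemma rel_iso_mono: "rel_iso n X Y R \<Longrightarrow> m \<le> n \<Longrightarrow> rel_iso m X Y R"
  unfolding rel_iso_def by auto

lemma rel_iso_bij: "rel_iso n X Y R \<Longrightarrow> 1 \<le> i \<Longrightarrow> i \<le> n \<Longrightarrow> bijrel (elts_at X i) (elts_at Y i) (R i)"
  unfolding rel_iso_def by auto

lemma rel_iso_restr: "rel_iso n X Y R \<Longrightarrow> 1 \<le> i \<Longrightarrow> i < n \<Longrightarrow> R (Suc i) x y \<Longrightarrow>
    R i (restr X i x) (restr Y i y)"
  unfolding rel_iso_def by auto

lemma bijrel_conv: "bijrel S T R \<Longrightarrow> bijrel T S (\<lambda>x y. R y x)"
  unfolding bijrel_def by blast

lemma rel_iso_conv: "rel_iso n X Y R \<Longrightarrow> rel_iso n Y X (\<lambda>i x y. R i y x)"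
  unfolding rel_iso_def using bijrel_conv by blast

lemma rel_iso_0: "rel_iso 0 X Y R"
  by (simp add: rel_iso_def)

lemma rel_iso_Id: "is_obj X \<Longrightarrow> rel_iso n X X (\<lambda>i x y. x = y \<and> x \<in> elts_at X i)"
  by (auto simp: rel_iso_def bijrel_def is_obj_def)

lemma bijrelD:
  assumes "bijrel S T R"
  shows "R x y \<Longrightarrow> x \<in> S" "R x y \<Longrightarrow> y \<in> T" "R x y \<Longrightarrow> R x y' \<Longrightarrow> y = y'" "R x y \<Longrightarrow> R x' y \<Longrightarrow> x = x'"
    "x \<in> S \<Longrightarrow> \<exists>y. R x y" "y \<in> T \<Longrightarrow> \<exists>x. R x y"
  using assms unfolding bijrel_def by blast+

text \<open>Since one relation serves all n, its graph at each stage can be turned into a map by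
  definite description.\<close>

lemma rel_iso_imp_is_iso:
  assumes "\<And>n. rel_iso n X Y R"
  shows "is_iso X Y (\<lambda>i x. THE y. R i x y)"
proof -
  have b: "bijrel (elts_at X i) (elts_at Y i) (R i)" if "1 \<le> i" for i
    using rel_iso_bij[OF assms that] by blast
  have r: "R i (restr X i x) (restr Y i y)" if "1 \<le> i" "R (Suc i) x y" for i x y
    using rel_iso_restr[OF assms that(1) _ that(2)] by blast
  have f: "(THE y. R i x y) = y" if "1 \<le> i" "R i x y" for i x y
    using that bijrelD(3)[OF b] by (intro the_equality) blast+
  have g: "(THE x. R i x y) = x" if "1 \<le> i" "R i x y" for i x y
    using that bijrelD(4)[OF b] by (intro the_equality) blast+
  have f_mor: "is_mor X Y (\<lambda>i x. THE y. R i x y)"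
    unfolding is_mor_def
  proof (intro conjI allI impI ballI)
    fix i x assume i: "(1::nat) \<le> i" and "x \<in> elts_at X i"
    then obtain y where "R i x y" using bijrelD(5)[OF b] by blast
    then show "(THE y. R i x y) \<in> elts_at Y i" using f[OF i] bijrelD(2)[OF b[OF i]] by simp
  next
    fix i x assume i: "(1::nat) \<le> i" and "x \<in> elts_at X (Suc i)"
    then obtain y where y: "R (Suc i) x y" using bijrelD(5)[OF b] by (metis le_SucI)
    then show "(THE y. R i (restr X i x) y) = restr Y i (THE y. R (Suc i) x y)"
      using f[OF i r[OF i y]] f[OF _ y] by simp
  qed
  have g_mor: "is_mor Y X (\<lambda>i y. THE x. R i x y)"
    unfolding is_mor_def
  proof (intro conjI allI impI ballI)
    fix i y assume i: "(1::nat) \<le> i" and "y \<in> elts_at Y i"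
    then obtain x where "R i x y" using bijrelD(6)[OF b] by blast
    then show "(THE x. R i x y) \<in> elts_at X i" using g[OF i] bijrelD(1)[OF b[OF i]] by simp
  next
    fix i y assume i: "(1::nat) \<le> i" and "y \<in> elts_at Y (Suc i)"
    then obtain x where x: "R (Suc i) x y" using bijrelD(6)[OF b] by (metis le_SucI)
    then show "(THE x. R i x (restr Y i y)) = restr X i (THE x. R (Suc i) x y)"
      using g[OF i r[OF i x]] g[OF _ x] by simp
  qed
  show ?thesis
    unfolding is_iso_def
  proof (intro conjI exI[of _ "\<lambda>i y. THE x. R i x y"] f_mor g_mor allI impI ballI)
    fix i x assume i: "(1::nat) \<le> i" and "x \<in> elts_at X i"
    then obtain y where "R i x y" using bijrelD(5)[OF b] by blast
    then show "(THE xa. R i xa (THE y. R i x y)) = x" using f[OF i] g[OF i] by simp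
  next
    fix i y assume i: "(1::nat) \<le> i" and "y \<in> elts_at Y i"
    then obtain x where "R i x y" using bijrelD(6)[OF b] by blast
    then show "(THE ya. R i (THE x. R i x y) ya) = y" using f[OF i] g[OF i] by simp
  qed
qed

text \<open>This composite of the graph of h with R is the shape of the \<open>TMu\<close> clause of
  \<open>tr\<close>, with h the chosen isomorphism.\<close>

lemma rel_iso_comp_iso:
  assumes "is_iso X X' h" "rel_iso n X' Y R"
  shows "rel_iso n X Y (\<lambda>i x y. x \<in> elts_at X i \<and> R i (h i x) y)"
proof -
  obtain g where h: "is_mor X X' h" and g: "is_mor X' X g"
    and gh: "\<And>i x. 1 \<le> i \<Longrightarrow> x \<in> elts_at X i \<Longrightarrow> g i (h i x) = x"
    and hg: "\<And>i x. 1 \<le> i \<Longrightarrow> x \<in> elts_at X' i \<Longrightarrow> h i (g i x) = x"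
    using assms(1) unfolding is_iso_def by blast
  have "bijrel (elts_at X i) (elts_at Y i) (\<lambda>x y. x \<in> elts_at X i \<and> R i (h i x) y)" if "1 \<le> i" "i \<le> n" for i
  proof -
    note b = rel_iso_bij[OF assms(2) that]
    have hm: "h i x \<in> elts_at X' i" if "x \<in> elts_at X i" for x
      using h that \<open>1 \<le> i\<close> by (auto simp: is_mor_def)
    have gm: "g i x \<in> elts_at X i" if "x \<in> elts_at X' i" for x
      using g that \<open>1 \<le> i\<close> by (auto simp: is_mor_def)
    have "\<exists>x. x \<in> elts_at X i \<and> R i (h i x) y" if y: "y \<in> elts_at Y i" for y
    proof -
      obtain x' where "R i x' y" using bijrelD(6)[OF b y] by blast
      then show ?thesis using hg[OF \<open>1 \<le> i\<close>, of x'] gm[of x'] bijrelD(1)[OF b] by metis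
    qed
    moreover have "x = x'" if "x \<in> elts_at X i" "R i (h i x) y" "x' \<in> elts_at X i" "R i (h i x') y" for x x' y
      using bijrelD(4)[OF b that(2,4)] gh[OF \<open>1 \<le> i\<close>] that by metis
    moreover have "\<exists>y. x \<in> elts_at X i \<and> R i (h i x) y" if "x \<in> elts_at X i" for x
      using bijrelD(5)[OF b hm[OF that]] that by blast
    ultimately show ?thesis
      unfolding bijrel_def using bijrelD(2,3)[OF b] by (intro conjI) blast+
  qed
  moreover have "restr X i x \<in> elts_at X i \<and> R i (h i (restr X i x)) (restr Y i y)"
    if "1 \<le> i" "i < n" "x \<in> elts_at X (Suc i)" "R (Suc i) (h (Suc i) x) y" for i x y
  proof -
    have "g (Suc i) (h (Suc i) x) = x" using gh[of "Suc i" x] that by simp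
    moreover have "h (Suc i) x \<in> elts_at X' (Suc i)" using h that by (auto simp: is_mor_def)
    \<comment> \<open>Naturality of the inverse g, read at the point
      \<open>h (Suc i) x\<close>.\<close>
    ultimately have "restr X i x = g i (restr X' i (h (Suc i) x))"
      using g that(1) unfolding is_mor_def by metis
    moreover have r: "R i (restr X' i (h (Suc i) x)) (restr Y i y)"
      using rel_iso_restr[OF assms(2) that(1,2,4)] .
    moreover have "restr X' i (h (Suc i) x) \<in> elts_at X' i"
      using bijrelD(1)[OF rel_iso_bij[OF assms(2)] r] that by simp
    ultimately show ?thesis
      using hg[OF that(1)] g that(1) unfolding is_mor_def by metis
  qed
  ultimately show ?thesis unfolding rel_iso_def by auto
qed

section \<open>The constructions on objects preserve isomorphism up to a stage\<close>

context zf_model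
begin

lemma rel_iso_delta: "rel_iso n (delta Z) (delta Z) (\<lambda>i x y. x = y \<and> x \<in> elts (Z :: 'v))"
  using rel_iso_Id[OF is_obj_delta, of n Z] by (simp add: elts_delta)

lemma rel_iso_prod:
  fixes X :: "'v obj"
  assumes "rel_iso n X X' P" "rel_iso n Y Y' Q"
  shows "rel_iso n (prod_obj X Y) (prod_obj X' Y')
    (\<lambda>i p q. \<exists>x y x' y'. p = vpair x y \<and> q = vpair x' y' \<and> P i x x' \<and> Q i y y')"
proof -
  have "bijrel (elts_at (prod_obj X Y) i) (elts_at (prod_obj X' Y') i)
      (\<lambda>p q. \<exists>x y x' y'. p = vpair x y \<and> q = vpair x' y' \<and> P i x x' \<and> Q i y y')"
    if "1 \<le> i" "i \<le> n" for i
    using rel_iso_bij[OF assms(1) that] rel_iso_bij[OF assms(2) that]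
    unfolding bijrel_def elts_prod
    by (auto simp: vpair_inject)
  then show ?thesis
    unfolding rel_iso_def using rel_iso_restr[OF assms(1)] rel_iso_restr[OF assms(2)]
    by (auto simp: restr_prod vpair_inject)
qed

lemma rel_iso_sum:
  fixes X :: "'v obj"
  assumes "rel_iso n X X' P" "rel_iso n Y Y' Q"
  shows "rel_iso n (sum_obj X Y) (sum_obj X' Y')
    (\<lambda>i p q. (\<exists>x x'. p = vin 1 x \<and> q = vin 1 x' \<and> P i x x') \<or> (\<exists>x x'. p = vin 2 x \<and> q = vin 2 x' \<and> Q i x x'))"
proof -
  have "bijrel (elts_at (sum_obj X Y) i) (elts_at (sum_obj X' Y') i)
      (\<lambda>p q. (\<exists>x x'. p = vin 1 x \<and> q = vin 1 x' \<and> P i x x') \<or> (\<exists>x x'. p = vin 2 x \<and> q = vin 2 x' \<and> Q i x x'))"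
    if "1 \<le> i" "i \<le> n" for i
    using rel_iso_bij[OF assms(1) that] rel_iso_bij[OF assms(2) that]
    unfolding bijrel_def elts_sum
    by (auto simp: vin_inject)
  then show ?thesis
    unfolding rel_iso_def using rel_iso_restr[OF assms(1)] rel_iso_restr[OF assms(2)]
    by (auto simp: restr_sum vin_inject)
qed

text \<open>The assumption reaches one stage less far than the conclusion. This gain carries the
  induction on the stage for recursive types.\<close>

lemma rel_iso_later:
  fixes X :: "'v obj"
  assumes "rel_iso (n - 1) X X' P"
  shows "rel_iso n (later_obj X) (later_obj X') (\<lambda>i x y. if i \<le> 1 then x = vunit \<and> y = vunit else P (i - 1) x y)"
proof -
  have "bijrel (elts_at (later_obj X) i) (elts_at (later_obj X') i)
     (\<lambda>x y. if i \<le> 1 then x = vunit \<and> y = vunit else P (i - 1) x y)" if "1 \<le> i" "i \<le> n" for i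
  proof (cases "i = 1")
    case True then show ?thesis by (auto simp: bijrel_def elts_later)
  next
    case False
    then show ?thesis using rel_iso_bij[OF assms, of "i - 1"] that by (simp add: elts_later)
  qed
  moreover have "P (i - 1) (restr X (i - 1) x) (restr X' (i - 1) y)"
    if "\<not> i \<le> 1" "i < n" "P i x y" for i x y
    using rel_iso_restr[OF assms, of "i - 1" x y] that by auto
  ultimately show ?thesis
    unfolding rel_iso_def restr_later by auto
qed

text \<open>A single element of \<open>box_obj X\<close> contains values at all stages, so the
  assumption is made for every n. Types beneath \<open>TBox\<close> are closed and can satisfy
  it.\<close>

lemma rel_iso_box:
  fixes X :: "'v obj"
  assumes "\<And>n. rel_iso n X X' P"
  shows "rel_iso n (box_obj X) (box_obj X') (\<lambda>i x y. x \<in> elts_at (box_obj X) i \<and> y \<in> elts_at (box_obj X') i \<and>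
     (\<forall>j\<ge>1. P j (vproj x j) (vproj y j)))"
proof -
  \<comment> \<open>Totality and uniqueness are shown for arbitrary objects and P; with P reversed
    they become surjectivity and injectivity.\<close>
  have total: "\<exists>y. y \<in> elts_at (box_obj X') i \<and> (\<forall>j\<ge>1. P j (vproj x j) (vproj y j))"
    if iso: "\<And>n. rel_iso n X X' P" and x: "x \<in> elts_at (box_obj X) i" for X X' P and x :: 'v and i
  proof -
    have b: "bijrel (elts_at X i) (elts_at X' i) (P i)" if "1 \<le> i" for i
      using rel_iso_bij[OF iso that] by blast
    have g: "glob X (vproj x)" by (rule box_proj[OF x])
    then have "\<forall>j. \<exists>z. 1 \<le> j \<longrightarrow> P j (vproj x j) z"
      using bijrelD(5)[OF b] unfolding glob_def by blast
    then obtain z where z: "\<And>j. 1 \<le> j \<Longrightarrow> P j (vproj x j) (z j)" by metis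
    have "glob X' z" unfolding glob_def
    proof (intro allI impI conjI)
      fix j :: nat assume j: "1 \<le> j"
      show "z j \<in> elts_at X' j" using bijrelD(2)[OF b[OF j] z[OF j]] .
      have "P j (restr X j (vproj x (Suc j))) (restr X' j (z (Suc j)))"
        using rel_iso_restr[OF iso[of "Suc j"] j _ z[of "Suc j"]] by simp
      then have "P j (vproj x j) (restr X' j (z (Suc j)))"
        using g j by (simp add: glob_def)
      then show "restr X' j (z (Suc j)) = z j" using bijrelD(3)[OF b[OF j]] z[OF j] by blast
    qed
    then have "vtuple {1..} z \<in> elts_at (box_obj X') i" by (auto simp: elts_box)
    then show ?thesis using z by (intro exI[of _ "vtuple {1..} z"]) (auto simp: vproj_vtuple)
  qed
  have unique: "y = y'"
    if iso: "\<And>n. rel_iso n X X' P" and y: "y \<in> elts_at (box_obj X') i" "y' \<in> elts_at (box_obj X') i"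
      "(\<forall>j\<ge>1. P j (vproj x j) (vproj y j))" "(\<forall>j\<ge>1. P j (vproj x j) (vproj y' j))"
    for X X' P and x y y' :: 'v and i
  proof -
    have b: "bijrel (elts_at X i) (elts_at X' i) (P i)" if "1 \<le> i" for i
      using rel_iso_bij[OF iso that] by blast
    have "vproj y j = vproj y' j" if "j \<ge> 1" for j
      using bijrelD(3)[OF b[OF that]] y(3,4) that by blast
    then have "vtuple {1..} (vproj y) = vtuple {1..} (vproj y')"
      by (simp add: vtuple_eq_iff)
    then show ?thesis using box_proj(2)[OF y(1)] box_proj(2)[OF y(2)] by simp
  qed
  have conv: "\<And>n. rel_iso n X' X (\<lambda>i x y. P i y x)" using rel_iso_conv[OF assms] .
  have "bijrel (elts_at (box_obj X) i) (elts_at (box_obj X') i) (\<lambda>x y. x \<in> elts_at (box_obj X) i \<and> y \<in> elts_at (box_obj X') i \<and>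
     (\<forall>j\<ge>1. P j (vproj x j) (vproj y j)))" if "1 \<le> i" for i
    unfolding bijrel_def
    using total[OF assms, of _ i] total[OF conv, of _ i] unique[OF assms, of _ i] unique[OF conv, of _ i]
    by (intro conjI) blast+
  then show ?thesis unfolding rel_iso_def restr_box by (auto simp: elts_box)
qed

text \<open>The witness is F conjugated by the two bijections: undo P, apply F, follow Q.\<close>

lemma exp_transfer:
  fixes X :: "'v obj"
  assumes P: "rel_iso n X X' P" and Q: "rel_iso n Y Y' Q" and X: "is_obj X"
    and F: "F \<in> elts_at (exp_obj X Y) i" and i: "i \<le> n"
  shows "\<exists>G\<in>elts_at (exp_obj X' Y') i. \<forall>j\<in>{1..i}. \<forall>x x'. P j x x' \<longrightarrow> Q j (ev F j x) (ev G j x')"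
proof -
  have bP: "bijrel (elts_at X j) (elts_at X' j) (P j)" if "1 \<le> j" "j \<le> i" for j
    using rel_iso_bij[OF P, of j] that i by auto
  have bQ: "bijrel (elts_at Y j) (elts_at Y' j) (Q j)" if "1 \<le> j" "j \<le> i" for j
    using rel_iso_bij[OF Q, of j] that i by auto
  have e: "exp_mor X Y i (ev F)" by (rule exp_ev[OF F X])
  define g where "g j x' = (THE y'. \<exists>x. P j x x' \<and> Q j (ev F j x) y')" for j x'
  have key: "Q j (ev F j x) (g j x')" if j: "1 \<le> j" "j \<le> i" and x: "P j x x'" for j x x'
  proof -
    have "ev F j x \<in> elts_at Y j" using e bijrelD(1)[OF bP[OF j] x] j by (auto simp: exp_mor_def)
    then obtain y' where y': "Q j (ev F j x) y'" using bijrelD(5)[OF bQ[OF j]] by blast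
    have "g j x' = y'" unfolding g_def
    proof (rule the_equality)
      show "\<exists>x. P j x x' \<and> Q j (ev F j x) y'" using x y' by blast
      fix z assume "\<exists>x. P j x x' \<and> Q j (ev F j x) z"
      then show "z = y'" using bijrelD(4)[OF bP[OF j]] x y' bijrelD(3)[OF bQ[OF j]] by metis
    qed
    then show ?thesis using y' by simp
  qed
  have "exp_mor X' Y' i g"
    unfolding exp_mor_def
  proof (intro conjI ballI)
    fix j x' assume j: "j \<in> {1..i}" and "x' \<in> elts_at X' j"
    then obtain x where "P j x x'" using bijrelD(6)[OF bP] by force
    then show "g j x' \<in> elts_at Y' j" using key[of j x x'] bijrelD(2)[OF bQ] j by force
  next
    fix j x' assume j: "j \<in> {1..<i}" and "x' \<in> elts_at X' (Suc j)"
    then obtain x where x: "P (Suc j) x x'" using bijrelD(6)[OF bP, of "Suc j"] by force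
    have x0: "x \<in> elts_at X (Suc j)" using bijrelD(1)[OF bP x] j by auto
    \<comment> \<open>Both sides of the naturality equation for g turn out to be the Q-image of
      \<open>ev F j (restr X j x)\<close>.\<close>
    have "Q j (restr Y j (ev F (Suc j) x)) (restr Y' j (g (Suc j) x'))"
      using rel_iso_restr[OF Q, of j] key[OF _ _ x] j i by auto
    moreover have "restr Y j (ev F (Suc j) x) = ev F j (restr X j x)"
      using e j x0 by (auto simp: exp_mor_def)
    moreover have "Q j (ev F j (restr X j x)) (g j (restr X' j x'))"
      using rel_iso_restr[OF P, of j] x j i by (intro key) auto
    ultimately show "g j (restr X' j x') = restr Y' j (g (Suc j) x')"
      using bijrelD(3)[OF bQ[of j]] j by simp
  qed
  then have "tup X' i g \<in> elts_at (exp_obj X' Y') i" by (rule tup_in_exp)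
  moreover have "Q j (ev F j x) (ev (tup X' i g) j x')" if "j \<in> {1..i}" "P j x x'" for j x x'
    using key[of j x x'] bijrelD(2)[OF bP[of j] that(2)] that by (simp add: ev_tup)
  ultimately show ?thesis by blast
qed

lemma rel_iso_exp:
  fixes X :: "'v obj"
  assumes P: "rel_iso n X X' P" and Q: "rel_iso n Y Y' Q" and X: "is_obj X" "is_obj X'"
  shows "rel_iso n (exp_obj X Y) (exp_obj X' Y') (\<lambda>i F G. F \<in> elts_at (exp_obj X Y) i \<and>
     G \<in> elts_at (exp_obj X' Y') i \<and> (\<forall>j\<in>{1..i}. \<forall>x y. P j x y \<longrightarrow> Q j (ev F j x) (ev G j y)))"
proof -
  have unique: "G = G'" if P: "rel_iso n X X' P" and Q: "rel_iso n Y Y' Q" and i: "i \<le> n"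
    and G: "G \<in> elts_at (exp_obj X' Y') i" "G' \<in> elts_at (exp_obj X' Y') i"
      "\<forall>j\<in>{1..i}. \<forall>x y. P j x y \<longrightarrow> Q j (ev F j x) (ev G j y)"
      "\<forall>j\<in>{1..i}. \<forall>x y. P j x y \<longrightarrow> Q j (ev F j x) (ev G' j y)"
      for X X' Y Y' P Q i and F G G' :: 'v
  proof (rule exp_ext[OF G(1,2)])
    fix j x' assume j: "1 \<le> j" "j \<le> i" and x': "x' \<in> elts_at X' j"
    then obtain x where "P j x x'" using bijrelD(6)[OF rel_iso_bij[OF P, of j]] i by force
    then show "ev G j x' = ev G' j x'"
      using G(3,4) j bijrelD(3)[OF rel_iso_bij[OF Q, of j]] i by fastforce
  qed
  note conv = rel_iso_conv[OF P] rel_iso_conv[OF Q]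
  have "bijrel (elts_at (exp_obj X Y) i) (elts_at (exp_obj X' Y') i) (\<lambda>F G. F \<in> elts_at (exp_obj X Y) i \<and>
     G \<in> elts_at (exp_obj X' Y') i \<and> (\<forall>j\<in>{1..i}. \<forall>x y. P j x y \<longrightarrow> Q j (ev F j x) (ev G j y)))"
    if "1 \<le> i" "i \<le> n" for i
    unfolding bijrel_def
  proof (intro conjI allI impI ballI)
    fix F assume "F \<in> elts_at (exp_obj X Y) i"
    then show "\<exists>G. F \<in> elts_at (exp_obj X Y) i \<and>
     G \<in> elts_at (exp_obj X' Y') i \<and> (\<forall>j\<in>{1..i}. \<forall>x y. P j x y \<longrightarrow> Q j (ev F j x) (ev G j y))"
      using exp_transfer[OF P Q X(1) _ that(2)] by blast
  next
    fix F assume "F \<in> elts_at (exp_obj X' Y') i"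
    then show "\<exists>G. G \<in> elts_at (exp_obj X Y) i \<and>
     F \<in> elts_at (exp_obj X' Y') i \<and> (\<forall>j\<in>{1..i}. \<forall>x y. P j x y \<longrightarrow> Q j (ev G j x) (ev F j y))"
      using exp_transfer[OF conv X(2) _ that(2)] by blast
  qed (use unique[OF P Q that(2)] unique[OF conv that(2)] in blast)+
  moreover have "restr (exp_obj X Y) i F \<in> elts_at (exp_obj X Y) i"
    if "1 \<le> i" "F \<in> elts_at (exp_obj X Y) (Suc i)" for i F
    using is_objD[OF is_obj_exp[OF X(1)] that] .
  moreover have "restr (exp_obj X' Y') i F \<in> elts_at (exp_obj X' Y') i"
    if "1 \<le> i" "F \<in> elts_at (exp_obj X' Y') (Suc i)" for i F
    using is_objD[OF is_obj_exp[OF X(2)] that] .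
  ultimately show ?thesis unfolding rel_iso_def
    by (auto simp: ev_restr)
qed

section \<open>Existence of solutions for recursive types\<close>

lemma is_obj_canon:
  "wf_ty m A \<Longrightarrow> m \<le> length V \<Longrightarrow> (\<And>k. k < m \<Longrightarrow> is_obj (V ! k)) \<Longrightarrow> is_obj (canon A V :: 'v obj)"
proof (induction m A arbitrary: V rule: wf_ty.induct)
  case (wf_TMu m A)
  have "is_obj (canon A (X # V))" if "is_obj X" for X
    using that wf_TMu.prems by (intro wf_TMu.IH) (auto simp: less_Suc_eq_0_disj)
  then show ?case
    using wf_TMu by (auto intro!: is_obj_ofix canon_ocontractive)
qed (auto intro!: is_obj_delta is_obj_prod is_obj_sum is_obj_exp is_obj_later is_obj_box)

text \<open>A single solution, whatever its origin, suffices for the choice made by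
  \<open>fixpoint\<close> to meet its specification.\<close>

lemma fixpoint_exists:
  assumes "is_obj X" "is_iso X (F X) h" "fixpoint F = (Y, k)"
  shows "is_obj Y" "is_iso Y (F Y) k"
proof -
  have "case fixpoint F of (X, h) \<Rightarrow> is_obj X \<and> is_iso X (F X) h"
    unfolding fixpoint_def by (rule someI[of _ "(X, h)"]) (simp add: assms)
  then show "is_obj Y" "is_iso Y (F Y) k" by (simp_all add: assms(3))
qed

lemma is_iso_sym: "is_iso X Y f \<Longrightarrow> \<exists>g. is_iso Y X g"
  unfolding is_iso_def by blast

text \<open>At \<open>TMu A\<close> the induction hypothesis is used twice: with identity relations on the fixed point
  of \<open>canon A\<close>, which then is a fixed point of \<open>tden A\<close> as well, and with the relation under
  construction, by induction on the stage.\<close>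

lemma tden_canon_iso:
  "wf_ty m A \<Longrightarrow> m \<le> length W \<Longrightarrow> m \<le> length V \<Longrightarrow> m \<le> length \<rho> \<Longrightarrow>
   (\<And>k. k < m \<Longrightarrow> is_obj (W ! k) \<and> is_obj (V ! k) \<and> rel_iso (n - 1) (W ! k) (V ! k) (\<rho> ! k) \<and>
      (\<not> guarded k A \<longrightarrow> rel_iso n (W ! k) (V ! k) (\<rho> ! k))) \<Longrightarrow>
   is_obj (tden A (diag W)) \<and> rel_iso n (tden A (diag W)) (canon A V) (tr A W V \<rho> :: nat \<Rightarrow> 'v \<Rightarrow> 'v \<Rightarrow> bool)"
proof (induction m A arbitrary: n W V \<rho> rule: wf_ty.induct)
  case (wf_TProd m A B)
  have "is_obj (tden A (diag W)) \<and> rel_iso n (tden A (diag W)) (canon A V) (tr A W V \<rho>)"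
    using wf_TProd.prems by (intro wf_TProd.IH) auto
  moreover have "is_obj (tden B (diag W)) \<and> rel_iso n (tden B (diag W)) (canon B V) (tr B W V \<rho>)"
    using wf_TProd.prems by (intro wf_TProd.IH) auto
  ultimately show ?case using is_obj_prod rel_iso_prod by simp
next
  case (wf_TSum m A B)
  have "is_obj (tden A (diag W)) \<and> rel_iso n (tden A (diag W)) (canon A V) (tr A W V \<rho>)"
    using wf_TSum.prems by (intro wf_TSum.IH) auto
  moreover have "is_obj (tden B (diag W)) \<and> rel_iso n (tden B (diag W)) (canon B V) (tr B W V \<rho>)"
    using wf_TSum.prems by (intro wf_TSum.IH) auto
  ultimately show ?case using is_obj_sum rel_iso_sum by simp
next
  case (wf_TFun m A B)
  have A: "is_obj (tden A (diag W)) \<and> rel_iso n (tden A (diag W)) (canon A V) (tr A W V \<rho>)"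
    using wf_TFun.prems by (intro wf_TFun.IH) auto
  have B: "is_obj (tden B (diag W)) \<and> rel_iso n (tden B (diag W)) (canon B V) (tr B W V \<rho>)"
    using wf_TFun.prems by (intro wf_TFun.IH) auto
  have "is_obj (canon A V)" using wf_TFun by (intro is_obj_canon) auto
  then show ?case using A B rel_iso_exp[of n "tden A (diag W)" "canon A V"] is_obj_exp by simp
next
  case (wf_TLater m A)
  \<comment> \<open>Beneath \<open>TLater\<close> the claim is used at n - 1, where every variable
    is covered, also those that are guarded in \<open>TLater A\<close> but not in A.\<close>
  have "is_obj (tden A (diag W)) \<and> rel_iso (n - 1) (tden A (diag W)) (canon A V) (tr A W V \<rho>)"
  proof (rule wf_TLater.IH)
    fix k assume "k < m"
    note k = wf_TLater.prems(4)[OF this]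
    have "rel_iso (n - 1 - 1) (W ! k) (V ! k) (\<rho> ! k)"
      by (rule rel_iso_mono[of "n - 1"]) (use k in auto)
    with k show "is_obj (W ! k) \<and> is_obj (V ! k) \<and> rel_iso (n - 1 - 1) (W ! k) (V ! k) (\<rho> ! k) \<and>
      (\<not> guarded k A \<longrightarrow> rel_iso (n - 1) (W ! k) (V ! k) (\<rho> ! k))" by blast
  qed (use wf_TLater.prems in auto)
  then show ?case using is_obj_later rel_iso_later by simp
next
  case (wf_TBox A m)
  have "is_obj (tden A (diag W)) \<and> rel_iso n (tden A (diag W)) (canon A V) (tr A W V \<rho>)" for n
    using wf_TBox.prems by (intro wf_TBox.IH) auto
  then show ?case using is_obj_box rel_iso_box by simp
next
  case (wf_TMu m A)
  have wf: "wf_ty m (TMu A)" using wf_TMu by auto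
  define F where "F = (\<lambda>X. tden A (diag (X # W)))"
  define X where "X = tden (TMu A) (diag W)"
  define h where "h = snd (fixpoint F)"
  have Xh: "fixpoint F = (X, h)" by (simp add: X_def h_def F_def)
  define Z where "Z = canon (TMu A) W"
  have Z: "is_obj Z" unfolding Z_def using wf wf_TMu.prems by (intro is_obj_canon) auto
  \<comment> \<open>W stands on both sides: the given relations between W and V reach only stage n,
    whereas the identities are isomorphisms at all stages, as a solution of the equation
    requires.\<close>
  have "rel_iso n (tden A (diag (Z # W))) (canon A (Z # W))
     (tr A (Z # W) (Z # W) (map (\<lambda>X i x y. x = y \<and> x \<in> elts_at X i) (Z # W)))" for n
    using wf_TMu.prems Z
    by (intro conjunct2[OF wf_TMu.IH]) (auto simp: less_Suc_eq_0_disj intro!: rel_iso_Id)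
  from rel_iso_imp_is_iso[OF this] have "\<exists>h. is_iso (F Z) Z h"
    using canon_TMu[OF wf wf_TMu.prems(1)] by (auto simp: F_def Z_def)
  then obtain g where "is_iso Z (F Z) g" using is_iso_sym by blast
  from fixpoint_exists[OF Z this Xh] have X: "is_obj X" "is_iso X (F X) h" .
  define Y where "Y = canon (TMu A) V"
  have Y: "is_obj Y" unfolding Y_def using wf wf_TMu.prems by (intro is_obj_canon) auto
  have AY: "canon A (Y # V) = Y" unfolding Y_def by (rule canon_TMu[OF wf wf_TMu.prems(2)])
  define R where "R = tr (TMu A) W V \<rho>"
  have R: "R = (\<lambda>i x y. x \<in> elts_at X i \<and> tr A (X # W) (Y # V) (R # \<rho>) i (h i x) y)"
    using tr_TMu[OF wf wf_TMu.prems(3), of W V] unfolding R_def X_def Y_def h_def F_def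
    by (intro ext) simp
  have "rel_iso n' X Y R" if "n' \<le> n" for n'
    using that
  proof (induction n' rule: less_induct)
    case (less n')
    \<comment> \<open>Index 0 is guarded in A, so R itself is needed only up to n' - 1, where it is
      already known; for n' = 0 the claim is empty.\<close>
    have "rel_iso (n' - 1) X Y R"
      using less.IH[of "n' - 1"] less.prems by (cases "n' = 0") (auto intro: rel_iso_0)
    moreover have "rel_iso (n' - 1) (W ! k) (V ! k) (\<rho> ! k)"
      "\<not> guarded (Suc k) A \<longrightarrow> rel_iso n' (W ! k) (V ! k) (\<rho> ! k)" if "k < m" for k
      using wf_TMu.prems(4)[OF that] less.prems by (auto intro: rel_iso_mono)
    ultimately have "rel_iso n' (F X) (canon A (Y # V)) (tr A (X # W) (Y # V) (R # \<rho>))"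
      unfolding F_def using wf_TMu.prems X Y wf_TMu.hyps
      by (intro conjunct2[OF wf_TMu.IH]) (auto simp: less_Suc_eq_0_disj)
    then have "rel_iso n' X Y (\<lambda>i x y. x \<in> elts_at X i \<and> tr A (X # W) (Y # V) (R # \<rho>) i (h i x) y)"
      using AY by (intro rel_iso_comp_iso[OF X(2)]) simp
    then show ?case using R by metis
  qed
  then show ?case using X(1) unfolding R_def X_def Y_def by simp
qed (auto intro!: is_obj_delta rel_iso_delta)

lemma is_obj_cden: "wf_ty 0 A \<Longrightarrow> is_obj (cden A :: 'v obj)"
  using tden_canon_iso[of 0 A "[]" "[]" "[]"] by simp

text \<open>\<open>tden_canon_iso\<close> relates the chosen object to \<open>canon\<close> without
  saying that it solves its equation, so the solution on the canonical side is offered to the choice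
  once more, for closed types.\<close>

lemma unfold_iso:
  assumes wf: "wf_ty 0 (TMu A)"
  shows "is_iso (cden (TMu A) :: 'v obj) (cden (tinst A (TMu A))) (unfold_iso A)"
proof -
  define F :: "'v obj \<Rightarrow> 'v obj" where "F = (\<lambda>X. tden A [(X, X)])"
  define Z :: "'v obj" where "Z = canon (TMu A) []"
  have Z: "is_obj Z" unfolding Z_def using wf by (intro is_obj_canon) auto
  have A: "wf_ty (Suc 0) A" using wf by auto
  have "rel_iso n (tden A (diag [Z])) (canon A [Z])
     (tr A [Z] [Z] (map (\<lambda>X i x y. x = y \<and> x \<in> elts_at X i) [Z]))" for n
    using Z by (intro conjunct2[OF tden_canon_iso[OF A]]) (auto intro!: rel_iso_Id)
  moreover have "canon A [Z] = Z" using canon_TMu[OF wf, of "[]"] by (simp add: Z_def)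
  ultimately have "\<exists>h. is_iso (F Z) Z h"
    using rel_iso_imp_is_iso[of "F Z" Z] by (auto simp: F_def)
  then obtain g where "is_iso Z (F Z) g" using is_iso_sym by blast
  from fixpoint_exists(2)[where F = F, OF Z this prod.collapse[symmetric]]
  show ?thesis unfolding tden_tinst[OF wf] by (simp add: F_def unfold_iso_def)
qed

end

section \<open>Substitution and reduction of terms\<close>

lemma sub_Var: "sub Var t = t"
proof -
  have "lift_sub n Var = Var" for n by (auto simp: lift_sub_def)
  then have "s = Var \<Longrightarrow> sub s t = t" for s
    by (induction s t rule: sub.induct) (auto intro: map_idI)
  then show ?thesis by simp
qed

lemma ren_eq_sub: "ren r t = sub (Var \<circ> r) t"
proof -
  have "lift_sub n (Var \<circ> r) = Var \<circ> lift_ren n r" for n r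
    by (auto simp: lift_sub_def lift_ren_def)
  then show ?thesis by (induction r t rule: ren.induct) auto
qed

text \<open>Lifting a substitution renames its values, so the binder cases of \<open>sub_sub\<close>
  rest on the two mixed laws for renaming and substitution.\<close>

lemma sub_ren: "sub s (ren r t) = sub (s \<circ> r) t"
proof -
  have "lift_sub n s \<circ> lift_ren n r = lift_sub n (s \<circ> r)" for n s r
    by (auto simp: lift_sub_def lift_ren_def)
  then show ?thesis by (induction r t arbitrary: s rule: ren.induct) auto
qed

lemma ren_ren: "ren r (ren r' t) = ren (r \<circ> r') t"
  by (simp add: ren_eq_sub[of r] ren_eq_sub[of "r \<circ> r'"] sub_ren comp_assoc)

lemma ren_sub: "ren r (sub s t) = sub (ren r \<circ> s) t"
proof -
  have "ren (lift_ren n r) \<circ> lift_sub n s = lift_sub n (ren r \<circ> s)" for n s r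
    by (auto simp: lift_sub_def lift_ren_def ren_ren fun_eq_iff intro!: arg_cong2[where f = ren])
  then show ?thesis by (induction s t arbitrary: r rule: sub.induct) auto
qed

lemma sub_sub: "sub s (sub s' t) = sub (sub s \<circ> s') t"
proof -
  have "sub (lift_sub n s) \<circ> lift_sub n s' = lift_sub n (sub s \<circ> s')" for n s s'
    by (auto simp: lift_sub_def fun_eq_iff sub_ren ren_sub intro!: arg_cong2[where f = sub])
  then show ?thesis by (induction s' t arbitrary: s rule: sub.induct) auto
qed

definition env_sub :: "tm list \<Rightarrow> (nat \<Rightarrow> tm) \<Rightarrow> nat \<Rightarrow> tm" where
  "env_sub us s k = (if k < length us then us ! k else s (k - length us))"

text \<open>Contracting a redex whose body was closed by s is the same as closing the body by s
  extended with the arguments. The fundamental lemmas can therefore apply an induction hypothesis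
  after each contraction.\<close>

lemma inst_lift_sub: "length us = n \<Longrightarrow> inst (sub (lift_sub n s) t) us = sub (env_sub us s) t"
  unfolding inst_def sub_sub
  by (rule arg_cong2[where f = sub])
     (auto simp: fun_eq_iff env_sub_def lift_sub_def sub_ren comp_def sub_Var)

lemma inst_Nil: "inst t [] = t"
  by (simp add: inst_def sub_Var)

lemma lift_sub_0: "lift_sub 0 s = s"
  by (auto simp: lift_sub_def fun_eq_iff ren_eq_sub comp_def sub_Var)

section \<open>Typing under renaming and substitution\<close>

lemma typing_wf: "\<Gamma> \<turnstile> t \<Ztypecolon> A \<Longrightarrow> wf_ty 0 A"
proof (induction rule: typing.induct)
  case (ty_Unfold \<Gamma> t A) then show ?case by (simp add: wf_ty_tinst)
qed auto

lemma typing_ren: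
  "\<Gamma> \<turnstile> t \<Ztypecolon> A \<Longrightarrow> (\<And>k. k < length \<Gamma> \<Longrightarrow> r k < length \<Delta> \<and> \<Delta> ! r k = \<Gamma> ! k) \<Longrightarrow> \<Delta> \<turnstile> ren r t \<Ztypecolon> A"
proof (induction arbitrary: r \<Delta> rule: typing.induct)
  case (ty_Var k \<Gamma>) then show ?case by (metis ren.simps(1) typing.ty_Var)
next
  case (ty_Case \<Gamma> t A B u C v)
  have "A # \<Delta> \<turnstile> ren (lift_ren 1 r) u \<Ztypecolon> C"  "B # \<Delta> \<turnstile> ren (lift_ren 1 r) v \<Ztypecolon> C"
    using ty_Case.prems by (auto intro!: ty_Case.IH simp: lift_ren_def less_Suc_eq_0_disj)
  then show ?case using ty_Case.IH(1)[OF ty_Case.prems] by (auto intro: typing.ty_Case)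
next
  case (ty_Lam A \<Gamma> t B)
  have "A # \<Delta> \<turnstile> ren (lift_ren 1 r) t \<Ztypecolon> B"
    using ty_Lam.prems by (intro ty_Lam.IH) (auto simp: lift_ren_def less_Suc_eq_0_disj)
  then show ?case using ty_Lam.hyps by (auto intro: typing.ty_Lam)
next
  case (ty_Prev As \<sigma> \<Gamma> t A)
  have "As \<turnstile> ren (lift_ren (length \<sigma>) r) t \<Ztypecolon> TLater A"
    using ty_Prev.hyps by (intro ty_Prev.IH) (auto simp: lift_ren_def)
  then show ?case using ty_Prev by (auto intro!: typing.ty_Prev)
next
  case (ty_Box As \<sigma> \<Gamma> t A)
  have "As \<turnstile> ren (lift_ren (length \<sigma>) r) t \<Ztypecolon> A"
    using ty_Box.hyps by (intro ty_Box.IH) (auto simp: lift_ren_def)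
  then show ?case using ty_Box by (auto intro!: typing.ty_Box)
next
  case (ty_BoxP As \<sigma> \<Gamma> t A B)
  have "As \<turnstile> ren (lift_ren (length \<sigma>) r) t \<Ztypecolon> TSum A B"
    using ty_BoxP.hyps by (intro ty_BoxP.IH) (auto simp: lift_ren_def)
  then show ?case using ty_BoxP by (auto intro!: typing.ty_BoxP)
next
  case (ty_App \<Gamma> t A B u)
  from ty_App.IH[OF ty_App.prems] show ?case by (auto intro: typing.ty_App)
next
  case (ty_Ast \<Gamma> t A B u)
  from ty_Ast.IH[OF ty_Ast.prems] show ?case by (auto intro: typing.ty_Ast)
qed (auto intro: typing.intros)

lemma typing_lift_sub:
  assumes "\<And>k. k < length \<Gamma> \<Longrightarrow> \<Delta> \<turnstile> s k \<Ztypecolon> \<Gamma> ! k" "wf_ty 0 A" "k < Suc (length \<Gamma>)"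
  shows "A # \<Delta> \<turnstile> lift_sub 1 s k \<Ztypecolon> (A # \<Gamma>) ! k"
proof (cases k)
  case 0
  then show ?thesis using ty_Var[of 0 "A # \<Delta>"] assms(2) by (simp add: lift_sub_def)
next
  case (Suc l)
  then have "A # \<Delta> \<turnstile> ren (\<lambda>m. 1 + m) (s l) \<Ztypecolon> \<Gamma> ! l" using assms(1,3) by (intro typing_ren) auto
  then show ?thesis using Suc by (simp add: lift_sub_def)
qed

lemma typing_sub:
  "\<Gamma> \<turnstile> t \<Ztypecolon> A \<Longrightarrow> (\<And>k. k < length \<Gamma> \<Longrightarrow> \<Delta> \<turnstile> s k \<Ztypecolon> \<Gamma> ! k) \<Longrightarrow> \<Delta> \<turnstile> sub s t \<Ztypecolon> A"
proof (induction arbitrary: s \<Delta> rule: typing.induct)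
  case (ty_Case \<Gamma> t A B u C v)
  have "wf_ty 0 A" "wf_ty 0 B" using typing_wf[OF ty_Case.hyps(1)] by auto
  then have "A # \<Delta> \<turnstile> sub (lift_sub 1 s) u \<Ztypecolon> C"  "B # \<Delta> \<turnstile> sub (lift_sub 1 s) v \<Ztypecolon> C"
    using ty_Case.prems by (auto intro!: ty_Case.IH typing_lift_sub)
  then show ?case using ty_Case.IH(1)[OF ty_Case.prems] by (auto intro: typing.ty_Case)
next
  case (ty_Lam A \<Gamma> t B)
  have "A # \<Delta> \<turnstile> sub (lift_sub 1 s) t \<Ztypecolon> B"
    using ty_Lam.prems ty_Lam.hyps by (intro ty_Lam.IH) (auto intro!: typing_lift_sub)
  then show ?case using ty_Lam.hyps by (auto intro: typing.ty_Lam)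
next
  case (ty_Prev As \<sigma> \<Gamma> t A)
  \<comment> \<open>The body is typed in As alone, and the lifted substitution fixes exactly these
    variables; s acts only on the entries of \<sigma>.\<close>
  have "As \<turnstile> sub (lift_sub (length \<sigma>) s) t \<Ztypecolon> TLater A"
    using ty_Prev.hyps ty_Prev.IH(1) by (intro ty_Prev.IH) (auto simp: lift_sub_def intro!: ty_Var dest: typing_wf)
  then show ?case using ty_Prev by (auto intro!: typing.ty_Prev)
next
  case (ty_Box As \<sigma> \<Gamma> t A)
  have "As \<turnstile> sub (lift_sub (length \<sigma>) s) t \<Ztypecolon> A"
    using ty_Box.hyps ty_Box.IH(1) by (intro ty_Box.IH) (auto simp: lift_sub_def intro!: ty_Var dest: typing_wf)
  then show ?case using ty_Box by (auto intro!: typing.ty_Box)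
next
  case (ty_BoxP As \<sigma> \<Gamma> t A B)
  have "As \<turnstile> sub (lift_sub (length \<sigma>) s) t \<Ztypecolon> TSum A B"
    using ty_BoxP.hyps ty_BoxP.IH(1) by (intro ty_BoxP.IH) (auto simp: lift_sub_def intro!: ty_Var dest: typing_wf)
  then show ?case using ty_BoxP by (auto intro!: typing.ty_BoxP)
next
  case (ty_App \<Gamma> t A B u)
  from ty_App.IH[OF ty_App.prems] show ?case by (auto intro: typing.ty_App)
next
  case (ty_Ast \<Gamma> t A B u)
  from ty_Ast.IH[OF ty_Ast.prems] show ?case by (auto intro: typing.ty_Ast)
qed (auto intro: typing.intros)

section \<open>Reduction in evaluation contexts\<close>

lemma ectx_comp: "ectx E \<Longrightarrow> ectx E' \<Longrightarrow> ectx (\<lambda>x. E (E' x))"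
  by (induction rule: ectx.induct) (auto intro: ectx.intros)

lemma step_ectx: "step t u \<Longrightarrow> ectx E \<Longrightarrow> step (E t) (E u)"
  by (auto elim!: step.cases intro: step.intros ectx_comp)

lemma steps_ectx: "t \<Zsurj> u \<Longrightarrow> ectx E \<Longrightarrow> E t \<Zsurj> E u"
  by (induction rule: rtranclp_induct) (auto intro: step_ectx rtranclp.rtrancl_into_rtrancl)

lemma redex_step: "redex t u \<Longrightarrow> step t u"
  using step.intros[OF ectx.intros(1)] by auto

lemma redex_steps: "redex t u \<Longrightarrow> t \<Zsurj> u"
  using redex_step by blast

lemmas steps_context =
  steps_ectx[OF _ ectx.intros(2)[OF ectx.intros(1)]]
  steps_ectx[OF _ ectx.intros(3)[OF ectx.intros(1)]]
  steps_ectx[OF _ ectx.intros(4)[OF ectx.intros(1)]]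
  steps_ectx[OF _ ectx.intros(5)[OF ectx.intros(1)]]
  steps_ectx[OF _ ectx.intros(6)[OF ectx.intros(1)]]
  steps_ectx[OF _ ectx.intros(7)[OF ectx.intros(1)]]
  steps_ectx[OF _ ectx.intros(8)[OF ectx.intros(1)]]
  steps_ectx[OF _ ectx.intros(9)[OF ectx.intros(1)]]
  steps_ectx[OF _ ectx.intros(10)[OF ectx.intros(1)]]
  steps_ectx[OF _ ectx.intros(11)[OF ectx.intros(1)]]
  steps_ectx[OF _ ectx.intros(12)[OF ectx.intros(1)]]

section \<open>Confluence of reduction\<close>

inductive cstep :: "tm \<Rightarrow> tm \<Rightarrow> bool" where
  c_redex: "redex t u \<Longrightarrow> cstep t u"
| c_Succ: "cstep t u \<Longrightarrow> cstep (Succ t) (Succ u)"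
| c_Proj1: "cstep t u \<Longrightarrow> cstep (Proj1 t) (Proj1 u)"
| c_Proj2: "cstep t u \<Longrightarrow> cstep (Proj2 t) (Proj2 u)"
| c_Case: "cstep t u \<Longrightarrow> cstep (Case t p q) (Case u p q)"
| c_App: "cstep t u \<Longrightarrow> cstep (App t p) (App u p)"
| c_Unfold: "cstep t u \<Longrightarrow> cstep (Unfold t) (Unfold u)"
| c_Prev: "cstep t u \<Longrightarrow> cstep (Prev [] t) (Prev [] u)"
| c_Ast1: "cstep t u \<Longrightarrow> cstep (Ast t p) (Ast u p)"
| c_Ast2: "cstep t u \<Longrightarrow> val v \<Longrightarrow> cstep (Ast v t) (Ast v u)"
| c_Unbox: "cstep t u \<Longrightarrow> cstep (Unbox t) (Unbox u)"
| c_BoxP: "cstep t u \<Longrightarrow> cstep (BoxP [] t) (BoxP [] u)"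

text \<open>In \<open>step\<close> the context is a function, and the shape of \<open>E t\<close>
  reveals little about E. With one rule per frame, the possible steps of a term can be found by
  inversion on its head.\<close>

lemma step_iff_cstep: "step t u \<longleftrightarrow> cstep t u"
proof
  assume "step t u"
  moreover have "ectx E \<Longrightarrow> redex p q \<Longrightarrow> cstep (E p) (E q)" for E p q
    by (induction rule: ectx.induct) (auto intro: cstep.intros)
  ultimately show "cstep t u" by (auto elim: step.cases)
next
  show "cstep t u \<Longrightarrow> step t u"
  proof (induction rule: cstep.induct)
    case (c_redex t u) then show ?case by (rule redex_step)
  next
    case (c_Ast2 t u v) then show ?case using step_ectx[OF _ ectx.intros(10)[OF ectx.intros(1)]] by blast
  qed (auto intro: step_ectx[OF _ ectx.intros(2)[OF ectx.intros(1)]]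
    step_ectx[OF _ ectx.intros(3)[OF ectx.intros(1)]]
    step_ectx[OF _ ectx.intros(4)[OF ectx.intros(1)]]
    step_ectx[OF _ ectx.intros(5)[OF ectx.intros(1)]]
    step_ectx[OF _ ectx.intros(6)[OF ectx.intros(1)]]
    step_ectx[OF _ ectx.intros(7)[OF ectx.intros(1)]]
    step_ectx[OF _ ectx.intros(8)[OF ectx.intros(1)]]
    step_ectx[OF _ ectx.intros(9)[OF ectx.intros(1)]]
    step_ectx[OF _ ectx.intros(11)[OF ectx.intros(1)]]
    step_ectx[OF _ ectx.intros(12)[OF ectx.intros(1)]])
qed

inductive_cases redexE [elim!]:
  "redex (Var k) u" "redex Zero u" "redex (Succ t) u" "redex Unit u" "redex (MkPair t t') u" "redex (Proj1 t) u"
  "redex (Proj2 t) u" "redex (Abort t) u" "redex (In1 t) u" "redex (In2 t) u" "redex (Case t p q) u"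
  "redex (Lam t) u" "redex (App t p) u" "redex (Fold t) u" "redex (Unfold t) u" "redex (Next t) u"
  "redex (Prev \<sigma> t) u" "redex (Ast t p) u" "redex (Box \<sigma> t) u" "redex (Unbox t) u" "redex (BoxP \<sigma> t) u"

inductive_cases cstepE [elim!]:
  "cstep Zero u" "cstep (Succ t) u" "cstep Unit u" "cstep (MkPair t t') u" "cstep (Proj1 t) u"
  "cstep (Proj2 t) u" "cstep (In1 t) u" "cstep (In2 t) u" "cstep (Case t p q) u"
  "cstep (Lam t) u" "cstep (App t p) u" "cstep (Fold t) u" "cstep (Unfold t) u" "cstep (Next t) u"
  "cstep (Prev \<sigma> t) u" "cstep (Ast t p) u" "cstep (Box \<sigma> t) u" "cstep (Unbox t) u" "cstep (BoxP \<sigma> t) u"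

lemma cstep_numeral: "\<not> cstep ((Succ ^^ n) Zero) u"
  by (induction n arbitrary: u) auto

text \<open>Not every value is normal: \<open>Box \<sigma> t\<close> still steps if \<sigma> is
  nonempty. The result is again a value, so a step to the right of \<open>Ast\<close> stays
  possible.\<close>

lemma cstep_val: "cstep v w \<Longrightarrow> val v \<Longrightarrow> val w"
  by (auto elim!: val.cases simp: cstep_numeral intro: val.intros)

text \<open>Reduction is not deterministic: the redex \<open>Unbox (Box \<sigma> t)\<close> contains the redex \<open>Box \<sigma> t\<close>.\<close>

definition joinable :: "tm \<Rightarrow> tm \<Rightarrow> bool" where
  "joinable u v \<longleftrightarrow> (\<exists>w. cstep\<^sup>=\<^sup>= u w \<and> cstep\<^sup>=\<^sup>= v w)"

lemma joinable_refl: "joinable u u"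
  by (auto simp: joinable_def)

lemma joinable_step: "cstep u v \<Longrightarrow> joinable u v" "cstep v u \<Longrightarrow> joinable u v"
  by (auto simp: joinable_def)

lemma joinable_square: "cstep u w \<Longrightarrow> cstep v w \<Longrightarrow> joinable u v"
  by (auto simp: joinable_def)

lemma joinable_cong:
  "(\<And>t u. cstep t u \<Longrightarrow> cstep (f t) (f u)) \<Longrightarrow> joinable u v \<Longrightarrow> joinable (f u) (f v)"
proof -
  assume f: "\<And>t u. cstep t u \<Longrightarrow> cstep (f t) (f u)" and "joinable u v"
  then obtain w where "cstep\<^sup>=\<^sup>= u w" "cstep\<^sup>=\<^sup>= v w" by (auto simp: joinable_def)
  then have "cstep\<^sup>=\<^sup>= (f u) (f w)" "cstep\<^sup>=\<^sup>= (f v) (f w)" using f by auto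
  then show ?thesis unfolding joinable_def by blast
qed

text \<open>Divergence has two sources, \<open>Unbox\<close> applied to a \<open>Box\<close> that
  can step, and \<open>Ast\<close> with a value on the left that can step. Each is closed by at most
  one step on either side.\<close>

lemma cstep_diamond: "cstep t u \<Longrightarrow> cstep t v \<Longrightarrow> joinable u v"
proof (induction arbitrary: v rule: cstep.induct)
  case (c_redex t u)
  have "cstep (Unbox (Box [] t)) t" for t
    using cstep.c_redex[OF redex.intros(11)[of "[]" t]] by (simp add: inst_Nil)
  with c_redex show ?case
    by (induction rule: redex.induct) (auto simp: joinable_refl intro: joinable_step)
next
  case (c_Unbox t u)
  have "cstep (Unbox (Box [] t)) t" for t
    using cstep.c_redex[OF redex.intros(11)[of "[]" t]] by (simp add: inst_Nil)
  with c_Unbox show ?case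
    by (auto simp: joinable_refl inst_Nil intro: joinable_cong[OF cstep.c_Unbox] joinable_step)
next
  case (c_Ast1 t u p)
  from c_Ast1.prems show ?case
  proof (cases rule: cstep.cases)
    case c_Ast2
    then show ?thesis using c_Ast1.hyps cstep_val by (auto intro: joinable_square cstep.intros)
  qed (use c_Ast1 in \<open>auto intro: joinable_cong[OF cstep.c_Ast1]\<close>)
next
  case (c_Ast2 t u v')
  from c_Ast2.prems show ?case
  proof (cases rule: cstep.cases)
    case c_Ast1
    then show ?thesis using c_Ast2.hyps cstep_val by (auto intro: joinable_square cstep.intros)
  qed (use c_Ast2 in \<open>auto intro: joinable_cong[OF cstep.c_Ast2]\<close>)
next
  case (c_Succ t u)
  then show ?case by (auto intro: joinable_cong[OF cstep.c_Succ])
next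
  case (c_Proj1 t u)
  then show ?case by (auto intro: joinable_cong[OF cstep.c_Proj1])
next
  case (c_Proj2 t u)
  then show ?case by (auto intro: joinable_cong[OF cstep.c_Proj2])
next
  case (c_Case t u p q)
  then show ?case by (auto intro: joinable_cong[where f = "\<lambda>t. Case t p q", OF cstep.c_Case])
next
  case (c_App t u p)
  then show ?case by (auto intro: joinable_cong[where f = "\<lambda>t. App t p", OF cstep.c_App])
next
  case (c_Unfold t u)
  then show ?case by (auto intro: joinable_cong[OF cstep.c_Unfold])
next
  case (c_Prev t u)
  then show ?case by (auto intro: joinable_cong[where f = "Prev []", OF cstep.c_Prev])
next
  case (c_BoxP t u)
  then show ?case by (auto intro: joinable_cong[where f = "BoxP []", OF cstep.c_BoxP])
qed

lemma step_confluent: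
  assumes "t \<Zsurj> u" "t \<Zsurj> v"
  shows "\<exists>w. u \<Zsurj> w \<and> v \<Zsurj> w"
proof -
  have diamond: "\<exists>w. step\<^sup>=\<^sup>= u w \<and> step\<^sup>=\<^sup>= v w" if "step t u" "step\<^sup>=\<^sup>= t v" for t u v
    using cstep_diamond[of t u v] that by (auto simp: step_iff_cstep joinable_def)
  have strip: "\<exists>w. step\<^sup>=\<^sup>= u w \<and> v \<Zsurj> w" if "t \<Zsurj> u" "step\<^sup>=\<^sup>= t v" for t u v
    using that
  proof (induction arbitrary: v rule: converse_rtranclp_induct)
    case (step y z)
    obtain w where w: "step\<^sup>=\<^sup>= z w" "step\<^sup>=\<^sup>= v w" using diamond step.hyps(1) step.prems by blast
    obtain w' where "step\<^sup>=\<^sup>= u w'" "w \<Zsurj> w'" using step.IH[OF w(1)] by blast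
    then show ?case using w(2) by (auto intro: converse_rtranclp_into_rtranclp)
  qed auto
  show ?thesis
    using assms(2)
  proof (induction rule: rtranclp_induct)
    case base then show ?case using assms(1) by blast
  next
    case (step v v')
    then obtain w where w: "u \<Zsurj> w" "v \<Zsurj> w" by blast
    then obtain w' where "step\<^sup>=\<^sup>= w w'" "v' \<Zsurj> w'" using strip[OF w(2), of v'] step.hyps(2) by blast
    then show ?case using w(1) by (auto intro: rtranclp.rtrancl_into_rtrancl)
  qed
qed

lemma steps_from_In1: "In1 t \<Zsurj> u \<Longrightarrow> u = In1 t"
  by (induction rule: rtranclp_induct) (auto simp: step_iff_cstep)

lemma steps_from_In2: "In2 t \<Zsurj> u \<Longrightarrow> u = In2 t"
  by (induction rule: rtranclp_induct) (auto simp: step_iff_cstep)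

text \<open>Injections are normal forms, so confluence makes the one that is reached unique. This
  identifies the results that \<open>BoxP\<close> obtains at different stages.\<close>

lemma steps_In_unique:
  "t \<Zsurj> In1 u \<Longrightarrow> t \<Zsurj> In1 v \<Longrightarrow> u = v" "t \<Zsurj> In2 u \<Longrightarrow> t \<Zsurj> In2 v \<Longrightarrow> u = v"
  "t \<Zsurj> In1 u \<Longrightarrow> \<not> t \<Zsurj> In2 v"
  using step_confluent[of t "In1 u" "In1 v"] step_confluent[of t "In2 u" "In2 v"] step_confluent[of t "In1 u" "In2 v"]
  by (auto dest!: steps_from_In1 steps_from_In2)

section \<open>Reductions of closed elimination terms\<close>

lemma env_sub_Nil [simp]: "env_sub [] s = s"
  by (simp add: env_sub_def fun_eq_iff)

lemma inst_lift_sub_1: "inst (sub (lift_sub 1 s) t) [p] = sub (env_sub [p] s) t"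
  by (rule inst_lift_sub) (simp add: One_nat_def)

text \<open>The rule fires only for a nonempty substitution; for an empty one both sides coincide
  and no step is taken.\<close>

lemma Prev_steps: "length us = n \<Longrightarrow> Prev us (sub (lift_sub n s) t) \<Zsurj> Prev [] (sub (env_sub us s) t)"
  using redex_steps[OF redex.intros(7)[of us "sub (lift_sub n s) t"]]
  by (cases "us = []") (auto simp: inst_lift_sub lift_sub_0)

lemma Box_steps: "length us = n \<Longrightarrow> Box us (sub (lift_sub n s) t) \<Zsurj> Box [] (sub (env_sub us s) t)"
  using redex_steps[OF redex.intros(10)[of us "sub (lift_sub n s) t"]]
  by (cases "us = []") (auto simp: inst_lift_sub lift_sub_0)

lemma BoxP_steps: "length us = n \<Longrightarrow> BoxP us (sub (lift_sub n s) t) \<Zsurj> BoxP [] (sub (env_sub us s) t)"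
  using redex_steps[OF redex.intros(12)[of us "sub (lift_sub n s) t"]]
  by (cases "us = []") (auto simp: inst_lift_sub lift_sub_0)

lemma steps_then_redex: "t \<Zsurj> u \<Longrightarrow> redex u v \<Longrightarrow> t \<Zsurj> v"
  using redex_step by (auto intro: rtranclp.rtrancl_into_rtrancl)

lemma elim_steps:
  "t \<Zsurj> MkPair p q \<Longrightarrow> Proj1 t \<Zsurj> p"
  "t \<Zsurj> MkPair p q \<Longrightarrow> Proj2 t \<Zsurj> q"
  "t \<Zsurj> In1 p \<Longrightarrow> Case t (sub (lift_sub 1 s) u) (sub (lift_sub 1 s) v) \<Zsurj> sub (env_sub [p] s) u"
  "t \<Zsurj> In2 p \<Longrightarrow> Case t (sub (lift_sub 1 s) u) (sub (lift_sub 1 s) v) \<Zsurj> sub (env_sub [p] s) v"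
  "t \<Zsurj> Lam p \<Longrightarrow> App t u \<Zsurj> inst p [u]"
  "t \<Zsurj> Fold p \<Longrightarrow> Unfold t \<Zsurj> p"
  "t \<Zsurj> Box [] p \<Longrightarrow> Unbox t \<Zsurj> p"
  "t \<Zsurj> Next p \<Longrightarrow> u \<Zsurj> Next q \<Longrightarrow> Ast t u \<Zsurj> Next (App p q)"
  unfolding inst_lift_sub_1[symmetric]
  using steps_then_redex[OF steps_context(10) redex.intros(11)[of "[]"], of t p]
  by (auto simp: inst_Nil intro: redex.intros val.intros rtranclp_trans
    steps_then_redex[OF steps_context(2)] steps_then_redex[OF steps_context(3)] steps_then_redex[OF steps_context(4)]
    steps_then_redex[OF steps_context(5)] steps_then_redex[OF steps_context(6)]
    steps_then_redex[OF rtranclp_trans[OF steps_context(8) steps_context(9)]])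

lemma Prev_elim:
  assumes "length us = n" "sub (env_sub us s) t \<Zsurj> Next u"
  shows "Prev us (sub (lift_sub n s) t) \<Zsurj> u"
  using Prev_steps[OF assms(1)] steps_then_redex[OF steps_context(7)[OF assms(2)] redex.intros(8)]
  by (rule rtranclp_trans)

lemma BoxP_elim:
  assumes "length us = n"
  shows "sub (env_sub us s) t \<Zsurj> In1 u \<Longrightarrow> BoxP us (sub (lift_sub n s) t) \<Zsurj> In1 (Box [] u)"
    "sub (env_sub us s) t \<Zsurj> In2 u \<Longrightarrow> BoxP us (sub (lift_sub n s) t) \<Zsurj> In2 (Box [] u)"
  using rtranclp_trans[OF BoxP_steps[OF assms] steps_then_redex[OF steps_context(11) redex.intros(13)]]
    rtranclp_trans[OF BoxP_steps[OF assms] steps_then_redex[OF steps_context(11) redex.intros(14)]] by auto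

section \<open>Normalisation\<close>

text \<open>The logical relation with its semantic component erased: without a set-theoretic universe there
  are no denotations to relate terms to.\<close>

context
  notes conj_cong [fundef_cong]
begin

function (sequential) red :: "ty \<Rightarrow> nat \<Rightarrow> tm \<Rightarrow> bool" where
  "red (TVar k) i t \<longleftrightarrow> False"
| "red TNat i t \<longleftrightarrow> (\<exists>n. t \<Zsurj> (Succ ^^ n) Zero)"
| "red TOne i t \<longleftrightarrow> t \<Zsurj> Unit"
| "red TZero i t \<longleftrightarrow> False"
| "red (TProd A B) i t \<longleftrightarrow> (\<exists>t1 t2. t \<Zsurj> MkPair t1 t2 \<and> red A i t1 \<and> red B i t2)"
| "red (TSum A B) i t \<longleftrightarrow> (\<exists>u. t \<Zsurj> In1 u \<and> red A i u) \<or> (\<exists>u. t \<Zsurj> In2 u \<and> red B i u)"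
| "red (TFun A B) i t \<longleftrightarrow> (\<exists>s. t \<Zsurj> Lam s \<and> (\<forall>j \<in> {1..i}. \<forall>u. red A j u \<longrightarrow> red B j (inst s [u])))"
| "red (TMu A) i t \<longleftrightarrow> wf_ty 0 (TMu A) \<and> (\<exists>u. t \<Zsurj> Fold u \<and> red (tinst A (TMu A)) i u)"
| "red (TLater A) i t \<longleftrightarrow> (\<exists>u. t \<Zsurj> Next u \<and> (i > 1 \<longrightarrow> red A (i - 1) u))"
| "red (TBox A) i t \<longleftrightarrow> (\<exists>u. t \<Zsurj> Box [] u \<and> (\<forall>j \<in> {1..}. red A j u))"
  by pat_completeness auto
text \<open>The measure is the one for \<open>logrel\<close>. Well-formedness in the
  \<open>TMu\<close> clause brings the guardedness by which the unfolding has smaller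
  \<open>usize\<close>.\<close>

termination
  by (relation "inv_image (less_than <*lex*> less_than <*lex*> less_than)
        (\<lambda>(A, i, t). (box_depth A, i, usize A))")
     (auto simp: less_le dest: unfolding_decreases del: wf_tyE)

end

lemma red_steps: "t \<Zsurj> u \<Longrightarrow> red A i u \<Longrightarrow> red A i t"
  by (cases A) (auto intro: rtranclp_trans)

text \<open>The arrow clause quantifies over all j up to i, so lowering i only weakens it; the
  clause for \<open>TBox\<close> does not mention i in its right-hand side.\<close>

lemma red_pred: "red A i t \<Longrightarrow> 1 < i \<Longrightarrow> red A (i - 1) t"
proof (induction A i t rule: red.induct)
  case (5 A B i t) then show ?case by (simp, blast)
next
  case (6 A B i t) then show ?case by (simp, blast)
next
  case (7 A B i t)
  then show ?case by fastforce
next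
  case (8 A i t) then show ?case by (simp, blast)
next
  case (9 A i t)
  then obtain u where "t \<Zsurj> Next u" "red A (i - 1) u" by auto
  with 9 show ?case by (auto intro!: exI[of _ u])
qed auto

lemma red_mono: assumes "red A i t" "1 \<le> j" "j \<le> i" shows "red A j t"
  using assms(3,1)
proof (induction rule: dec_induct)
  case (step n) then show ?case using red_pred[of A "Suc n" t] assms(2) by simp
qed

text \<open>At an arrow, stages above i are reached by moving the argument to stage i, applying the
  function there and moving the result back. The induction follows \<open>usize\<close>, which
  decreases when \<open>TMu\<close> is unfolded.\<close>

lemma red_const:
  "const_ty A \<Longrightarrow> red A i t \<Longrightarrow> 1 \<le> i \<Longrightarrow> 1 \<le> j \<Longrightarrow> red A j t"
proof (induction "usize A" arbitrary: A i j t rule: less_induct)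
  case less
  show ?case
  proof (cases A)
    case (TProd B C)
    then show ?thesis using less.prems less.hyps[of B i _ j] less.hyps[of C i _ j] by (simp, blast)
  next
    case (TSum B C)
    then show ?thesis using less.prems less.hyps[of B i _ j] less.hyps[of C i _ j] by (simp, blast)
  next
    case (TFun B C)
    then obtain s where s: "t \<Zsurj> Lam s" "\<And>j u. j \<in> {1..i} \<Longrightarrow> red B j u \<Longrightarrow> red C j (inst s [u])"
      using less.prems by auto
    have "red C j' (inst s [u])" if "red B j' u" "1 \<le> j'" for j' u
    proof -
      have "red B i u" using less.hyps[of B j' u i] TFun less.prems that by simp
      then have "red C i (inst s [u])" using s(2) less.prems by simp
      then show ?thesis using less.hyps[of C i _ j'] TFun less.prems that by simp
    qed
    then show ?thesis using s(1) TFun by auto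
  next
    case (TMu B)
    then obtain u where u: "t \<Zsurj> Fold u" "wf_ty 0 (TMu B)" "red (tinst B (TMu B)) i u"
      using less.prems by auto
    have "red (tinst B (TMu B)) j u"
      using less.hyps[OF _ _ u(3)] unfolding_decreases(2)[OF u(2)] const_ty_tinst less.prems TMu by simp
    then show ?thesis using TMu u by auto
  qed (use less.prems in auto)
qed

lemma red_env_sub:
  assumes "length As = length \<sigma>" "\<forall>k<length \<sigma>. const_ty (As ! k) \<and> red (As ! k) i (\<sigma> ! k)" "1 \<le> i" "1 \<le> j" "k < length As"
  shows "red (As ! k) j (env_sub \<sigma> s k)"
  using assms by (auto simp: env_sub_def intro: red_const)

lemma red_Cons:
  assumes "red A i u" "\<And>k. k < length \<Gamma> \<Longrightarrow> red (\<Gamma> ! k) i (s k)" "k < length (A # \<Gamma>)"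
  shows "red ((A # \<Gamma>) ! k) i (env_sub [u] s k)"
  using assms by (cases k) (auto simp: env_sub_def)

text \<open>The stage varies in the induction: \<open>Lam\<close> asks for its body at all lower
  stages, \<open>Prev\<close> at the next one, \<open>Box\<close> and \<open>BoxP\<close> at every
  stage.\<close>

lemma red_fundamental:
  "\<Gamma> \<turnstile> t \<Ztypecolon> A \<Longrightarrow> 1 \<le> i \<Longrightarrow> (\<And>k. k < length \<Gamma> \<Longrightarrow> red (\<Gamma> ! k) i (s k)) \<Longrightarrow> red A i (sub s t)"
proof (induction arbitrary: s i rule: typing.induct)
  case (ty_Zero \<Gamma>)
  show ?case by (auto intro: exI[of _ 0])
next
  case (ty_Succ \<Gamma> t)
  then obtain n where "sub s t \<Zsurj> (Succ ^^ n) Zero" by fastforce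
  then have "Succ (sub s t) \<Zsurj> (Succ ^^ Suc n) Zero" using steps_context(1) by simp
  then show ?case by (simp del: funpow.simps) blast
next
  case (ty_Pair \<Gamma> t A u B)
  then have "red A i (sub s t)" "red B i (sub s u)" by blast+
  then show ?case by auto
next
  case (ty_Proj1 \<Gamma> t A B)
  then have "red (TProd A B) i (sub s t)" by blast
  then show ?case using elim_steps(1) red_steps by fastforce
next
  case (ty_Proj2 \<Gamma> t A B)
  then have "red (TProd A B) i (sub s t)" by blast
  then show ?case using elim_steps(2) red_steps by fastforce
next
  case (ty_Abort \<Gamma> t A)
  then have "red TZero i (sub s t)" by blast
  then show ?case by simp
next
  case (ty_In1 \<Gamma> t A B) then show ?case by auto
next
  case (ty_In2 \<Gamma> t B A) then show ?case by auto
next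
  case (ty_Case \<Gamma> t A B u C v)
  have "red (TSum A B) i (sub s t)" using ty_Case by blast
  then consider p where "sub s t \<Zsurj> In1 p" "red A i p" | p where "sub s t \<Zsurj> In2 p" "red B i p" by auto
  then show ?case
  proof cases
    case 1
    have "red C i (sub (env_sub [p] s) u)"
      by (rule ty_Case.IH(2)[OF ty_Case.prems(1) red_Cons[OF 1(2) ty_Case.prems(2)]])
    then show ?thesis using red_steps[OF elim_steps(3)[OF 1(1)]] by simp
  next
    case 2
    have "red C i (sub (env_sub [p] s) v)"
      by (rule ty_Case.IH(3)[OF ty_Case.prems(1) red_Cons[OF 2(2) ty_Case.prems(2)]])
    then show ?thesis using red_steps[OF elim_steps(4)[OF 2(1)]] by simp
  qed
next
  case (ty_Lam A \<Gamma> t B)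
  have "red B j (inst (sub (lift_sub 1 s) t) [u])" if "j \<in> {1..i}" "red A j u" for j u
  proof -
    have "red (\<Gamma> ! k) j (s k)" if "k < length \<Gamma>" for k
      using ty_Lam.prems(2)[OF that] \<open>j \<in> {1..i}\<close> red_mono by simp
    then have "red B j (sub (env_sub [u] s) t)"
      using that by (intro ty_Lam.IH red_Cons) auto
    then show ?thesis by (simp add: inst_lift_sub_1)
  qed
  then show ?case by auto
next
  case (ty_App \<Gamma> t A B u)
  have "red (TFun A B) i (sub s t)" "red A i (sub s u)" using ty_App by blast+
  then obtain p where "sub s t \<Zsurj> Lam p" "red B i (inst p [sub s u])" using ty_App.prems(1) by auto
  then show ?case using red_steps[OF elim_steps(5)] by simp
next
  case (ty_Fold \<Gamma> t A)
  then show ?case by auto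
next
  case (ty_Unfold \<Gamma> t A)
  then have "red (TMu A) i (sub s t)" by blast
  then show ?case using elim_steps(6) red_steps by fastforce
next
  case (ty_Next \<Gamma> t A)
  then have "red A i (sub s t)" by blast
  then show ?case using red_pred by auto
next
  case (ty_Prev As \<sigma> \<Gamma> t A)
  have "\<forall>k<length \<sigma>. const_ty (As ! k) \<and> red (As ! k) i (map (sub s) \<sigma> ! k)"
    using ty_Prev.IH(1) ty_Prev.prems by simp
  \<comment> \<open>Taken at stage i + 1, the clause for \<open>TLater\<close> yields the result at
    i; constancy of the types in As permits the move.\<close>
  then have "red (TLater A) (Suc i) (sub (env_sub (map (sub s) \<sigma>) s) t)"
    using ty_Prev.hyps(1) ty_Prev.prems(1) by (intro ty_Prev.IH(2) red_env_sub[where i = i]) simp_all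
  then show ?case using Prev_elim[of "map (sub s) \<sigma>"] red_steps ty_Prev.prems(1) by fastforce
next
  case (ty_Ast \<Gamma> t A B u)
  have "red (TLater (TFun A B)) i (sub s t)" "red (TLater A) i (sub s u)" using ty_Ast by blast+
  then obtain p q where p: "sub s t \<Zsurj> Next p" "sub s u \<Zsurj> Next q"
    and r: "1 < i \<Longrightarrow> red (TFun A B) (i - 1) p" "1 < i \<Longrightarrow> red A (i - 1) q" by fastforce
  have "red B (i - 1) (App p q)" if i: "1 < i"
  proof -
    obtain p' where "p \<Zsurj> Lam p'" "red B (i - 1) (inst p' [q])" using r[OF i] i by fastforce
    then show ?thesis using red_steps[OF elim_steps(5)] by simp
  qed
  then show ?case using elim_steps(8)[OF p] by auto
next
  case (ty_Box As \<sigma> \<Gamma> t A)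
  have "\<forall>k<length \<sigma>. const_ty (As ! k) \<and> red (As ! k) i (map (sub s) \<sigma> ! k)"
    using ty_Box.IH(1) ty_Box.prems by simp
  then have "red A j (sub (env_sub (map (sub s) \<sigma>) s) t)" if "1 \<le> j" for j
    using ty_Box.hyps(1) ty_Box.prems(1) that by (intro ty_Box.IH(2) red_env_sub[where i = i]) simp_all
  then show ?case using Box_steps[of "map (sub s) \<sigma>" "length \<sigma>" s t] by auto
next
  case (ty_Unbox \<Gamma> t A)
  then have "red (TBox A) i (sub s t)" by blast
  then show ?case using elim_steps(7) red_steps ty_Unbox.prems(1) by fastforce
next
  case (ty_BoxP As \<sigma> \<Gamma> t A B)
  let ?t = "sub (env_sub (map (sub s) \<sigma>) s) t"
  have "\<forall>k<length \<sigma>. const_ty (As ! k) \<and> red (As ! k) i (map (sub s) \<sigma> ! k)"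
    using ty_BoxP.IH(1) ty_BoxP.prems by simp
  then have *: "red (TSum A B) j ?t" if "1 \<le> j" for j
    using ty_BoxP.hyps(1) ty_BoxP.prems(1) that by (intro ty_BoxP.IH(2) red_env_sub[where i = i]) simp_all
  note elim = BoxP_elim[of "map (sub s) \<sigma>" "length \<sigma>" s t]
  \<comment> \<open>The injection and its argument u are fixed at stage 1. The reducing term is the
    same at every stage, so uniqueness of the injection gives u at all of them.\<close>
  from *[of 1] consider u where "?t \<Zsurj> In1 u" | u where "?t \<Zsurj> In2 u" by auto
  then show ?case
  proof cases
    case 1
    have "red A j u" if "1 \<le> j" for j
      using *[OF that] steps_In_unique(1,3)[OF 1] by (metis red.simps(6))
    then have "red (TBox A) i (Box [] u)" by auto
    then show ?thesis using elim(1)[OF _ 1] by (simp del: red.simps(10)) blast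
  next
    case 2
    have "red B j u" if "1 \<le> j" for j
      using *[OF that] steps_In_unique(2)[OF 2] steps_In_unique(3)[where t = ?t and v = u] 2 by (metis red.simps(6))
    then have "red (TBox B) i (Box [] u)" by auto
    then show ?thesis using elim(2)[OF _ 2] by (simp del: red.simps(10)) blast
  qed
qed auto

lemma red_imp_val: "red A i t \<Longrightarrow> \<exists>v. val v \<and> t \<Zsurj> v"
  by (cases A) (auto intro: val.intros)

lemma normalisation: "[] \<turnstile> t \<Ztypecolon> A \<Longrightarrow> \<exists>v. val v \<and> t \<Zsurj> v"
  using red_fundamental[of "[]" t A 1 Var] red_imp_val by (auto simp: sub_Var)

section \<open>Constant objects\<close>

lemma down_in: "is_obj X \<Longrightarrow> 1 \<le> i \<Longrightarrow> x \<in> elts_at X (i + k) \<Longrightarrow> down X i k x \<in> elts_at X i"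
  by (induction k arbitrary: x) (auto simp: is_obj_def)

lemma down_Suc_restr: "down X i (Suc k) x = restr X i (down X (Suc i) k x)"
proof (induction k arbitrary: x)
  case (Suc k) show ?case using Suc[of "restr X (i + Suc k) x"] by simp
qed simp

lemma restrict_to_refl [simp]: "restrict_to X i i x = x"
  by (simp add: restrict_to_def)

lemma restrict_to_Suc: "j \<le> i \<Longrightarrow> restrict_to X (Suc i) j x = restrict_to X i j (restr X i x)"
  by (simp add: restrict_to_def Suc_diff_le)

lemma restr_restrict_to: "j < i \<Longrightarrow> restr X j (restrict_to X i (Suc j) x) = restrict_to X i j x"
  unfolding restrict_to_def using down_Suc_restr[of X j "i - Suc j" x] by (simp add: Suc_diff_Suc)

lemma restrict_to_in: "is_obj X \<Longrightarrow> 1 \<le> j \<Longrightarrow> j \<le> i \<Longrightarrow> x \<in> elts_at X i \<Longrightarrow> restrict_to X i j x \<in> elts_at X j"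
  unfolding restrict_to_def by (intro down_in) auto

lemma glob_restrict_to: "glob X y \<Longrightarrow> 1 \<le> j \<Longrightarrow> j \<le> i \<Longrightarrow> restrict_to X i j (y i) = y j"
proof (induction i)
  case (Suc i)
  then show ?case
    by (cases "j = Suc i") (auto simp: restrict_to_Suc glob_def)
qed simp

text \<open>Equivalent to the bijectivity of all restriction maps: every element lies on exactly one global
  element.\<close>

definition const_obj :: "'v::elts obj \<Rightarrow> bool" where
  "const_obj X \<longleftrightarrow> is_obj X \<and> (\<forall>i\<ge>1. \<forall>x \<in> elts_at X i. \<exists>y. glob X y \<and> y i = x) \<and>
     (\<forall>y z i. glob X y \<longrightarrow> glob X z \<longrightarrow> 1 \<le> i \<longrightarrow> y i = z i \<longrightarrow> (\<forall>j\<ge>1. y j = z j))"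

lemma const_obj_glob: "const_obj X \<Longrightarrow> 1 \<le> i \<Longrightarrow> x \<in> elts_at X i \<Longrightarrow> \<exists>y. glob X y \<and> y i = x"
  by (simp add: const_obj_def)

lemma const_obj_unique: "const_obj X \<Longrightarrow> glob X y \<Longrightarrow> glob X z \<Longrightarrow> 1 \<le> i \<Longrightarrow> y i = z i \<Longrightarrow> 1 \<le> j \<Longrightarrow> y j = z j"
  unfolding const_obj_def by blast

lemma globD: "glob X y \<Longrightarrow> 1 \<le> j \<Longrightarrow> y j \<in> elts_at X j"
  "glob X y \<Longrightarrow> 1 \<le> j \<Longrightarrow> restr X j (y (Suc j)) = y j"
  by (auto simp: glob_def)

text \<open>Transport follows the global element through a point. The laws below are obtained from
  this instead of from the definite description.\<close>

lemma transport_glob: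
  assumes "const_obj X" "glob X y" "1 \<le> i" "1 \<le> j"
  shows "transport X i j (y i) = y j"
proof (cases "j \<le> i")
  case True
  then show ?thesis using assms glob_restrict_to by (simp add: transport_def)
next
  case False
  have "(THE z. z \<in> elts_at X j \<and> restrict_to X j i z = y i) = y j"
  proof (rule the_equality)
    show "y j \<in> elts_at X j \<and> restrict_to X j i (y j) = y i"
      using assms globD(1)[OF assms(2,4)] glob_restrict_to[of X y i j] False by auto
    fix z assume z: "z \<in> elts_at X j \<and> restrict_to X j i z = y i"
    then obtain w where w: "glob X w" "w j = z" using const_obj_glob[OF assms(1,4)] by blast
    then have "w i = y i" using z glob_restrict_to[of X w i j] False assms by auto
    then show "z = y j" using const_obj_unique[OF assms(1) w(1) assms(2,3) _ assms(4)] w by simp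
  qed
  then show ?thesis using False by (simp add: transport_def)
qed

lemma transport_in:
  "const_obj X \<Longrightarrow> 1 \<le> i \<Longrightarrow> 1 \<le> j \<Longrightarrow> x \<in> elts_at X i \<Longrightarrow> transport X i j x \<in> elts_at X j"
  by (metis transport_glob const_obj_glob globD(1))

lemma restr_transport:
  "const_obj X \<Longrightarrow> 1 \<le> i \<Longrightarrow> 1 \<le> j \<Longrightarrow> x \<in> elts_at X i \<Longrightarrow> restr X j (transport X i (Suc j) x) = transport X i j x"
  using transport_glob[of X _ i "Suc j"] transport_glob[of X _ i j] const_obj_glob[of X i x] globD(2)[of X _ j]
  by (metis le_SucI)

lemma transport_restr:
  "const_obj X \<Longrightarrow> 1 \<le> i \<Longrightarrow> 1 \<le> j \<Longrightarrow> x \<in> elts_at X (Suc i) \<Longrightarrow> transport X i j (restr X i x) = transport X (Suc i) j x"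
  using transport_glob[of X _ "Suc i" j] transport_glob[of X _ i j] const_obj_glob[of X "Suc i" x] globD(2)[of X _ i]
  by (metis le_SucI)

lemma glob_mor: "is_mor X Y f \<Longrightarrow> glob X y \<Longrightarrow> glob Y (\<lambda>j. f j (y j))"
  by (auto simp: is_mor_def glob_def) (metis le_SucI)

lemma const_obj_iso:
  assumes "is_obj X" "is_iso X Y h" "const_obj Y"
  shows "const_obj X"
proof -
  obtain g where h: "is_mor X Y h" and g: "is_mor Y X g"
    and gh: "\<And>i x. 1 \<le> i \<Longrightarrow> x \<in> elts_at X i \<Longrightarrow> g i (h i x) = x"
    and hg: "\<And>i x. 1 \<le> i \<Longrightarrow> x \<in> elts_at Y i \<Longrightarrow> h i (g i x) = x"
    using assms(2) unfolding is_iso_def by blast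
  show ?thesis
    unfolding const_obj_def
  proof (intro conjI allI impI ballI assms(1))
    fix i x assume i: "(1::nat) \<le> i" and x: "x \<in> elts_at X i"
    then have "h i x \<in> elts_at Y i" using h by (auto simp: is_mor_def)
    then obtain y where "glob Y y" "y i = h i x" using const_obj_glob[OF assms(3) i] by blast
    then show "\<exists>z. glob X z \<and> z i = x" using glob_mor[OF g, of y] gh[OF i x] by auto
  next
    fix y z :: "nat \<Rightarrow> 'a" and i j :: nat
    assume *: "glob X y" "glob X z" "1 \<le> i" "y i = z i" "1 \<le> j"
    have "h j (y j) = h j (z j)"
      using const_obj_unique[OF assms(3) glob_mor[OF h *(1)] glob_mor[OF h *(2)] *(3) _ *(5)] *(4) by simp
    then show "y j = z j" using gh[OF *(5)] globD(1) * by metis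
  qed
qed

section \<open>Constancy of the denotations of constant types\<close>

context zf_model
begin

lemma glob_delta: "glob (delta (Z :: 'v)) y \<longleftrightarrow> (\<forall>j\<ge>1. y j \<in> elts Z \<and> y (Suc j) = y j)"
  by (simp add: glob_def elts_delta)

lemma glob_delta_const:
  assumes "glob (delta (Z :: 'v)) y" "1 \<le> i"
  shows "y i = y 1"
  using assms(2) by (induction rule: nat_induct_at_least) (use assms(1) in \<open>auto simp: glob_delta\<close>)

lemma const_obj_delta: "const_obj (delta (Z :: 'v))"
  unfolding const_obj_def
proof (intro conjI allI impI ballI is_obj_delta)
  fix i x assume "x \<in> elts_at (delta Z) i"
  then show "\<exists>y. glob (delta Z) y \<and> y i = x"
    by (intro exI[of _ "\<lambda>_. x"]) (auto simp: glob_delta elts_delta)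
next
  fix y z :: "nat \<Rightarrow> 'v" and i j :: nat
  assume "glob (delta Z) y" "glob (delta Z) z" "1 \<le> i" "y i = z i" "1 \<le> j"
  then show "y j = z j" using glob_delta_const by metis
qed

lemma const_obj_box: "const_obj (box_obj (X :: 'v obj))"
  by (simp add: box_obj_def const_obj_delta)

lemma glob_prod:
  fixes X :: "'v obj"
  assumes "glob (prod_obj X Y) p"
  shows "\<exists>x y. glob X x \<and> glob Y y \<and> (\<forall>j\<ge>1. p j = vpair (x j) (y j))"
proof -
  have e: "p j = vpair (vfst (p j)) (vsnd (p j)) \<and> vfst (p j) \<in> elts_at X j \<and> vsnd (p j) \<in> elts_at Y j" if "1 \<le> j" for j
    using globD(1)[OF assms that] by (auto simp: elts_prod)
  have "vpair (restr X j (vfst (p (Suc j)))) (restr Y j (vsnd (p (Suc j)))) = p j" if "1 \<le> j" for j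
    using globD(2)[OF assms that] restr_prod[of X Y j "vfst (p (Suc j))" "vsnd (p (Suc j))"] e[of "Suc j"] by simp
  then have "restr X j (vfst (p (Suc j))) = vfst (p j) \<and> restr Y j (vsnd (p (Suc j))) = vsnd (p j)" if "1 \<le> j" for j
    using that by (metis vfst_vpair vsnd_vpair)
  then show ?thesis using e
    by (intro exI[of _ "\<lambda>j. vfst (p j)"] exI[of _ "\<lambda>j. vsnd (p j)"]) (auto simp: glob_def)
qed

text \<open>Restriction preserves the injection, so the tag found at stage 1 persists at all stages.
  The denotation of \<open>BoxP\<close> depends on this.\<close>

lemma glob_sum:
  fixes X :: "'v obj"
  assumes "glob (sum_obj X Y) p"
  shows "(\<exists>x. glob X x \<and> (\<forall>j\<ge>1. p j = vin 1 (x j))) \<or> (\<exists>y. glob Y y \<and> (\<forall>j\<ge>1. p j = vin 2 (y j)))"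
proof -
  have e: "(\<exists>x\<in>elts_at X j. p j = vin 1 x) \<or> (\<exists>y\<in>elts_at Y j. p j = vin 2 y)" if "1 \<le> j" for j
    using globD(1)[OF assms that] by (auto simp: elts_sum)
  have r: "restr (sum_obj X Y) j (p (Suc j)) = p j" if "1 \<le> j" for j
    using globD(2)[OF assms that] .
  consider (1) x where "p 1 = vin 1 x" | (2) y where "p 1 = vin 2 y" using e[of 1] by auto
  then show ?thesis
  proof cases
    case 1
    have "\<exists>x\<in>elts_at X j. p j = vin 1 x" if "1 \<le> j" for j
      using that
    proof (induction rule: nat_induct_at_least)
      case base then show ?case using e[of 1] 1 by auto
    next
      case (Suc j) then show ?case using r[OF Suc.hyps] e[of "Suc j"] by (auto simp: restr_sum)
    qed
    then obtain x where x: "\<And>j. 1 \<le> j \<Longrightarrow> x j \<in> elts_at X j \<and> p j = vin 1 (x j)" by metis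
    have "restr X j (x (Suc j)) = x j" if "1 \<le> j" for j
      using r[OF that] x[OF that] x[of "Suc j"] by (simp add: restr_sum)
    then have "glob X x" using x by (simp add: glob_def)
    then show ?thesis using x by blast
  next
    case 2
    have "\<exists>x\<in>elts_at Y j. p j = vin 2 x" if "1 \<le> j" for j
      using that
    proof (induction rule: nat_induct_at_least)
      case base then show ?case using e[of 1] 2 by auto
    next
      case (Suc j) then show ?case using r[OF Suc.hyps] e[of "Suc j"] by (auto simp: restr_sum)
    qed
    then obtain x where x: "\<And>j. 1 \<le> j \<Longrightarrow> x j \<in> elts_at Y j \<and> p j = vin 2 (x j)" by metis
    have "restr Y j (x (Suc j)) = x j" if "1 \<le> j" for j
      using r[OF that] x[OF that] x[of "Suc j"] by (simp add: restr_sum)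
    then have "glob Y x" using x by (simp add: glob_def)
    then show ?thesis using x by blast
  qed
qed

text \<open>Restricting an element of an exponential only drops components, so along a global
  element the j-th component stays fixed from stage j on.\<close>

lemma glob_exp_vproj:
  fixes X :: "'v obj"
  assumes "glob (exp_obj X Y) F" "1 \<le> j" "j \<le> i"
  shows "vproj (F i) j = vproj (F j) j"
  using assms(3)
proof (induction rule: dec_induct)
  case (step n)
  then show ?case using globD(2)[OF assms(1), of n] ev_restr[of j n X Y "F (Suc n)"] assms(2) by simp
qed simp

lemma ev_in:
  fixes X :: "'v obj"
  shows "F \<in> elts_at (exp_obj X Y) i \<Longrightarrow> is_obj X \<Longrightarrow> 1 \<le> j \<Longrightarrow> j \<le> i \<Longrightarrow> x \<in> elts_at X j \<Longrightarrow> ev F j x \<in> elts_at Y j"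
  using exp_ev by (auto simp: exp_mor_def)

lemma ev_restr_arg:
  fixes X :: "'v obj"
  shows "F \<in> elts_at (exp_obj X Y) i \<Longrightarrow> is_obj X \<Longrightarrow> 1 \<le> j \<Longrightarrow> j < i \<Longrightarrow> x \<in> elts_at X (Suc j) \<Longrightarrow>
    ev F j (restr X j x) = restr Y j (ev F (Suc j) x)"
  using exp_ev by (auto simp: exp_mor_def)

lemma glob_exp_ev:
  fixes X :: "'v obj"
  assumes F: "glob (exp_obj X Y) F" and X: "is_obj X" and z: "glob X z"
  shows "glob Y (\<lambda>j. ev (F j) j (z j))"
  unfolding glob_def
proof (intro allI impI conjI)
  fix j :: nat assume j: "1 \<le> j"
  show "ev (F j) j (z j) \<in> elts_at Y j"
    using ev_in[OF globD(1)[OF F j] X j _ globD(1)[OF z j]] by simp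
  have "restr Y j (ev (F (Suc j)) (Suc j) (z (Suc j))) = ev (F (Suc j)) j (restr X j (z (Suc j)))"
    using ev_restr_arg[OF globD(1)[OF F, of "Suc j"] X j _ globD(1)[OF z, of "Suc j"]] j by simp
  also have "\<dots> = ev (F j) j (z j)"
    using glob_exp_vproj[OF F j, of "Suc j"] globD(2)[OF z j] by simp
  finally show "restr Y j (ev (F (Suc j)) (Suc j) (z (Suc j))) = ev (F j) j (z j)" .
qed

lemma const_obj_prod:
  fixes X :: "'v obj"
  assumes "const_obj X" "const_obj Y" shows "const_obj (prod_obj X Y)"
  unfolding const_obj_def
proof (intro conjI allI impI ballI)
  show "is_obj (prod_obj X Y)" using assms by (auto simp: const_obj_def intro: is_obj_prod)
next
  fix i p assume i: "(1::nat) \<le> i" and "p \<in> elts_at (prod_obj X Y) i"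
  then obtain x y where p: "p = vpair x y" "x \<in> elts_at X i" "y \<in> elts_at Y i" by (auto simp: elts_prod)
  then obtain x' y' where "glob X x'" "x' i = x" "glob Y y'" "y' i = y"
    using const_obj_glob[OF assms(1) i] const_obj_glob[OF assms(2) i] by metis
  then show "\<exists>q. glob (prod_obj X Y) q \<and> q i = p" using p
    by (intro exI[of _ "\<lambda>j. vpair (x' j) (y' j)"]) (auto simp: glob_def elts_prod restr_prod)
next
  fix p q :: "nat \<Rightarrow> 'v" and i j :: nat
  assume *: "glob (prod_obj X Y) p" "glob (prod_obj X Y) q" "1 \<le> i" "p i = q i" "1 \<le> j"
  obtain x y where p: "glob X x" "glob Y y" "\<And>j. 1 \<le> j \<Longrightarrow> p j = vpair (x j) (y j)" using glob_prod[OF *(1)] by blast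
  obtain x' y' where q: "glob X x'" "glob Y y'" "\<And>j. 1 \<le> j \<Longrightarrow> q j = vpair (x' j) (y' j)" using glob_prod[OF *(2)] by blast
  have "x i = x' i" "y i = y' i" using p(3)[OF *(3)] q(3)[OF *(3)] *(4) by auto
  then show "p j = q j"
    using p(3)[OF *(5)] q(3)[OF *(5)] const_obj_unique[OF assms(1) p(1) q(1) *(3) _ *(5)]
      const_obj_unique[OF assms(2) p(2) q(2) *(3) _ *(5)] by simp
qed

lemma const_obj_sum:
  fixes X :: "'v obj"
  assumes "const_obj X" "const_obj Y" shows "const_obj (sum_obj X Y)"
  unfolding const_obj_def
proof (intro conjI allI impI ballI)
  show "is_obj (sum_obj X Y)" using assms by (auto simp: const_obj_def intro: is_obj_sum)
next
  fix i p assume i: "(1::nat) \<le> i" and "p \<in> elts_at (sum_obj X Y) i"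
  then consider x where "p = vin 1 x" "x \<in> elts_at X i" | x where "p = vin 2 x" "x \<in> elts_at Y i" by (auto simp: elts_sum)
  then show "\<exists>q. glob (sum_obj X Y) q \<and> q i = p"
  proof cases
    case 1
    then obtain y where "glob X y" "y i = x" using const_obj_glob[OF assms(1) i] by blast
    then show ?thesis using 1 by (intro exI[of _ "\<lambda>j. vin 1 (y j)"]) (auto simp: glob_def elts_sum restr_sum)
  next
    case 2
    then obtain y where "glob Y y" "y i = x" using const_obj_glob[OF assms(2) i] by blast
    then show ?thesis using 2 by (intro exI[of _ "\<lambda>j. vin 2 (y j)"]) (auto simp: glob_def elts_sum restr_sum)
  qed
next
  fix p q :: "nat \<Rightarrow> 'v" and i j :: nat
  assume *: "glob (sum_obj X Y) p" "glob (sum_obj X Y) q" "1 \<le> i" "p i = q i" "1 \<le> j"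
  show "p j = q j"
    using glob_sum[OF *(1)] glob_sum[OF *(2)]
  proof (elim disjE exE conjE)
    fix x y assume "glob X x" "\<forall>j\<ge>1. p j = vin 1 (x j)" "glob X y" "\<forall>j\<ge>1. q j = vin 1 (y j)"
    then show ?thesis using * const_obj_unique[OF assms(1), of x y i j] by simp
  next
    fix x y assume "glob Y x" "\<forall>j\<ge>1. p j = vin 2 (x j)" "glob Y y" "\<forall>j\<ge>1. q j = vin 2 (y j)"
    then show ?thesis using * const_obj_unique[OF assms(2), of x y i j] by simp
  qed (use * in auto)
qed

text \<open>Between constant objects a morphism is determined by any one component. To extend F from
  stage i, an argument is transported to i, F is applied there, and the result is transported
  back.\<close>

lemma const_obj_exp:
  fixes X :: "'v obj"
  assumes X: "const_obj X" and Y: "const_obj Y" shows "const_obj (exp_obj X Y)"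
proof -
  have oX: "is_obj X" using X by (simp add: const_obj_def)
  have 1: "\<exists>G. glob (exp_obj X Y) G \<and> G i = F" if i: "1 \<le> i" and F: "F \<in> elts_at (exp_obj X Y) i" for i F
  proof -
    define g where "g j x = transport Y i j (ev F i (transport X j i x))" for j x
    have ev: "ev F i (transport X j i x) \<in> elts_at Y i" if "1 \<le> j" "x \<in> elts_at X j" for j x
      using ev_in[OF F oX i order.refl transport_in[OF X that(1) i that(2)]] .
    have mor: "exp_mor X Y k g" for k
      unfolding exp_mor_def
    proof (intro conjI ballI)
      fix j x assume "j \<in> {1..k}" "x \<in> elts_at X j"
      then show "g j x \<in> elts_at Y j" unfolding g_def using ev transport_in[OF Y i] by simp
    next
      fix j x assume j: "j \<in> {1..<k}" and x: "x \<in> elts_at X (Suc j)"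
      then show "g j (restr X j x) = restr Y j (g (Suc j) x)"
        unfolding g_def using transport_restr[OF X _ i x] restr_transport[OF Y i _ ev[OF _ x]] by simp
    qed
    then have "tup X k g \<in> elts_at (exp_obj X Y) k" for k by (rule tup_in_exp)
    moreover have "restr (exp_obj X Y) k (tup X (Suc k) g) = tup X k g" for k
      using restr_exp[OF tup_in_exp[OF mor[of "Suc k"]]] tup_cong[of k X "ev (tup X (Suc k) g)" g] by simp
    moreover have "tup X i g = F"
    proof (rule exp_ext[OF _ F])
      show "tup X i g \<in> elts_at (exp_obj X Y) i" by (rule tup_in_exp[OF mor])
      fix j x assume j: "1 \<le> j" "j \<le> i" and x: "x \<in> elts_at X j"
      obtain z where z: "glob X z" "z j = x" using const_obj_glob[OF X j(1) x] by blast
      \<comment> \<open>F commutes with restrictions below i, so the extension agrees with F at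
        those stages as well and not only at i.\<close>
      have r: "restrict_to Y i k (ev F i (z i)) = ev F k (z k)" if "1 \<le> k" "k \<le> i" for k
        using that(2,1)
      proof (induction rule: inc_induct)
        case (step n)
        have "restrict_to Y i n (ev F i (z i)) = restr Y n (ev F (Suc n) (z (Suc n)))"
          using restr_restrict_to[of n i Y "ev F i (z i)"] step by simp
        also have "\<dots> = ev F n (z n)"
          using ev_restr_arg[OF F oX step.prems step.hyps(2) globD(1)[OF z(1)]] globD(2)[OF z(1) step.prems] by simp
        finally show ?case .
      qed simp
      have "g j x = ev F j x"
        unfolding g_def z(2)[symmetric] transport_glob[OF X z(1) j(1) i]
        using r[OF j] j by (simp add: transport_def)
      then show "ev (tup X i g) j x = ev F j x" using j x by (simp add: ev_tup)
    qed
    ultimately show ?thesis by (intro exI[of _ "\<lambda>k. tup X k g"]) (simp add: glob_def)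
  qed
  have 2: "F j = G j" if "glob (exp_obj X Y) F" "glob (exp_obj X Y) G" "1 \<le> i" "F i = G i" "1 \<le> j" for F G i j
  proof (rule exp_ext[OF globD(1)[OF that(1,5)] globD(1)[OF that(2,5)]])
    fix k x assume k: "1 \<le> k" "k \<le> j" and "x \<in> elts_at X k"
    then obtain z where z: "glob X z" "z k = x" using const_obj_glob[OF X] by blast
    have "ev (F k) k (z k) = ev (G k) k (z k)"
      using const_obj_unique[OF Y glob_exp_ev[OF that(1) oX z(1)] glob_exp_ev[OF that(2) oX z(1)] that(3) _ k(1)] that(4) by simp
    then show "ev (F j) k x = ev (G j) k x"
      using glob_exp_vproj[OF that(1) k] glob_exp_vproj[OF that(2) k] z(2) by simp
  qed
  show ?thesis unfolding const_obj_def using 1 2 is_obj_exp[OF oX] by blast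
qed

text \<open>Constant recursive types are degenerate: the bound variable would have to lie beneath a
  \<open>TLater\<close>, hence beneath a \<open>TBox\<close>, whose body is closed. Their unfoldings
  have smaller \<open>usize\<close>, and constancy comes back along
  \<open>unfold_iso\<close>.\<close>

lemma const_obj_cden: "wf_ty 0 A \<Longrightarrow> const_ty A \<Longrightarrow> const_obj (cden A :: 'v obj)"
proof (induction "usize A" arbitrary: A rule: less_induct)
  case less
  show ?case
  proof (cases A)
    case (TMu B)
    have wf: "wf_ty 0 (TMu B)" using less.prems TMu by simp
    have "const_obj (cden (tinst B (TMu B)) :: 'v obj)"
      using less.hyps[OF _ wf_ty_tinst[OF wf] const_ty_tinst] unfolding_decreases(2)[OF wf] less.prems TMu by simp
    then show ?thesis
      using const_obj_iso[OF is_obj_cden[OF wf] unfold_iso[OF wf]] TMu by simp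
  qed (use less in \<open>auto intro!: const_obj_delta const_obj_box const_obj_prod const_obj_sum const_obj_exp\<close>)
qed

end

section \<open>Soundness of the denotation\<close>

definition in_env :: "ty list \<Rightarrow> nat \<Rightarrow> 'v::elts list \<Rightarrow> bool" where
  "in_env \<Gamma> i \<gamma> \<longleftrightarrow> length \<gamma> = length \<Gamma> \<and> (\<forall>k<length \<Gamma>. \<gamma> ! k \<in> elts_at (cden (\<Gamma> ! k)) i)"

text \<open>That f is a morphism in the topos from the product denoted by the context to
  \<open>cden A\<close>.\<close>

definition sem :: "ty list \<Rightarrow> ty \<Rightarrow> (nat \<Rightarrow> 'v::elts list \<Rightarrow> 'v) \<Rightarrow> bool" where
  "sem \<Gamma> A f \<longleftrightarrow> (\<forall>i\<ge>1. (\<forall>\<gamma>. in_env \<Gamma> i \<gamma> \<longrightarrow> f i \<gamma> \<in> elts_at (cden A) i) \<and>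
     (\<forall>\<gamma>. in_env \<Gamma> (Suc i) \<gamma> \<longrightarrow> f i (restrict_env \<Gamma> (Suc i) i \<gamma>) = restr (cden A) i (f (Suc i) \<gamma>)))"

lemma semI:
  assumes "\<And>i \<gamma>. 1 \<le> i \<Longrightarrow> in_env \<Gamma> i \<gamma> \<Longrightarrow> f i \<gamma> \<in> elts_at (cden A) i"
    "\<And>i \<gamma>. 1 \<le> i \<Longrightarrow> in_env \<Gamma> (Suc i) \<gamma> \<Longrightarrow> f i (restrict_env \<Gamma> (Suc i) i \<gamma>) = restr (cden A) i (f (Suc i) \<gamma>)"
  shows "sem \<Gamma> A f"
  using assms by (simp add: sem_def)

lemma semD:
  assumes "sem \<Gamma> A f" "1 \<le> i"
  shows "in_env \<Gamma> i \<gamma> \<Longrightarrow> f i \<gamma> \<in> elts_at (cden A) i"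
    "in_env \<Gamma> (Suc i) \<gamma> \<Longrightarrow> f i (restrict_env \<Gamma> (Suc i) i \<gamma>) = restr (cden A) i (f (Suc i) \<gamma>)"
  using assms by (simp_all add: sem_def)

lemma length_restrict_env [simp]: "length \<gamma> = length \<Gamma> \<Longrightarrow> length (restrict_env \<Gamma> i j \<gamma>) = length \<Gamma>"
  by (simp add: restrict_env_def)

lemma nth_restrict_env [simp]: "length \<gamma> = length \<Gamma> \<Longrightarrow> k < length \<Gamma> \<Longrightarrow>
    restrict_env \<Gamma> i j \<gamma> ! k = restrict_to (cden (\<Gamma> ! k)) i j (\<gamma> ! k)"
  by (simp add: restrict_env_def)

lemma length_transport_env [simp]: "length \<gamma> = length \<Gamma> \<Longrightarrow> length (transport_env \<Gamma> i j \<gamma>) = length \<Gamma>"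
  by (simp add: transport_env_def)

lemma nth_transport_env [simp]: "length \<gamma> = length \<Gamma> \<Longrightarrow> k < length \<Gamma> \<Longrightarrow>
    transport_env \<Gamma> i j \<gamma> ! k = transport (cden (\<Gamma> ! k)) i j (\<gamma> ! k)"
  by (simp add: transport_env_def)

lemma restrict_to_1: "restrict_to X (Suc i) i x = restr X i x"
  by (simp add: restrict_to_Suc)

lemma restrict_env_Cons: "restrict_env (A # \<Gamma>) i j (a # \<gamma>) = restrict_to (cden A) i j a # restrict_env \<Gamma> i j \<gamma>"
  by (simp add: restrict_env_def)

lemma in_env_Cons: "in_env (A # \<Gamma>) i (a # \<gamma>) \<longleftrightarrow> a \<in> elts_at (cden A) i \<and> in_env \<Gamma> i \<gamma>"
  by (auto simp: in_env_def less_Suc_eq_0_disj)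

lemma restrict_env_Suc_left: "in_env \<Gamma> (Suc i) \<gamma> \<Longrightarrow> j \<le> i \<Longrightarrow>
    restrict_env \<Gamma> i j (restrict_env \<Gamma> (Suc i) i \<gamma>) = restrict_env \<Gamma> (Suc i) j \<gamma>"
  by (auto simp: in_env_def restrict_to_Suc intro!: nth_equalityI)

lemma restrict_env_Suc_right: "in_env \<Gamma> i \<gamma> \<Longrightarrow> j < i \<Longrightarrow>
    restrict_env \<Gamma> (Suc j) j (restrict_env \<Gamma> i (Suc j) \<gamma>) = restrict_env \<Gamma> i j \<gamma>"
  by (auto simp: in_env_def restrict_to_1 restr_restrict_to intro!: nth_equalityI)

lemma denotes_typing: "denotes \<Gamma> t A f \<Longrightarrow> \<Gamma> \<turnstile> t \<Ztypecolon> A"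
  by (induction rule: denotes.induct) (auto intro: typing.intros)

lemma typing_denotes: "\<Gamma> \<turnstile> t \<Ztypecolon> A \<Longrightarrow> \<exists>f :: nat \<Rightarrow> 'v::elts list \<Rightarrow> 'v. denotes \<Gamma> t A f"
proof (induction rule: typing.induct)
  case (ty_Prev As \<sigma> \<Gamma> t A)
  then obtain f where f: "denotes As t (TLater A) (f :: nat \<Rightarrow> 'v list \<Rightarrow> 'v)" by blast
  have "\<forall>k. \<exists>g. k < length \<sigma> \<longrightarrow> denotes \<Gamma> (\<sigma> ! k) (As ! k) (g :: nat \<Rightarrow> 'v list \<Rightarrow> 'v)"
    using ty_Prev by blast
  then obtain g where "\<And>k. k < length \<sigma> \<Longrightarrow> denotes \<Gamma> (\<sigma> ! k) (As ! k) (g k :: nat \<Rightarrow> 'v list \<Rightarrow> 'v)" by metis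
  then show ?case
    using ty_Prev den_Prev[of As \<sigma> "map g [0..<length \<sigma>]" \<Gamma> t A f] f by auto
next
  case (ty_Box As \<sigma> \<Gamma> t A)
  then obtain f where f: "denotes As t A (f :: nat \<Rightarrow> 'v list \<Rightarrow> 'v)" by blast
  have "\<forall>k. \<exists>g. k < length \<sigma> \<longrightarrow> denotes \<Gamma> (\<sigma> ! k) (As ! k) (g :: nat \<Rightarrow> 'v list \<Rightarrow> 'v)"
    using ty_Box by blast
  then obtain g where "\<And>k. k < length \<sigma> \<Longrightarrow> denotes \<Gamma> (\<sigma> ! k) (As ! k) (g k :: nat \<Rightarrow> 'v list \<Rightarrow> 'v)" by metis
  then show ?case
    using ty_Box den_Box[of As \<sigma> "map g [0..<length \<sigma>]" \<Gamma> t A f] f by auto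
next
  case (ty_BoxP As \<sigma> \<Gamma> t A B)
  then obtain f where f: "denotes As t (TSum A B) (f :: nat \<Rightarrow> 'v list \<Rightarrow> 'v)" by blast
  have "\<forall>k. \<exists>g. k < length \<sigma> \<longrightarrow> denotes \<Gamma> (\<sigma> ! k) (As ! k) (g :: nat \<Rightarrow> 'v list \<Rightarrow> 'v)"
    using ty_BoxP by blast
  then obtain g where "\<And>k. k < length \<sigma> \<Longrightarrow> denotes \<Gamma> (\<sigma> ! k) (As ! k) (g k :: nat \<Rightarrow> 'v list \<Rightarrow> 'v)" by metis
  then show ?case
    using ty_BoxP den_BoxP[of As \<sigma> "map g [0..<length \<sigma>]" \<Gamma> t A B f] f by auto
qed (blast intro: denotes.intros)+

context zf_model
begin

lemma elts_TNat: "elts_at (cden TNat) i = range (vnat :: nat \<Rightarrow> 'v)"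
  by (simp add: elts_delta elts_mkset small_range)

lemma elts_TOne: "elts_at (cden TOne) i = {vunit :: 'v}"
  by (simp add: elts_delta elts_mkset small_singleton)

lemma elts_TZero: "elts_at (cden TZero :: 'v obj) i = {}"
  by (simp add: elts_delta elts_mkset small_empty)

lemma unfold_iso_in: "wf_ty 0 (TMu A) \<Longrightarrow> 1 \<le> i \<Longrightarrow> (x :: 'v) \<in> elts_at (cden (TMu A)) i \<Longrightarrow>
    unfold_iso A i x \<in> elts_at (cden (tinst A (TMu A))) i"
  using unfold_iso[of A] unfolding is_iso_def is_mor_def by blast

lemma unfold_iso_restr: "wf_ty 0 (TMu A) \<Longrightarrow> 1 \<le> i \<Longrightarrow> (x :: 'v) \<in> elts_at (cden (TMu A)) (Suc i) \<Longrightarrow>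
    unfold_iso A i (restr (cden (TMu A)) i x) = restr (cden (tinst A (TMu A))) i (unfold_iso A (Suc i) x)"
  using unfold_iso[of A] unfolding is_iso_def is_mor_def by blast

lemma unfold_iso_inj: "wf_ty 0 (TMu A) \<Longrightarrow> 1 \<le> i \<Longrightarrow> inj_on (unfold_iso A i) (elts_at (cden (TMu A) :: 'v obj) i)"
  using unfold_iso[of A] unfolding is_iso_def by (metis inj_on_inverseI)

lemma fold_iso:
  assumes "wf_ty 0 (TMu A)" "1 \<le> i" "(y :: 'v) \<in> elts_at (cden (tinst A (TMu A))) i"
  shows "fold_iso A i y \<in> elts_at (cden (TMu A)) i" "unfold_iso A i (fold_iso A i y) = y"
proof -
  have "y \<in> unfold_iso A i ` elts_at (cden (TMu A)) i"
    using unfold_iso[OF assms(1)] assms(2,3) unfolding is_iso_def is_mor_def by (metis imageI)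
  then show "fold_iso A i y \<in> elts_at (cden (TMu A)) i" "unfold_iso A i (fold_iso A i y) = y"
    unfolding fold_iso_def by (rule inv_into_into, rule f_inv_into_f)
qed

lemma fold_iso_restr:
  assumes "wf_ty 0 (TMu A)" "1 \<le> i" "(y :: 'v) \<in> elts_at (cden (tinst A (TMu A))) (Suc i)"
  shows "fold_iso A i (restr (cden (tinst A (TMu A))) i y) = restr (cden (TMu A)) i (fold_iso A (Suc i) y)"
proof (rule inj_onD[OF unfold_iso_inj[OF assms(1,2)]])
  note y = fold_iso[OF assms(1) _ assms(3)]
  have r: "restr (cden (tinst A (TMu A))) i y \<in> elts_at (cden (tinst A (TMu A))) i"
    by (rule is_objD[OF is_obj_cden[OF wf_ty_tinst[OF assms(1)]] assms(2,3)])
  show "unfold_iso A i (fold_iso A i (restr (cden (tinst A (TMu A))) i y)) =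
    unfold_iso A i (restr (cden (TMu A)) i (fold_iso A (Suc i) y))"
    using fold_iso(2)[OF assms(1,2) r] unfold_iso_restr[OF assms(1,2) y(1)] y(2) by simp
  show "fold_iso A i (restr (cden (tinst A (TMu A))) i y) \<in> elts_at (cden (TMu A)) i"
    by (rule fold_iso(1)[OF assms(1,2) r])
  show "restr (cden (TMu A)) i (fold_iso A (Suc i) y) \<in> elts_at (cden (TMu A)) i"
    by (rule is_objD[OF is_obj_cden[OF assms(1)] assms(2) y(1)]) simp
qed

text \<open>Typing checks an entry of the context only where its variable is used, whereas
  restricting an environment needs every entry to denote an object.\<close>

definition wfs :: "ty list \<Rightarrow> bool" where
  "wfs \<Gamma> \<longleftrightarrow> (\<forall>k<length \<Gamma>. wf_ty 0 (\<Gamma> ! k))"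

lemma wfs_Cons: "wfs (A # \<Gamma>) \<longleftrightarrow> wf_ty 0 A \<and> wfs \<Gamma>"
  by (auto simp: wfs_def less_Suc_eq_0_disj)

lemma in_env_restrict:
  "wfs \<Gamma> \<Longrightarrow> in_env \<Gamma> i \<gamma> \<Longrightarrow> 1 \<le> j \<Longrightarrow> j \<le> i \<Longrightarrow> in_env \<Gamma> j (restrict_env \<Gamma> i j \<gamma> :: 'v list)"
  by (auto simp: in_env_def wfs_def intro!: restrict_to_in is_obj_cden)

text \<open>Arguments of constant type trace out a global element of the context, and the body maps
  it to one of B. The denotations of \<open>Prev\<close>, \<open>Box\<close> and \<open>BoxP\<close>
  are all read off from this sequence.\<close>

lemma glob_body:
  fixes \<delta> :: "'v list"
  assumes f: "sem As B f" and c: "wfs As" "\<forall>k<length As. const_ty (As ! k)" and i: "1 \<le> i" and \<delta>: "in_env As i \<delta>"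
  shows "glob (cden B) (\<lambda>j. f j (transport_env As i j \<delta>))"
  unfolding glob_def
proof (intro allI impI conjI)
  have c': "const_obj (cden (As ! k) :: 'v obj)" if "k < length As" for k
    using c that const_obj_cden by (auto simp: wfs_def)
  have e: "in_env As j (transport_env As i j \<delta>)" if "1 \<le> j" for j
    using \<delta> i that c' by (auto simp: in_env_def intro!: transport_in)
  fix j :: nat assume j: "1 \<le> j"
  show "f j (transport_env As i j \<delta>) \<in> elts_at (cden B) j" by (rule semD(1)[OF f j e[OF j]])
  have "restrict_env As (Suc j) j (transport_env As i (Suc j) \<delta>) = transport_env As i j \<delta>"
    using \<delta> i j c' by (auto simp: in_env_def restrict_to_1 intro!: nth_equalityI restr_transport)
  then show "restr (cden B) j (f (Suc j) (transport_env As i (Suc j) \<delta>)) = f j (transport_env As i j \<delta>)"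
    using semD(2)[OF f j e[of "Suc j"]] by simp
qed

lemma transport_env_restrict:
  fixes \<delta> :: "'v list"
  assumes c: "wfs As" "\<forall>k<length As. const_ty (As ! k)" and i: "1 \<le> i" "1 \<le> j" and \<delta>: "in_env As (Suc i) \<delta>"
  shows "transport_env As i j (restrict_env As (Suc i) i \<delta>) = transport_env As (Suc i) j \<delta>"
  using \<delta> i c const_obj_cden
  by (auto simp: in_env_def restrict_to_1 wfs_def intro!: nth_equalityI transport_restr)

lemma sem_args:
  fixes fs :: "(nat \<Rightarrow> 'v list \<Rightarrow> 'v) list"
  assumes "length As = length fs" "\<forall>k<length fs. sem \<Gamma> (As ! k) (fs ! k)" "1 \<le> i"
  shows "in_env \<Gamma> i \<gamma> \<Longrightarrow> in_env As i (map (\<lambda>g. g i \<gamma>) fs)"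
    "in_env \<Gamma> (Suc i) \<gamma> \<Longrightarrow> map (\<lambda>g. g i (restrict_env \<Gamma> (Suc i) i \<gamma>)) fs =
       restrict_env As (Suc i) i (map (\<lambda>g. g (Suc i) \<gamma>) fs)"
  using assms by (auto simp: in_env_def restrict_to_1 semD intro!: nth_equalityI)

text \<open>For \<open>Prev\<close>: a global element of the later object, shifted by one stage, is
  one of X.\<close>

lemma glob_later: "glob (later_obj (X :: 'v obj)) G \<Longrightarrow> glob X (\<lambda>j. G (Suc j))"
  unfolding glob_def elts_later restr_later
proof (intro allI impI)
  fix j :: nat
  assume "\<forall>j\<ge>1. G j \<in> (if j \<le> 1 then {vunit} else elts_at X (j - 1)) \<and>
     (if j \<le> 1 then vunit else restr X (j - 1) (G (Suc j))) = G j" and "1 \<le> j"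
  then show "G (Suc j) \<in> elts_at X j \<and> restr X j (G (Suc (Suc j))) = G (Suc j)"
    by (elim allE[of _ "Suc j"]) simp
qed

text \<open>The stages from 1 on determine d and the components of a, and
  \<open>vtuple {1..}\<close> ignores the value of a at 0; so the description is unique.\<close>

lemma THE_BoxP:
  fixes a :: "nat \<Rightarrow> 'v"
  assumes "\<forall>j\<ge>1. G j = vin d (a j)"
  shows "(THE b. \<exists>d a. (\<forall>j\<ge>1. G j = vin d (a j)) \<and> b = vin d (vtuple {1..} a)) = vin d (vtuple {1..} a)"
proof (rule the_equality)
  fix b assume "\<exists>d a. (\<forall>j\<ge>1. G j = vin d (a j)) \<and> b = vin d (vtuple {1..} a)"
  then obtain d' a' where *: "\<forall>j\<ge>1. G j = vin d' (a' j)" "b = vin d' (vtuple {1..} a')" by blast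
  have "d' = d \<and> a' j = a j" if "1 \<le> j" for j
    using assms *(1) that by (metis vin_inject)
  then show "b = vin d (vtuple {1..} a)" unfolding *(2) by (auto simp: vtuple_eq_iff)
qed (use assms in blast)

lemma denotes_sem:
  "denotes \<Gamma> t A f \<Longrightarrow> wfs \<Gamma> \<Longrightarrow> sem \<Gamma> A (f :: nat \<Rightarrow> 'v list \<Rightarrow> 'v)"
proof (induction rule: denotes.induct)
  case (den_Var k \<Gamma>)
  then show ?case by (intro semI) (auto simp: in_env_def restrict_to_1)
next
  case (den_Zero \<Gamma>)
  show ?case by (intro semI) (auto simp: elts_TNat elts_delta simp del: tden.simps, simp add: elts_delta)
next
  case (den_Succ \<Gamma> t f)
  note f = semD[OF den_Succ.IH[OF den_Succ.prems]]
  show ?case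
  proof (rule semI)
    fix i and \<gamma> :: "'v list" assume "(1::nat) \<le> i" "in_env \<Gamma> i \<gamma>"
    then have "f i \<gamma> \<in> range vnat" using f(1) elts_TNat by blast
    then show "vsucc (f i \<gamma>) \<in> elts_at (cden TNat) i" unfolding elts_TNat by (auto simp: vnat_Suc[symmetric])
  qed (use f(2) in \<open>simp add: elts_delta\<close>)
next
  case (den_Unit \<Gamma>)
  show ?case by (intro semI) (auto simp: elts_TOne simp del: tden.simps, simp add: elts_delta)
next
  case (den_Pair \<Gamma> t A f u B g)
  note f = semD[OF den_Pair.IH(1)[OF den_Pair.prems]] and g = semD[OF den_Pair.IH(2)[OF den_Pair.prems]]
  show ?case by (intro semI) (auto simp: elts_prod restr_prod f g)
next
  case (den_Proj1 \<Gamma> t A B f)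
  note f = semD[OF den_Proj1.IH[OF den_Proj1.prems]]
  have e: "\<exists>x y. f i \<gamma> = vpair x y \<and> x \<in> elts_at (cden A) i \<and> y \<in> elts_at (cden B) i" if "1 \<le> i" "in_env \<Gamma> i \<gamma>" for i and \<gamma> :: "'v list"
    using f(1)[OF that] by (auto simp: elts_prod)
  show ?case
  proof (rule semI)
    fix i and \<gamma> :: "'v list" assume "(1::nat) \<le> i" "in_env \<Gamma> i \<gamma>"
    then show "vfst (f i \<gamma>) \<in> elts_at (cden A) i" using e[of i \<gamma>] by auto
  next
    fix i and \<gamma> :: "'v list" assume "(1::nat) \<le> i" "in_env \<Gamma> (Suc i) \<gamma>"
    then show "vfst (f i (restrict_env \<Gamma> (Suc i) i \<gamma>)) = restr (cden A) i (vfst (f (Suc i) \<gamma>))"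
      using f(2)[of i \<gamma>] e[of "Suc i" \<gamma>] by (auto simp: restr_prod)
  qed
next
  case (den_Proj2 \<Gamma> t A B f)
  note f = semD[OF den_Proj2.IH[OF den_Proj2.prems]]
  have e: "\<exists>x y. f i \<gamma> = vpair x y \<and> x \<in> elts_at (cden A) i \<and> y \<in> elts_at (cden B) i" if "1 \<le> i" "in_env \<Gamma> i \<gamma>" for i and \<gamma> :: "'v list"
    using f(1)[OF that] by (auto simp: elts_prod)
  show ?case
  proof (rule semI)
    fix i and \<gamma> :: "'v list" assume "(1::nat) \<le> i" "in_env \<Gamma> i \<gamma>"
    then show "vsnd (f i \<gamma>) \<in> elts_at (cden B) i" using e[of i \<gamma>] by auto
  next
    fix i and \<gamma> :: "'v list" assume "(1::nat) \<le> i" "in_env \<Gamma> (Suc i) \<gamma>"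
    then show "vsnd (f i (restrict_env \<Gamma> (Suc i) i \<gamma>)) = restr (cden B) i (vsnd (f (Suc i) \<gamma>))"
      using f(2)[of i \<gamma>] e[of "Suc i" \<gamma>] by (auto simp: restr_prod)
  qed
next
  case (den_Abort \<Gamma> t f A)
  note f = semD[OF den_Abort.IH[OF den_Abort.prems]]
  \<comment> \<open>An environment would yield an element of the empty set. Hence there is none, and
    the value \<open>undefined\<close> is never met.\<close>
  have "\<not> in_env \<Gamma> i \<gamma>" if "1 \<le> i" for i and \<gamma> :: "'v list" using f(1)[OF that, of \<gamma>] elts_TZero by auto
  then show ?case by (intro semI) auto
next
  case (den_In1 \<Gamma> t A f B)
  note f = semD[OF den_In1.IH[OF den_In1.prems]]
  show ?case by (intro semI) (auto simp: elts_sum restr_sum f)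
next
  case (den_In2 \<Gamma> t B f A)
  note f = semD[OF den_In2.IH[OF den_In2.prems]]
  show ?case by (intro semI) (auto simp: elts_sum restr_sum f)
next
  case (den_Case \<Gamma> t A B f u C g v h)
  have wf: "wf_ty 0 A" "wf_ty 0 B" using typing_wf[OF denotes_typing[OF den_Case.hyps(1)]] by auto
  note f = semD[OF den_Case.IH(1)[OF den_Case.prems]]
  have g: "sem (A # \<Gamma>) C g" and h: "sem (B # \<Gamma>) C h" using den_Case wf by (auto simp: wfs_Cons)
  have e: "(\<exists>x. f i \<gamma> = vin 1 x \<and> x \<in> elts_at (cden A) i) \<or> (\<exists>x. f i \<gamma> = vin 2 x \<and> x \<in> elts_at (cden B) i)"
    if "1 \<le> i" "in_env \<Gamma> i \<gamma>" for i and \<gamma> :: "'v list"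
    using f(1)[OF that] by (auto simp: elts_sum)
  show ?case
  proof (rule semI)
    fix i and \<gamma> :: "'v list" assume i: "(1::nat) \<le> i" "in_env \<Gamma> i \<gamma>"
    then show "vcase (\<lambda>a. g i (a # \<gamma>)) (\<lambda>b. h i (b # \<gamma>)) (f i \<gamma>) \<in> elts_at (cden C) i"
      using e[OF i] semD(1)[OF g i(1)] semD(1)[OF h i(1)] by (auto simp: in_env_Cons)
  next
    fix i and \<gamma> :: "'v list" assume i: "(1::nat) \<le> i" "in_env \<Gamma> (Suc i) \<gamma>"
    then show "vcase (\<lambda>a. g i (a # restrict_env \<Gamma> (Suc i) i \<gamma>)) (\<lambda>b. h i (b # restrict_env \<Gamma> (Suc i) i \<gamma>)) (f i (restrict_env \<Gamma> (Suc i) i \<gamma>)) =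
      restr (cden C) i (vcase (\<lambda>a. g (Suc i) (a # \<gamma>)) (\<lambda>b. h (Suc i) (b # \<gamma>)) (f (Suc i) \<gamma>))"
      using e[of "Suc i" \<gamma>] f(2)[OF i] semD(2)[OF g i(1), of "_ # \<gamma>"] semD(2)[OF h i(1), of "_ # \<gamma>"]
      by (auto simp: in_env_Cons restr_sum restrict_env_Cons restrict_to_1)
  qed
next
  case (den_Lam A \<Gamma> t B f)
  have f: "sem (A # \<Gamma>) B f" using den_Lam by (simp add: wfs_Cons)
  let ?h = "\<lambda>i \<gamma> j a. f j (a # restrict_env \<Gamma> i j \<gamma>)"
  have mor: "exp_mor (cden A) (cden B) i (?h i \<gamma>)" if "in_env \<Gamma> i \<gamma>" for i and \<gamma> :: "'v list"
    unfolding exp_mor_def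
  proof (intro conjI ballI)
    fix j and x :: "'v" assume "j \<in> {1..i}" "x \<in> elts_at (cden A) j"
    then show "?h i \<gamma> j x \<in> elts_at (cden B) j"
      using that den_Lam.prems by (intro semD(1)[OF f]) (auto simp: in_env_Cons in_env_restrict)
  next
    fix j and x :: "'v" assume j: "j \<in> {1..<i}" and x: "x \<in> elts_at (cden A) (Suc j)"
    have "in_env (A # \<Gamma>) (Suc j) (x # restrict_env \<Gamma> i (Suc j) \<gamma>)"
      using j x that den_Lam.prems by (auto simp: in_env_Cons in_env_restrict)
    from semD(2)[OF f _ this] j show "?h i \<gamma> j (restr (cden A) j x) = restr (cden B) j (?h i \<gamma> (Suc j) x)"
      using that by (auto simp: restrict_env_Cons restrict_to_1 restrict_env_Suc_right)
  qed
  show ?case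
  proof (rule semI)
    fix i and \<gamma> :: "'v list" assume "(1::nat) \<le> i" "in_env \<Gamma> i \<gamma>"
    then show "tup (cden A) i (?h i \<gamma>) \<in> elts_at (cden (TFun A B)) i"
      using tup_in_exp[OF mor] by simp
  next
    fix i and \<gamma> :: "'v list" assume i: "(1::nat) \<le> i" "in_env \<Gamma> (Suc i) \<gamma>"
    have "restr (exp_obj (cden A) (cden B)) i (tup (cden A) (Suc i) (?h (Suc i) \<gamma>)) =
        tup (cden A) i (ev (tup (cden A) (Suc i) (?h (Suc i) \<gamma>)))"
      by (rule restr_exp[OF tup_in_exp[OF mor[OF i(2)]]])
    \<comment> \<open>Restriction keeps the components j up to i; for these, restricting the
      environment to i and then to j equals restricting it to j at once.\<close>
    also have "\<dots> = tup (cden A) i (?h i (restrict_env \<Gamma> (Suc i) i \<gamma>))"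
      using i by (intro tup_cong) (simp add: restrict_env_Suc_left)
    finally show "tup (cden A) i (?h i (restrict_env \<Gamma> (Suc i) i \<gamma>)) =
       restr (cden (TFun A B)) i (tup (cden A) (Suc i) (?h (Suc i) \<gamma>))" by simp
  qed
next
  case (den_App \<Gamma> t A B f u g)
  note f = semD[OF den_App.IH(1)[OF den_App.prems]] and g = semD[OF den_App.IH(2)[OF den_App.prems]]
  have oA: "is_obj (cden A :: 'v obj)"
    using typing_wf[OF denotes_typing[OF den_App.hyps(2)]] by (rule is_obj_cden)
  have fe: "f i \<gamma> \<in> elts_at (exp_obj (cden A) (cden B)) i" if "1 \<le> i" "in_env \<Gamma> i \<gamma>" for i and \<gamma> :: "'v list"
    using f(1)[OF that] by simp
  show ?case
  proof (rule semI)
    fix i and \<gamma> :: "'v list" assume i: "(1::nat) \<le> i" "in_env \<Gamma> i \<gamma>"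
    then show "ev (f i \<gamma>) i (g i \<gamma>) \<in> elts_at (cden B) i"
      using ev_in[OF fe[OF i] oA i(1) order.refl g(1)[OF i]] by simp
  next
    fix i and \<gamma> :: "'v list" assume i: "(1::nat) \<le> i" "in_env \<Gamma> (Suc i) \<gamma>"
    then show "ev (f i (restrict_env \<Gamma> (Suc i) i \<gamma>)) i (g i (restrict_env \<Gamma> (Suc i) i \<gamma>)) =
      restr (cden B) i (ev (f (Suc i) \<gamma>) (Suc i) (g (Suc i) \<gamma>))"
      using ev_restr_arg[OF fe[OF _ i(2)] oA i(1) _ g(1)[OF _ i(2)]] by (simp add: f(2) g(2) ev_restr)
  qed
next
  case (den_Fold \<Gamma> t A f)
  note f = semD[OF den_Fold.IH[OF den_Fold.prems]]
  show ?case
    using f fold_iso(1)[OF den_Fold.hyps(2)] fold_iso_restr[OF den_Fold.hyps(2)]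
    by (intro semI) (simp_all del: tden.simps)
next
  case (den_Unfold \<Gamma> t A f)
  note f = semD[OF den_Unfold.IH[OF den_Unfold.prems]]
  note wf = typing_wf[OF denotes_typing[OF den_Unfold.hyps]]
  show ?case
    using f unfold_iso_in[OF wf] unfold_iso_restr[OF wf]
    by (intro semI) (simp_all del: tden.simps)
next
  case (den_Next \<Gamma> t A f)
  note f = semD[OF den_Next.IH[OF den_Next.prems]]
  have oA: "is_obj (cden A :: 'v obj)"
    using typing_wf[OF denotes_typing[OF den_Next.hyps]] by (rule is_obj_cden)
  show ?case
  proof (rule semI)
    fix i and \<gamma> :: "'v list" assume i: "(1::nat) \<le> i" "in_env \<Gamma> i \<gamma>"
    then show "(if i \<le> 1 then vunit else restr (cden A) (i - 1) (f i \<gamma>)) \<in> elts_at (cden (TLater A)) i"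
      using is_objD[OF oA, of "i - 1"] f(1)[OF i] by (auto simp: elts_later)
  next
    fix i and \<gamma> :: "'v list" assume i: "(1::nat) \<le> i" "in_env \<Gamma> (Suc i) \<gamma>"
    then show "(if i \<le> 1 then vunit else restr (cden A) (i - 1) (f i (restrict_env \<Gamma> (Suc i) i \<gamma>))) =
      restr (cden (TLater A)) i (if Suc i \<le> 1 then vunit else restr (cden A) (Suc i - 1) (f (Suc i) \<gamma>))"
      using f(2)[OF i] by (auto simp: restr_later diff_Suc_1)
  qed
next
  case (den_Prev As \<sigma> fs \<Gamma> t A f)
  have wfs: "wfs As" using den_Prev.IH(1) den_Prev.hyps typing_wf denotes_typing unfolding wfs_def by metis
  have c: "\<forall>k<length As. const_ty (As ! k)" using den_Prev by simp
  have f: "sem As (TLater A) f" using den_Prev wfs by blast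
  have len: "length As = length fs" and args: "\<forall>k<length fs. sem \<Gamma> (As ! k) (fs ! k)" using den_Prev by simp_all
  note sa = sem_args[OF len args]
  have G: "glob (cden A) (\<lambda>j. f (Suc j) (transport_env As i (Suc j) (map (\<lambda>g. g i \<gamma>) fs)))"
    if "1 \<le> i" "in_env \<Gamma> i \<gamma>" for i and \<gamma> :: "'v list"
    using glob_later[of "cden A"] glob_body[OF f wfs c that(1) sa(1)[OF that]] by simp
  show ?case
  proof (rule semI)
    fix i and \<gamma> :: "'v list" assume i: "(1::nat) \<le> i" "in_env \<Gamma> i \<gamma>"
    show "f (Suc i) (transport_env As i (Suc i) (map (\<lambda>g. g i \<gamma>) fs)) \<in> elts_at (cden A) i"
      using globD(1)[OF G[OF i] i(1)] .
  next
    fix i and \<gamma> :: "'v list" assume i: "(1::nat) \<le> i" "in_env \<Gamma> (Suc i) \<gamma>"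
    have "in_env As (Suc i) (map (\<lambda>g. g (Suc i) \<gamma>) fs)" using sa(1)[OF _ i(2)] by simp
    then show "f (Suc i) (transport_env As i (Suc i) (map (\<lambda>g. g i (restrict_env \<Gamma> (Suc i) i \<gamma>)) fs)) =
       restr (cden A) i (f (Suc (Suc i)) (transport_env As (Suc i) (Suc (Suc i)) (map (\<lambda>g. g (Suc i) \<gamma>) fs)))"
      using globD(2)[OF G[OF _ i(2)] i(1)] i by (simp add: sa(2) transport_env_restrict[OF wfs c])
  qed
next
  case (den_Ast \<Gamma> t A B f u g)
  note f = semD[OF den_Ast.IH(1)[OF den_Ast.prems]] and g = semD[OF den_Ast.IH(2)[OF den_Ast.prems]]
  have oA: "is_obj (cden A :: 'v obj)"
    using typing_wf[OF denotes_typing[OF den_Ast.hyps(2)]] is_obj_cden by auto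
  have fe: "f i \<gamma> \<in> elts_at (exp_obj (cden A) (cden B)) (i - 1) \<and> g i \<gamma> \<in> elts_at (cden A) (i - 1)"
    if "1 < i" "in_env \<Gamma> i \<gamma>" for i and \<gamma> :: "'v list"
    using f(1)[of i \<gamma>] g(1)[of i \<gamma>] that by (auto simp: elts_later)
  show ?case
  proof (rule semI)
    fix i and \<gamma> :: "'v list" assume i: "(1::nat) \<le> i" "in_env \<Gamma> i \<gamma>"
    show "(if i \<le> 1 then vunit else ev (f i \<gamma>) (i - 1) (g i \<gamma>)) \<in> elts_at (cden (TLater B)) i"
    proof (cases "i \<le> 1")
      case False
      then have "1 \<le> i - 1" by linarith
      with False show ?thesis
        using ev_in[of "f i \<gamma>" "cden A" "cden B" "i - 1" "i - 1"] fe[of i \<gamma>] i oA by (simp add: elts_later)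
    qed (simp add: elts_later)
  next
    fix i and \<gamma> :: "'v list" assume i: "(1::nat) \<le> i" "in_env \<Gamma> (Suc i) \<gamma>"
    show "(if i \<le> 1 then vunit else ev (f i (restrict_env \<Gamma> (Suc i) i \<gamma>)) (i - 1) (g i (restrict_env \<Gamma> (Suc i) i \<gamma>))) =
      restr (cden (TLater B)) i (if Suc i \<le> 1 then vunit else ev (f (Suc i) \<gamma>) (Suc i - 1) (g (Suc i) \<gamma>))"
    proof (cases "i \<le> 1")
      case False
      \<comment> \<open>Stage i of a later object is stage k of the original, so naturality at i
        reduces to that of application at k.\<close>
      then obtain k where k: "i = Suc k" "1 \<le> k" using i(1) by (cases i) auto
      have "f i (restrict_env \<Gamma> (Suc i) i \<gamma>) = restr (exp_obj (cden A) (cden B)) k (f (Suc i) \<gamma>)"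
        "g i (restrict_env \<Gamma> (Suc i) i \<gamma>) = restr (cden A) k (g (Suc i) \<gamma>)"
        using f(2)[OF i] g(2)[OF i] k by (simp_all add: restr_later diff_Suc_1)
      moreover have "f (Suc i) \<gamma> \<in> elts_at (exp_obj (cden A) (cden B)) i" "g (Suc i) \<gamma> \<in> elts_at (cden A) i"
        using fe[of "Suc i" \<gamma>] i by (simp_all add: diff_Suc_1)
      ultimately show ?thesis
        using ev_restr_arg[of "f (Suc i) \<gamma>" "cden A" "cden B" i k "g (Suc i) \<gamma>"] oA k
        by (simp add: restr_later diff_Suc_1 ev_restr)
    qed (simp add: restr_later)
  qed
next
  case (den_Box As \<sigma> fs \<Gamma> t A f)
  have wfs: "wfs As" using den_Box.IH(1) den_Box.hyps typing_wf denotes_typing unfolding wfs_def by metis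
  have c: "\<forall>k<length As. const_ty (As ! k)" using den_Box by simp
  have f: "sem As A f" using den_Box wfs by blast
  have len: "length As = length fs" and args: "\<forall>k<length fs. sem \<Gamma> (As ! k) (fs ! k)" using den_Box by simp_all
  note sa = sem_args[OF len args]
  have G: "glob (cden A) (\<lambda>j. f j (transport_env As i j (map (\<lambda>g. g i \<gamma>) fs)))"
    if "1 \<le> i" "in_env \<Gamma> i \<gamma>" for i and \<gamma> :: "'v list"
    using glob_body[OF f wfs c that(1) sa(1)[OF that]] .
  show ?case
  proof (rule semI)
    fix i and \<gamma> :: "'v list" assume i: "(1::nat) \<le> i" "in_env \<Gamma> i \<gamma>"
    show "vtuple {1..} (\<lambda>j. f j (transport_env As i j (map (\<lambda>g. g i \<gamma>) fs))) \<in> elts_at (cden (TBox A)) i"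
      using G[OF i] by (auto simp: elts_box)
  next
    fix i and \<gamma> :: "'v list" assume i: "(1::nat) \<le> i" "in_env \<Gamma> (Suc i) \<gamma>"
    have "in_env As (Suc i) (map (\<lambda>g. g (Suc i) \<gamma>) fs)" using sa(1)[OF _ i(2)] by simp
    \<comment> \<open>Restriction in \<open>box_obj\<close> is the identity, so the two sequences
      must be equal outright: transport absorbs the restriction of the arguments.\<close>
    then show "vtuple {1..} (\<lambda>j. f j (transport_env As i j (map (\<lambda>g. g i (restrict_env \<Gamma> (Suc i) i \<gamma>)) fs))) =
       restr (cden (TBox A)) i (vtuple {1..} (\<lambda>j. f j (transport_env As (Suc i) j (map (\<lambda>g. g (Suc i) \<gamma>) fs))))"
      using i by (auto simp: restr_box sa(2) transport_env_restrict[OF wfs c] vtuple_eq_iff)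
  qed
next
  case (den_Unbox \<Gamma> t A f)
  note f = semD[OF den_Unbox.IH[OF den_Unbox.prems]]
  have G: "glob (cden A) (vproj (f i \<gamma>))" if "1 \<le> i" "in_env \<Gamma> i \<gamma>" for i and \<gamma> :: "'v list"
    using f(1)[OF that] box_proj(1) by simp
  show ?case
  proof (rule semI)
    fix i and \<gamma> :: "'v list" assume i: "(1::nat) \<le> i" "in_env \<Gamma> i \<gamma>"
    then show "vproj (f i \<gamma>) i \<in> elts_at (cden A) i" using globD(1)[OF G] by blast
  next
    fix i and \<gamma> :: "'v list" assume i: "(1::nat) \<le> i" "in_env \<Gamma> (Suc i) \<gamma>"
    then show "vproj (f i (restrict_env \<Gamma> (Suc i) i \<gamma>)) i = restr (cden A) i (vproj (f (Suc i) \<gamma>) (Suc i))"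
      using globD(2)[OF G[OF _ i(2)] i(1)] f(2)[OF i] by (simp add: restr_box)
  qed
next
  case (den_BoxP As \<sigma> fs \<Gamma> t A B f)
  have wfs: "wfs As" using den_BoxP.IH(1) den_BoxP.hyps typing_wf denotes_typing unfolding wfs_def by metis
  have c: "\<forall>k<length As. const_ty (As ! k)" using den_BoxP by simp
  have f: "sem As (TSum A B) f" using den_BoxP wfs by blast
  have len: "length As = length fs" and args: "\<forall>k<length fs. sem \<Gamma> (As ! k) (fs ! k)" using den_BoxP by simp_all
  note sa = sem_args[OF len args]
  let ?G = "\<lambda>i \<gamma> j. f j (transport_env As i j (map (\<lambda>g. g i \<gamma>) fs))"
  let ?T = "\<lambda>i \<gamma>. THE b. \<exists>d a. (\<forall>j\<ge>1. ?G i \<gamma> j = vin d (a j)) \<and> b = vin d (vtuple {1..} a)"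
  have G: "glob (sum_obj (cden A) (cden B)) (?G i \<gamma>)"
    if "1 \<le> i" "in_env \<Gamma> i \<gamma>" for i and \<gamma> :: "'v list"
    using glob_body[OF f wfs c that(1) sa(1)[OF that]] by simp
  have T: "(\<exists>a. glob (cden A) a \<and> ?T i \<gamma> = vin 1 (vtuple {1..} a)) \<or> (\<exists>a. glob (cden B) a \<and> ?T i \<gamma> = vin 2 (vtuple {1..} a))"
    if "1 \<le> i" "in_env \<Gamma> i \<gamma>" for i and \<gamma> :: "'v list"
    using glob_sum[OF G[OF that]]
  proof (elim disjE exE conjE)
    fix a assume "glob (cden A) a" "\<forall>j\<ge>1. ?G i \<gamma> j = vin 1 (a j)"
    then show ?thesis using THE_BoxP[of "?G i \<gamma>" 1 a] by blast
  next
    fix a assume "glob (cden B) a" "\<forall>j\<ge>1. ?G i \<gamma> j = vin 2 (a j)"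
    then show ?thesis using THE_BoxP[of "?G i \<gamma>" 2 a] by blast
  qed
  show ?case
  proof (rule semI)
    fix i and \<gamma> :: "'v list" assume i: "(1::nat) \<le> i" "in_env \<Gamma> i \<gamma>"
    show "?T i \<gamma> \<in> elts_at (cden (TSum (TBox A) (TBox B))) i"
      using T[OF i] by (auto simp: elts_sum elts_box)
  next
    fix i and \<gamma> :: "'v list" assume i: "(1::nat) \<le> i" "in_env \<Gamma> (Suc i) \<gamma>"
    have "in_env As (Suc i) (map (\<lambda>g. g (Suc i) \<gamma>) fs)" using sa(1)[OF _ i(2)] by simp
    then have "\<forall>j\<ge>1. ?G i (restrict_env \<Gamma> (Suc i) i \<gamma>) j = ?G (Suc i) \<gamma> j"
      using i by (auto simp: sa(2) transport_env_restrict[OF wfs c])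
    then have "?T i (restrict_env \<Gamma> (Suc i) i \<gamma>) = ?T (Suc i) \<gamma>" by (simp cong: conj_cong)
    moreover have "restr (cden (TSum (TBox A) (TBox B))) i (?T (Suc i) \<gamma>) = ?T (Suc i) \<gamma>"
      using T[of "Suc i" \<gamma>] i by (auto simp: restr_sum restr_box)
    ultimately show "?T i (restrict_env \<Gamma> (Suc i) i \<gamma>) = restr (cden (TSum (TBox A) (TBox B))) i (?T (Suc i) \<gamma>)" by simp
  qed
qed

end

section \<open>Adequacy\<close>

lemma logrel_in_dom: "logrel A i a t \<Longrightarrow> in_dom A i a t"
  by (cases A) auto

text \<open>Expansion can lose typability, for instance when a projection discards an ill-typed
  component, so the type of t is assumed separately.\<close>

lemma logrel_steps: "t \<Zsurj> u \<Longrightarrow> [] \<turnstile> t \<Ztypecolon> A \<Longrightarrow> logrel A i a u \<Longrightarrow> logrel A i a t"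
  by (cases A) (auto simp: in_dom_def intro: rtranclp_trans, (blast intro: rtranclp_trans)+)

lemma in_dom_elt: "in_dom A i a t \<Longrightarrow> wf_ty 0 A \<and> 1 \<le> i \<and> a \<in> elts_at (cden A) i \<and> [] \<turnstile> t \<Ztypecolon> A"
  by (simp add: in_dom_def)

section \<open>Change of stage in the logical relation\<close>

context zf_model
begin

lemma in_dom_pred:
  assumes "in_dom A i (a :: 'v) t" "1 < i"
  shows "in_dom A (i - 1) (restr (cden A) (i - 1) a) t"
proof -
  have "wf_ty 0 A" "a \<in> elts_at (cden A) (Suc (i - 1))" "1 \<le> i - 1"
    using assms by (auto simp: in_dom_def)
  then show ?thesis using assms is_objD[OF is_obj_cden] by (auto simp: in_dom_def)
qed

text \<open>Kripke monotonicity. Restriction acts componentwise on pairs and injections, drops a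
  component at arrows, is trivial at \<open>TBox\<close>, and at \<open>TMu\<close> commutes with
  \<open>unfold_iso\<close> by naturality.\<close>

lemma logrel_pred: "logrel A i (a :: 'v) t \<Longrightarrow> 1 < i \<Longrightarrow> logrel A (i - 1) (restr (cden A) (i - 1) a) t"
proof (induction A i a t rule: logrel.induct)
  case (2 i a t)
  then show ?case using in_dom_pred[of TNat i a t] by (auto simp: elts_delta)
next
  case (3 i a t)
  then show ?case using in_dom_pred[of TOne i a t] by (auto simp: elts_delta)
next
  case (5 A B i a t)
  note d = in_dom_pred[OF logrel_in_dom[OF 5(3)] 5(4)]
  obtain a1 a2 t1 t2 where *: "a = vpair a1 a2" "t \<Zsurj> MkPair t1 t2" "logrel A i a1 t1" "logrel B i a2 t2"
    using "5.prems" by auto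
  have "logrel A (i - 1) (restr (cden A) (i - 1) a1) t1" "logrel B (i - 1) (restr (cden B) (i - 1) a2) t2"
    using 5 * by auto
  then show ?case using d * by (auto simp: restr_prod)
next
  case (6 A B i a t)
  note d = in_dom_pred[OF logrel_in_dom[OF 6(3)] 6(4)]
  from "6.prems" consider b u where "a = vin 1 b" "t \<Zsurj> In1 u" "logrel A i b u"
    | b u where "a = vin 2 b" "t \<Zsurj> In2 u" "logrel B i b u" by auto
  then show ?case
  proof cases
    case 1
    then have "logrel A (i - 1) (restr (cden A) (i - 1) b) u" using 6 by auto
    then show ?thesis using d 1 by (auto simp: restr_sum)
  next
    case 2
    then have "logrel B (i - 1) (restr (cden B) (i - 1) b) u" using 6 by auto
    then show ?thesis using d 2 by (auto simp: restr_sum)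
  qed
next
  case (7 A B i a t)
  note d = in_dom_pred[OF logrel_in_dom[OF 7(3)] 7(4)]
  obtain s where s: "t \<Zsurj> Lam s" "\<And>j b u. j \<in> {1..i} \<Longrightarrow> logrel A j b u \<Longrightarrow> logrel B j (ev a j b) (inst s [u])"
    using "7.prems" by auto
  have "logrel B j (ev (restr (cden (TFun A B)) (i - 1) a) j b) (inst s [u])"
    if "j \<in> {1..i - 1}" "logrel A j b u" for j b u
    using s(2)[of j b u] that by (auto simp: ev_restr)
  then show ?case using d s(1) by (auto simp del: tden.simps)
next
  case (8 A i a t)
  note d = in_dom_pred[OF logrel_in_dom[OF 8(2)] 8(3)]
  obtain u where u: "in_dom (TMu A) i a t" "t \<Zsurj> Fold u" "logrel (tinst A (TMu A)) i (unfold_iso A i a) u"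
    using "8.prems" by auto
  have "logrel (tinst A (TMu A)) (i - 1) (restr (cden (tinst A (TMu A))) (i - 1) (unfold_iso A i a)) u"
    using "8.IH" u "8.prems" by auto
  moreover have "unfold_iso A (i - 1) (restr (cden (TMu A)) (i - 1) a) = restr (cden (tinst A (TMu A))) (i - 1) (unfold_iso A i a)"
    using unfold_iso_restr[of A "i - 1" a] u(1) "8.prems"(2) by (auto simp: in_dom_def simp del: tden.simps)
  ultimately show ?case using d u(2) by (auto simp del: tden.simps)
next
  case (9 A i a t)
  note d = in_dom_pred[OF logrel_in_dom[OF 9(2)] 9(3)]
  obtain u where u: "in_dom (TLater A) i a t" "t \<Zsurj> Next u" "logrel A (i - 1) a u"
    using "9.prems" by auto
  have "1 < i - 1 \<longrightarrow> logrel A (i - 1 - 1) (restr (cden A) (i - 1 - 1) a) u" using 9 u by auto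
  then show ?case using d u by (auto simp: restr_later)
next
  case (10 A i a t)
  note d = in_dom_pred[OF logrel_in_dom[OF 10(2)] 10(3)]
  then show ?case using "10.prems" by (auto simp: restr_box)
qed auto

lemma logrel_restrict:
  assumes "j \<le> i" "1 \<le> j" "logrel A i (a :: 'v) t"
  shows "logrel A j (restrict_to (cden A) i j a) t"
  using assms(1,3)
proof (induction arbitrary: a rule: dec_induct)
  case (step n)
  have "logrel A n (restr (cden A) n a) t"
    using logrel_pred[OF step.prems] step.hyps assms(2) by simp
  then show ?case using step.IH step.hyps by (simp add: restrict_to_Suc)
qed simp

text \<open>The semantic element has to move along with the stage. Phrasing the claim along a global
  element y handles both directions at once.\<close>

lemma logrel_const:
  "const_ty A \<Longrightarrow> glob (cden A) (y :: nat \<Rightarrow> 'v) \<Longrightarrow> 1 \<le> i \<Longrightarrow> logrel A i (y i) t \<Longrightarrow> 1 \<le> j \<Longrightarrow> logrel A j (y j) t"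
proof (induction "usize A" arbitrary: A i j t y rule: less_induct)
  case less
  note d = in_dom_elt[OF logrel_in_dom[OF less.prems(4)]]
  have d': "in_dom A j (y j) t" using d globD(1)[OF less.prems(2,5)] less.prems(5) by (simp add: in_dom_def)
  show ?case
  proof (cases A)
    case TNat
    then show ?thesis using less.prems d' glob_delta_const[of _ y i] glob_delta_const[of _ y j] by auto
  next
    case TOne
    then show ?thesis using less.prems d' by auto
  next
    case (TProd B C)
    then obtain z w where zw: "glob (cden B) z" "glob (cden C) w" "\<And>j. 1 \<le> j \<Longrightarrow> y j = vpair (z j) (w j)"
      using glob_prod less.prems(2) by (metis tden.simps(4))
    obtain t1 t2 where t: "t \<Zsurj> MkPair t1 t2" "logrel B i (z i) t1" "logrel C i (w i) t2"
      using less.prems(4) TProd zw(3)[OF less.prems(3)] by auto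
    have "logrel B j (z j) t1" "logrel C j (w j) t2"
      using less.hyps[OF _ _ zw(1) less.prems(3) t(2) less.prems(5)] less.hyps[OF _ _ zw(2) less.prems(3) t(3) less.prems(5)]
        less.prems(1) TProd by auto
    then show ?thesis using TProd t(1) zw(3)[OF less.prems(5)] d' by auto
  next
    case (TSum B C)
    then have "glob (sum_obj (cden B) (cden C)) y" using less.prems(2) by simp
    from glob_sum[OF this] show ?thesis
    proof (elim disjE exE conjE)
      fix z assume z: "glob (cden B) z" "\<forall>j\<ge>1. y j = vin 1 (z j)"
      then obtain u where u: "t \<Zsurj> In1 u" "logrel B i (z i) u"
        using less.prems(3,4) TSum by auto
      have "logrel B j (z j) u" using less.hyps[OF _ _ z(1) less.prems(3) u(2) less.prems(5)] TSum less.prems(1) by auto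
      then show ?thesis using TSum u(1) z(2) less.prems(5) d' by auto
    next
      fix z assume z: "glob (cden C) z" "\<forall>j\<ge>1. y j = vin 2 (z j)"
      then obtain u where u: "t \<Zsurj> In2 u" "logrel C i (z i) u"
        using less.prems(3,4) TSum by auto
      have "logrel C j (z j) u" using less.hyps[OF _ _ z(1) less.prems(3) u(2) less.prems(5)] TSum less.prems(1) by auto
      then show ?thesis using TSum u(1) z(2) less.prems(5) d' by auto
    qed
  next
    case (TFun B C)
    then obtain s where s: "t \<Zsurj> Lam s"
      "\<And>j b u. j \<in> {1..i} \<Longrightarrow> logrel B j b u \<Longrightarrow> logrel C j (ev (y i) j b) (inst s [u])"
      using less.prems(4) by auto
    have wf: "wf_ty 0 B" and c: "const_ty B" "const_ty C" using d less.prems(1) TFun by auto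
    have g: "glob (exp_obj (cden B) (cden C)) y" using less.prems(2) TFun by simp
    have "logrel C k (ev (y j) k b) (inst s [u])" if k: "k \<in> {1..j}" and b: "logrel B k b u" for k b u
    proof -
      have k1: "1 \<le> k" using k by simp
      \<comment> \<open>The argument lies on a global element of the constant domain. Along it the
        argument moves to stage i, where s is known to behave, and the result moves back to
        k.\<close>
      obtain z where z: "glob (cden B) z" "z k = b"
        using const_obj_glob[OF const_obj_cden[OF wf c(1)] k1] in_dom_elt[OF logrel_in_dom[OF b]] by blast
      have "logrel B i (z i) u"
        using less.hyps[OF _ c(1) z(1) k1 _ less.prems(3)] b z(2) TFun by simp
      then have "logrel C i (ev (y i) i (z i)) (inst s [u])"
        using s(2) less.prems(3) by simp
      then have "logrel C k (ev (y k) k (z k)) (inst s [u])"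
        using less.hyps[OF _ c(2) glob_exp_ev[OF g is_obj_cden[OF wf] z(1)] less.prems(3) _ k1] TFun by simp
      then show ?thesis using glob_exp_vproj[OF g k1, of j] k z(2) by simp
    qed
    then show ?thesis using TFun s(1) d' by auto
  next
    case (TMu B)
    then obtain u where u: "t \<Zsurj> Fold u" "logrel (tinst B (TMu B)) i (unfold_iso B i (y i)) u"
      using less.prems(4) by auto
    have wf: "wf_ty 0 (TMu B)" using d TMu by simp
    have "glob (cden (tinst B (TMu B))) (\<lambda>j. unfold_iso B j (y j))"
      using glob_mor unfold_iso[OF wf] less.prems(2) TMu unfolding is_iso_def by blast
    from less.hyps[OF _ _ this less.prems(3) u(2) less.prems(5)]
    have "logrel (tinst B (TMu B)) j (unfold_iso B j (y j)) u"
      using unfolding_decreases(2)[OF wf] const_ty_tinst less.prems(1) TMu by simp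
    then show ?thesis using TMu u(1) d' by auto
  next
    case (TBox B)
    then have "y i = y j" using less.prems glob_delta_const[of _ y i] glob_delta_const[of _ y j] by (simp add: box_obj_def)
    then show ?thesis using TBox less.prems(4) d' by auto
  qed (use less.prems in auto)
qed

lemma logrel_transport:
  assumes "const_ty A" "1 \<le> i" "1 \<le> j" "logrel A i (a :: 'v) t"
  shows "logrel A j (transport (cden A) i j a) t"
proof -
  note d = in_dom_elt[OF logrel_in_dom[OF assms(4)]]
  have c: "const_obj (cden A :: 'v obj)" using d assms(1) const_obj_cden by blast
  then obtain y where y: "glob (cden A) y" "y i = a" using const_obj_glob[OF c assms(2)] d by blast
  show ?thesis using logrel_const[OF assms(1) y(1) assms(2) _ assms(3)] transport_glob[OF c y(1) assms(2,3)] y(2) assms(4) by simp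
qed

section \<open>The fundamental lemma\<close>

definition rel_env :: "ty list \<Rightarrow> nat \<Rightarrow> 'v list \<Rightarrow> (nat \<Rightarrow> tm) \<Rightarrow> bool" where
  "rel_env \<Gamma> i \<gamma> s \<longleftrightarrow> length \<gamma> = length \<Gamma> \<and> (\<forall>k<length \<Gamma>. logrel (\<Gamma> ! k) i (\<gamma> ! k) (s k))"

lemma rel_env_in_env: "rel_env \<Gamma> i \<gamma> s \<Longrightarrow> wfs \<Gamma> \<and> in_env \<Gamma> i \<gamma>"
  using in_dom_elt[OF logrel_in_dom] by (fastforce simp: rel_env_def wfs_def in_env_def)

lemma rel_env_typing: "rel_env \<Gamma> i \<gamma> s \<Longrightarrow> \<Gamma> \<turnstile> t \<Ztypecolon> A \<Longrightarrow> [] \<turnstile> sub s t \<Ztypecolon> A"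
  by (intro typing_sub) (auto simp: rel_env_def dest!: logrel_in_dom simp: in_dom_def)

lemma rel_env_in_dom: "rel_env \<Gamma> i \<gamma> s \<Longrightarrow> 1 \<le> i \<Longrightarrow> denotes \<Gamma> t A f \<Longrightarrow> in_dom A i (f i \<gamma>) (sub s t)"
  using rel_env_typing denotes_typing typing_wf rel_env_in_env semD(1)[OF denotes_sem]
  unfolding in_dom_def by metis

lemma rel_env_Cons: "rel_env \<Gamma> i \<gamma> s \<Longrightarrow> logrel A i a u \<Longrightarrow> rel_env (A # \<Gamma>) i (a # \<gamma>) (env_sub [u] s)"
  by (auto simp: rel_env_def env_sub_def less_Suc_eq_0_disj)

lemma rel_env_restrict: "rel_env \<Gamma> i \<gamma> s \<Longrightarrow> 1 \<le> j \<Longrightarrow> j \<le> i \<Longrightarrow> rel_env \<Gamma> j (restrict_env \<Gamma> i j \<gamma>) s"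
  by (auto simp: rel_env_def intro: logrel_restrict)

lemma rel_env_transport:
  assumes "length As = length us" "length \<delta> = length As" "1 \<le> i" "1 \<le> j"
    "\<forall>k<length As. const_ty (As ! k) \<and> logrel (As ! k) i (\<delta> ! k) (us ! k)"
  shows "rel_env As j (transport_env As i j \<delta>) (env_sub us s)"
  using assms by (auto simp: rel_env_def env_sub_def intro: logrel_transport)

lemma logrel_fundamental:
  "denotes \<Gamma> t A f \<Longrightarrow> 1 \<le> i \<Longrightarrow> rel_env \<Gamma> i \<gamma> s \<Longrightarrow> logrel A i (f i \<gamma> :: 'v) (sub s t)"
proof (induction arbitrary: i \<gamma> s rule: denotes.induct)
  case (den_Var k \<Gamma>)
  then show ?case by (simp add: rel_env_def)
next
  case (den_Zero \<Gamma>)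
  note d = rel_env_in_dom[OF den_Zero.prems(2,1) denotes.den_Zero]
  show ?case using d by (auto intro!: exI[of _ 0])
next
  case (den_Succ \<Gamma> t f)
  note d = rel_env_in_dom[OF den_Succ.prems(2,1) denotes.den_Succ[OF den_Succ.hyps]]
  obtain n where n: "f i \<gamma> = vnat n" "sub s t \<Zsurj> (Succ ^^ n) Zero"
    using den_Succ.IH[OF den_Succ.prems] by auto
  have "vsucc (f i \<gamma>) = vnat (Suc n)" "sub s (Succ t) \<Zsurj> (Succ ^^ Suc n) Zero"
    using n steps_context(1) by (simp_all add: vnat_Suc)
  then show ?case using d by (simp only: logrel.simps) blast
next
  case (den_Unit \<Gamma>)
  note d = rel_env_in_dom[OF den_Unit.prems(2,1) denotes.den_Unit]
  show ?case using d by auto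
next
  case (den_Pair \<Gamma> t A f u B g)
  note d = rel_env_in_dom[OF den_Pair.prems(2,1) denotes.den_Pair[OF den_Pair.hyps]]
  show ?case using d den_Pair.IH(1)[OF den_Pair.prems] den_Pair.IH(2)[OF den_Pair.prems] by auto
next
  case (den_Proj1 \<Gamma> t A B f)
  note ty = rel_env_typing[OF den_Proj1.prems(2) denotes_typing[OF denotes.den_Proj1[OF den_Proj1.hyps]]]
  obtain a1 a2 t1 t2 where *: "f i \<gamma> = vpair a1 a2" "sub s t \<Zsurj> MkPair t1 t2" "logrel A i a1 t1"
    using den_Proj1.IH[OF den_Proj1.prems] by auto
  show ?case using logrel_steps[OF _ ty] elim_steps(1)[OF *(2)] * by simp
next
  case (den_Proj2 \<Gamma> t A B f)
  note ty = rel_env_typing[OF den_Proj2.prems(2) denotes_typing[OF denotes.den_Proj2[OF den_Proj2.hyps]]]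
  obtain a1 a2 t1 t2 where *: "f i \<gamma> = vpair a1 a2" "sub s t \<Zsurj> MkPair t1 t2" "logrel B i a2 t2"
    using den_Proj2.IH[OF den_Proj2.prems] by auto
  show ?case using logrel_steps[OF _ ty] elim_steps(2)[OF *(2)] * by simp
next
  case (den_Abort \<Gamma> t f A)
  show ?case using den_Abort.IH[OF den_Abort.prems] by simp
next
  case (den_In1 \<Gamma> t A f B)
  note d = rel_env_in_dom[OF den_In1.prems(2,1) denotes.den_In1[OF den_In1.hyps]]
  show ?case using d den_In1.IH[OF den_In1.prems] by auto
next
  case (den_In2 \<Gamma> t B f A)
  note d = rel_env_in_dom[OF den_In2.prems(2,1) denotes.den_In2[OF den_In2.hyps]]
  show ?case using d den_In2.IH[OF den_In2.prems] by auto
next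
  case (den_Case \<Gamma> t A B f u C g v h)
  note ty = rel_env_typing[OF den_Case.prems(2) denotes_typing[OF denotes.den_Case[OF den_Case.hyps]]]
  from den_Case.IH(1)[OF den_Case.prems]
  consider b p where "f i \<gamma> = vin 1 b" "sub s t \<Zsurj> In1 p" "logrel A i b p"
    | b p where "f i \<gamma> = vin 2 b" "sub s t \<Zsurj> In2 p" "logrel B i b p" by auto
  then show ?case
  proof cases
    case 1
    have "logrel C i (g i (b # \<gamma>)) (sub (env_sub [p] s) u)"
      by (rule den_Case.IH(2)[OF den_Case.prems(1) rel_env_Cons[OF den_Case.prems(2) 1(3)]])
    then show ?thesis using logrel_steps[OF elim_steps(3)[OF 1(2), of s u v]] ty 1(1) by simp
  next
    case 2
    have "logrel C i (h i (b # \<gamma>)) (sub (env_sub [p] s) v)"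
      by (rule den_Case.IH(3)[OF den_Case.prems(1) rel_env_Cons[OF den_Case.prems(2) 2(3)]])
    then show ?thesis using logrel_steps[OF elim_steps(4)[OF 2(2), of s u v]] ty 2(1) by simp
  qed
next
  case (den_Lam A \<Gamma> t B f)
  note d = rel_env_in_dom[OF den_Lam.prems(2,1) denotes.den_Lam[OF den_Lam.hyps]]
  let ?F = "tup (cden A) i (\<lambda>j a. f j (a # restrict_env \<Gamma> i j \<gamma>))"
  have "logrel B j (ev ?F j b) (inst (sub (lift_sub 1 s) t) [u])" if j: "j \<in> {1..i}" and b: "logrel A j b u" for j b u
  proof -
    have "rel_env (A # \<Gamma>) j (b # restrict_env \<Gamma> i j \<gamma>) (env_sub [u] s)"
      using j by (intro rel_env_Cons rel_env_restrict den_Lam.prems b) auto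
    then have "logrel B j (f j (b # restrict_env \<Gamma> i j \<gamma>)) (sub (env_sub [u] s) t)"
      using j by (intro den_Lam.IH) auto
    \<comment> \<open>A coded function can be evaluated only inside its domain; membership of b is
      part of \<open>logrel\<close>.\<close>
    moreover have "ev ?F j b = f j (b # restrict_env \<Gamma> i j \<gamma>)"
      using j in_dom_elt[OF logrel_in_dom[OF b]] by (intro ev_tup) auto
    ultimately show ?thesis by (simp only: inst_lift_sub_1)
  qed
  then show ?case using d by (auto simp del: vproj_vtuple)
next
  case (den_App \<Gamma> t A B f u g)
  note ty = rel_env_typing[OF den_App.prems(2) denotes_typing[OF denotes.den_App[OF den_App.hyps]]]
  obtain p where p: "sub s t \<Zsurj> Lam p"
    "\<And>j b u. j \<in> {1..i} \<Longrightarrow> logrel A j b u \<Longrightarrow> logrel B j (ev (f i \<gamma>) j b) (inst p [u])"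
    using den_App.IH(1)[OF den_App.prems] by auto
  have "logrel B i (ev (f i \<gamma>) i (g i \<gamma>)) (inst p [sub s u])"
    using p(2) den_App.IH(2)[OF den_App.prems] den_App.prems(1) by simp
  then show ?case using logrel_steps[OF elim_steps(5)[OF p(1)]] ty by simp
next
  case (den_Fold \<Gamma> t A f)
  note d = rel_env_in_dom[OF den_Fold.prems(2,1) denotes.den_Fold[OF den_Fold.hyps]]
  note r = den_Fold.IH[OF den_Fold.prems]
  have "unfold_iso A i (fold_iso A i (f i \<gamma>)) = f i \<gamma>"
    using fold_iso(2)[OF den_Fold.hyps(2) den_Fold.prems(1)] in_dom_elt[OF logrel_in_dom[OF r]] by blast
  then show ?case using d r by auto
next
  case (den_Unfold \<Gamma> t A f)
  note ty = rel_env_typing[OF den_Unfold.prems(2) denotes_typing[OF denotes.den_Unfold[OF den_Unfold.hyps]]]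
  obtain u where u: "sub s t \<Zsurj> Fold u" "logrel (tinst A (TMu A)) i (unfold_iso A i (f i \<gamma>)) u"
    using den_Unfold.IH[OF den_Unfold.prems] by auto
  then show ?case using logrel_steps[OF elim_steps(6)[OF u(1)]] ty by simp
next
  case (den_Next \<Gamma> t A f)
  note d = rel_env_in_dom[OF den_Next.prems(2,1) denotes.den_Next[OF den_Next.hyps]]
  show ?case using d logrel_pred[OF den_Next.IH[OF den_Next.prems]] by auto
next
  case (den_Prev As \<sigma> fs \<Gamma> t A f)
  have "denotes \<Gamma> (Prev \<sigma> t) A (\<lambda>i \<gamma>. f (Suc i) (transport_env As i (Suc i) (map (\<lambda>g. g i \<gamma>) fs)))"
    using den_Prev by (intro denotes.den_Prev) auto
  note ty = rel_env_typing[OF den_Prev.prems(2) denotes_typing[OF this]]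
  \<comment> \<open>The environment is transported to stage i + 1, since the relation at
    \<open>TLater A\<close> there speaks of A at stage i.\<close>
  have "rel_env As (Suc i) (transport_env As i (Suc i) (map (\<lambda>g. g i \<gamma>) fs)) (env_sub (map (sub s) \<sigma>) s)"
    using den_Prev by (intro rel_env_transport) auto
  then have "logrel (TLater A) (Suc i) (f (Suc i) (transport_env As i (Suc i) (map (\<lambda>g. g i \<gamma>) fs))) (sub (env_sub (map (sub s) \<sigma>) s) t)"
    by (intro den_Prev.IH(2)) auto
  then obtain u where u: "sub (env_sub (map (sub s) \<sigma>) s) t \<Zsurj> Next u"
    "logrel A i (f (Suc i) (transport_env As i (Suc i) (map (\<lambda>g. g i \<gamma>) fs))) u"
    using den_Prev.prems(1) by (auto simp: diff_Suc_1)
  then show ?case using logrel_steps[OF Prev_elim[of _ "length \<sigma>", OF _ u(1)]] ty by simp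
next
  case (den_Ast \<Gamma> t A B f u g)
  note d = rel_env_in_dom[OF den_Ast.prems(2,1) denotes.den_Ast[OF den_Ast.hyps]]
  obtain p where p: "sub s t \<Zsurj> Next p" "1 < i \<longrightarrow> logrel (TFun A B) (i - 1) (f i \<gamma>) p"
    using den_Ast.IH(1)[OF den_Ast.prems] by auto
  obtain q where q: "sub s u \<Zsurj> Next q" "1 < i \<longrightarrow> logrel A (i - 1) (g i \<gamma>) q"
    using den_Ast.IH(2)[OF den_Ast.prems] by auto
  have "logrel B (i - 1) (ev (f i \<gamma>) (i - 1) (g i \<gamma>)) (App p q)" if i: "1 < i"
  proof -
    have pq: "logrel (TFun A B) (i - 1) (f i \<gamma>) p" "logrel A (i - 1) (g i \<gamma>) q" using p(2) q(2) i by auto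
    then obtain p' where p': "p \<Zsurj> Lam p'" "logrel B (i - 1) (ev (f i \<gamma>) (i - 1) (g i \<gamma>)) (inst p' [q])"
      using i by auto
    have "[] \<turnstile> App p q \<Ztypecolon> B"
      using pq[THEN logrel_in_dom, THEN in_dom_elt] by (auto intro: ty_App)
    then show ?thesis by (rule logrel_steps[OF elim_steps(5)[OF p'(1)] _ p'(2)])
  qed
  then show ?case using d elim_steps(8)[OF p(1) q(1)] by auto
next
  case (den_Box As \<sigma> fs \<Gamma> t A f)
  have "denotes \<Gamma> (Box \<sigma> t) (TBox A) (\<lambda>i \<gamma>. vtuple {1..} (\<lambda>j. f j (transport_env As i j (map (\<lambda>g. g i \<gamma>) fs))))"
    using den_Box by (intro denotes.den_Box) auto
  note d = rel_env_in_dom[OF den_Box.prems(2,1) this]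
  have "rel_env As j (transport_env As i j (map (\<lambda>g. g i \<gamma>) fs)) (env_sub (map (sub s) \<sigma>) s)" if "1 \<le> j" for j
    using den_Box that by (intro rel_env_transport) auto
  then have "logrel A j (f j (transport_env As i j (map (\<lambda>g. g i \<gamma>) fs))) (sub (env_sub (map (sub s) \<sigma>) s) t)" if "1 \<le> j" for j
    using that by (intro den_Box.IH(2)) auto
  then show ?case using d Box_steps[of "map (sub s) \<sigma>" "length \<sigma>" s t] by auto
next
  case (den_Unbox \<Gamma> t A f)
  note ty = rel_env_typing[OF den_Unbox.prems(2) denotes_typing[OF denotes.den_Unbox[OF den_Unbox.hyps]]]
  obtain u where u: "sub s t \<Zsurj> Box [] u" "\<And>j. j \<in> {1..} \<Longrightarrow> logrel A j (vproj (f i \<gamma>) j) u"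
    using den_Unbox.IH[OF den_Unbox.prems] by auto
  then show ?case using ty den_Unbox.prems(1) by (auto intro: logrel_steps[OF elim_steps(7)[OF u(1)]])
next
  case (den_BoxP As \<sigma> fs \<Gamma> t A B f)
  let ?G = "\<lambda>i \<gamma> j. f j (transport_env As i j (map (\<lambda>g. g i \<gamma>) fs))"
  let ?T = "\<lambda>i \<gamma>. THE b. \<exists>d a. (\<forall>j\<ge>1. ?G i \<gamma> j = vin d (a j)) \<and> b = vin d (vtuple {1..} a)"
  let ?t = "sub (env_sub (map (sub s) \<sigma>) s) t"
  have "denotes \<Gamma> (BoxP \<sigma> t) (TSum (TBox A) (TBox B)) ?T"
    using den_BoxP by (intro denotes.den_BoxP) auto
  note d = rel_env_in_dom[OF den_BoxP.prems(2,1) this]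
  have ty: "As \<turnstile> t \<Ztypecolon> TSum A B" by (rule denotes_typing[OF den_BoxP.hyps(3)])
  have "rel_env As j (transport_env As i j (map (\<lambda>g. g i \<gamma>) fs)) (env_sub (map (sub s) \<sigma>) s)" if "1 \<le> j" for j
    using den_BoxP that by (intro rel_env_transport) auto
  then have r: "logrel (TSum A B) j (?G i \<gamma> j) ?t" if "1 \<le> j" for j
    using that by (intro den_BoxP.IH(2)) auto
  note elim = BoxP_elim[of "map (sub s) \<sigma>" "length \<sigma>" s t]
  from r[of 1] consider u where "?t \<Zsurj> In1 u" | u where "?t \<Zsurj> In2 u" by auto
  then show ?case
  proof cases
    case 1
    \<comment> \<open>The semantic component varies with j, while by confluence the term component
      is always the u found at stage 1.\<close>
    have "\<exists>a. ?G i \<gamma> j = vin 1 a \<and> logrel A j a u" if "1 \<le> j" for j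
      using r[OF that] steps_In_unique(1,3)[OF 1] by auto
    then obtain a where a: "\<And>j. 1 \<le> j \<Longrightarrow> ?G i \<gamma> j = vin 1 (a j) \<and> logrel A j (a j) u" by metis
    have T: "?T i \<gamma> = vin 1 (vtuple {1..} a)" by (rule THE_BoxP) (use a in blast)
    \<comment> \<open>Membership of the tuple is contained in d; the type of the reduct u is
      supplied by the relation at stage 1.\<close>
    have "in_dom (TBox A) i (vtuple {1..} a) (Box [] u)"
      using d in_dom_elt[OF logrel_in_dom[OF conjunct2[OF a[of 1]]]]
      unfolding T by (auto simp: in_dom_def elts_sum intro!: ty_Box[of "[]"])
    then have "logrel (TBox A) i (vtuple {1..} a) (Box [] u)" using a by auto
    with d elim(1)[OF _ 1] show ?thesis
      unfolding T by (auto simp del: logrel.simps(10))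
  next
    case 2
    have no_In1: "\<not> ?t \<Zsurj> In1 v" for v using steps_In_unique(3)[of ?t v u] 2 by blast
    have "\<exists>a. ?G i \<gamma> j = vin 2 a \<and> logrel B j a u" if "1 \<le> j" for j
    proof -
      obtain a w where "?G i \<gamma> j = vin 2 a" "?t \<Zsurj> In2 w" "logrel B j a w"
        using r[OF \<open>1 \<le> j\<close>] no_In1 by auto
      then show ?thesis using steps_In_unique(2)[OF 2] by blast
    qed
    then obtain a where a: "\<And>j. 1 \<le> j \<Longrightarrow> ?G i \<gamma> j = vin 2 (a j) \<and> logrel B j (a j) u" by metis
    have T: "?T i \<gamma> = vin 2 (vtuple {1..} a)" by (rule THE_BoxP) (use a in blast)
    have "in_dom (TBox B) i (vtuple {1..} a) (Box [] u)"
      using d in_dom_elt[OF logrel_in_dom[OF conjunct2[OF a[of 1]]]]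
      unfolding T by (auto simp: in_dom_def elts_sum intro!: ty_Box[of "[]"])
    then have "logrel (TBox B) i (vtuple {1..} a) (Box [] u)" using a by auto
    with d elim(2)[OF _ 2] show ?thesis
      unfolding T by (auto simp del: logrel.simps(10))
  qed
qed

lemma adequacy: "denotes [] t A f \<Longrightarrow> 1 \<le> i \<Longrightarrow> logrel A i (f i [] :: 'v) t"
  using logrel_fundamental[of "[]" t A f i "[]" Var] by (simp add: rel_env_def sub_Var)

lemma adequacy_nat:
  assumes "denotes [] t TNat f" "1 \<le> i" "f i [] = (vnat n :: 'v)"
  shows "t \<Zsurj> (Succ ^^ n) Zero"
  using adequacy[OF assms(1,2)] assms(3) by auto

end

theorem theorem2p17:
  shows "(zf_universe TYPE('v::elts) \<longrightarrow>
      (\<forall>t A. [] \<turnstile> t \<Ztypecolon> A \<longrightarrow>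
         (\<exists>f :: nat \<Rightarrow> 'v list \<Rightarrow> 'v. denotes [] t A f) \<and>
         (\<forall>f :: nat \<Rightarrow> 'v list \<Rightarrow> 'v. denotes [] t A f \<longrightarrow> (\<forall>i\<ge>1. logrel A i (f i []) t))) \<and>
      (\<forall>t n i (f :: nat \<Rightarrow> 'v list \<Rightarrow> 'v).
         [] \<turnstile> t \<Ztypecolon> TNat \<and> denotes [] t TNat f \<and> 1 \<le> i \<and> f i [] = vnat n \<longrightarrow>
         t \<Zsurj> (Succ ^^ n) Zero)) \<and>
    (\<forall>t A. [] \<turnstile> t \<Ztypecolon> A \<longrightarrow> (\<exists>v. val v \<and> t \<Zsurj> v))"
proof (intro conjI impI)
  assume "zf_universe TYPE('v)"
  then interpret zf_model "TYPE('v)" by unfold_locales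
  show "\<forall>t A. [] \<turnstile> t \<Ztypecolon> A \<longrightarrow>
         (\<exists>f :: nat \<Rightarrow> 'v list \<Rightarrow> 'v. denotes [] t A f) \<and>
         (\<forall>f :: nat \<Rightarrow> 'v list \<Rightarrow> 'v. denotes [] t A f \<longrightarrow> (\<forall>i\<ge>1. logrel A i (f i []) t))"
    using typing_denotes adequacy by blast
  show "\<forall>t n i (f :: nat \<Rightarrow> 'v list \<Rightarrow> 'v).
         [] \<turnstile> t \<Ztypecolon> TNat \<and> denotes [] t TNat f \<and> 1 \<le> i \<and> f i [] = vnat n \<longrightarrow>
         t \<Zsurj> (Succ ^^ n) Zero"
    using adequacy_nat by blast
qed (use normalisation in blast)

end
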